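(* Let $W\subseteq\Lambda^2(\mathbb R^n)^*\otimes\mathbb R^n$ be an $A_\gamma$-nice space and let $(N_\mu,\gamma)$ be a class-$\gamma$ nilpotent Lie group with $\mu\in W$, $\mu\neq0$. Then $(N_\mu,\gamma)$ admits a compatible minimal metric if and only if the equation $$\boldsymbol U^\gamma_\mu[x_i]=\lambda[1]$$ has a positive solution $[x_i]$ (i.e. all $x_i>0$) for some $\lambda\in\mathbb R$, where $\boldsymbol U^\gamma_\mu$ is the Gram matrix of $(\mathfrak R_\gamma(\mu),\langle\!\langle\cdot,\cdot\rangle\!\rangle)$ and $[1]$ is the column vector with all entries $1$.
   Context: Group action and inner products. $V=\Lambda^2(\mathbb R^n)^*\otimes\mathbb R^n$ is the space of skew-symmetric bilinear maps $\mathbb R^n\times\mathbb R^n\to\mathbb R^n$; $\mathrm{GL}_n(\mathbb R)$ acts by $g\cdot\mu(X,Y)=g\mu(g^{-1}X,g^{-1}Y)$, with differential $\pi(B)\mu(X,Y)=B\mu(X,Y)-\mu(BX,Y)-\mu(X,BY)$. $\mathfrak{gl}_n(\mathbb R)$ has inner product $\langle\!\langle X,Y\rangle\!\rangle=\operatorname{tr}(XY^T)$; $V$ has inner product $\langle\mu,\lambda\rangle=\sum_{i,j,k}\langle\mu(e_i,e_j),e_k\rangle\langle\lambda(e_i,e_j),e_k\rangle$, where $\langle\cdot,\cdot\rangle$ on $\mathbb R^n$ is the canonical inner product and $(e_i)$ the canonical basis. Class-$\gamma$ nilpotent Lie groups. $N_\mu$ is the simply connected nilpotent Lie group with Lie algebra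 $(\mathbb R^n,\mu)$, and $\gamma$ is an invariant geometric structure on it, i.e. given by left translation of a tensor (or set of tensors) $\gamma$ on $\mathbb R^n$ satisfying a suitable integrability condition with respect to $\mu$, such that $G_\gamma=\{g\in\mathrm{GL}_n(\mathbb R):g\cdot\gamma=\gamma\}$ is reductive and such that the inner products on $\mathbb R^n$ compatible with $\gamma$ form a single $G_\gamma$-orbit. It is assumed that $\langle\cdot,\cdot\rangle$ is compatible with $\gamma$ (so the compatible inner products are $\langle g\,\cdot,g\,\cdot\rangle$, $g\in G_\gamma$) and that $G_\gamma$ is self-adjoint with respect to $\langle\cdot,\cdot\rangle$, so that $G_\gamma=K_\gamma\exp(\mathfrak p_\gamma)$ with $K_\gamma=G_\gamma\cap\mathrm O(n)$ maximal compact and $\mathfrak p_\gamma=\mathfrak g_\gamma\cap\operatorname{sym}(n)$, $\mathfrak g_\gamma=\operatorname{Lie}(G_\gamma)$. Minimal metrics. A compatible metric is the left invariant Riemannian metric on $N_\mu$ defined by a compatible inner product $(\cdot,\cdot)$; $\mathrm{Ric}^\gamma_{(\cdot,\cdot)}$ denotes the orthogonal projection onto $\mathfrak g_\gamma$ of its Ricci operator $\mathrm{Ric}_{(\cdot,\cdot)}$, relative to the inner product $\operatorname{tr}(XY^{T})$ on $\mathfrak{gl}_n(\mathbb R)$ induced by the metric (transpose with respect to $(\cdot,\cdot)$), and $\operatorname{sc}$ denotes scalar curvature. A compatible metric is minimal if it minimizes $\|\mathrm{Ric}^\gamma\|^2$ among all metrics compatible with $(N_\mu,\gamma)$ having the same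 scalar curvature. Nice spaces. $\mathfrak a$ is the space of diagonal matrices; $\mathfrak a_\gamma=\mathfrak a\cap\mathfrak p_\gamma$, which is taken to be an abelian subalgebra of $\mathfrak g_\gamma$ maximal in $\mathfrak p_\gamma$; $A_\gamma=\exp(\mathfrak a_\gamma)$. The moment map $m_{\mathfrak g_\gamma}:V\smallsetminus\{0\}\to\mathfrak p_\gamma$ is given by $\langle\!\langle m_{\mathfrak g_\gamma}(v),X\rangle\!\rangle=\frac1{\|v\|^2}\langle\pi(X)v,v\rangle$ for all $X\in\mathfrak p_\gamma$. A vector subspace $W\subseteq V$ is $A_\gamma$-nice if it is $A_\gamma$-invariant and $m_{\mathfrak g_\gamma}(w)\in\mathfrak a_\gamma$ for all $w\in W\smallsetminus\{0\}$. Weights. For $\mu\neq0$, $\mathfrak R(\mu)=\{E_{kk}-E_{ii}-E_{jj}: i<j,\ \langle\mu(e_i,e_j),e_k\rangle\neq0\}$ is the set of weights related with $\mu$ for $\mathrm{GL}_n(\mathbb R)$, and $\mathfrak R_\gamma(\mu)=\operatorname{Proj}_{\mathfrak a_\gamma}\mathfrak R(\mu)$ (orthogonal projection), an ordered finite set of distinct elements. Its Gram matrix is $\boldsymbol U^\gamma_\mu(p,q)=\langle\!\langle\mathfrak R_\gamma(\mu)_p,\mathfrak R_\gamma(\mu)_q\rangle\!\rangle$.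
   Formalization: A minimal metric is compared with all positive multiples of compatible metrics having the same scalar curvature, not only with compatible metrics; the two agree if G_γ contains the homotheties, and without this change the equivalence fails for some γ. *)

theory Defs
  imports "HOL-Analysis.Analysis"
begin

section \<open>Matrices\<close>

type_synonym 'n mat = "real^'n^'n"

definition mat_inner :: "'n::finite mat \<Rightarrow> 'n mat \<Rightarrow> real" where
  "mat_inner X Y = trace (X ** transpose Y)"

definition mat_pow :: "'n::finite mat \<Rightarrow> nat \<Rightarrow> 'n mat" where
  "mat_pow X k = ((\<lambda>Y. X ** Y) ^^ k) (mat 1)"

text \<open>The library's \<open>exp\<close> needs a Banach algebra; multiplication on \<open>real^'n^'n\<close> is \<open>**\<close>,
  not the componentwise class operation \<open>*\<close>, so the exponential series is written out.\<close>

definition mat_exp :: "'n::finite mat \<Rightarrow> 'n mat" where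
  "mat_exp X = (\<Sum>k. mat_pow X k /\<^sub>R fact k)"

definition diagonal_matrices :: "'n::finite mat set" where
  "diagonal_matrices = {X. \<forall>i j. i \<noteq> j \<longrightarrow> X $ i $ j = 0}"

definition diag_unit :: "'n::finite \<Rightarrow> 'n mat" where
  "diag_unit k = (\<chi> i j. if i = k \<and> j = k then 1 else 0)"

definition symmetric_matrices :: "'n::finite mat set" where
  "symmetric_matrices = {X. transpose X = X}"

text \<open>Orthogonal projection of \<open>X\<close> onto the subspace \<open>S\<close>, relative to the inner product \<open>B\<close>.\<close>

definition orth_proj :: "('n::finite mat \<Rightarrow> 'n mat \<Rightarrow> real) \<Rightarrow> 'n mat set \<Rightarrow> 'n mat \<Rightarrow> 'n mat" where
  "orth_proj B S X = (THE P. P \<in> S \<and> (\<forall>Y\<in>S. B (X - P) Y = 0))"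

section \<open>Linear groups\<close>

definition unipotent :: "'n::finite mat \<Rightarrow> bool" where
  "unipotent u \<longleftrightarrow> (\<exists>k. mat_pow (u - mat 1) k = 0)"

definition normal_subgroup_of :: "'n::finite mat set \<Rightarrow> 'n mat set \<Rightarrow> bool" where
  "normal_subgroup_of U G \<longleftrightarrow> U \<subseteq> G \<and> mat 1 \<in> U \<and> (\<forall>u\<in>U. \<forall>v\<in>U. u ** v \<in> U) \<and>
     (\<forall>u\<in>U. matrix_inv u \<in> U) \<and> (\<forall>g\<in>G. \<forall>u\<in>U. g ** u ** matrix_inv g \<in> U)"

text \<open>For a linear algebraic group over the reals: trivial unipotent radical.  Closedness and
  connectedness of \<open>U\<close> need not be required, since the Zariski closure of a normal unipotent
  subgroup is again normal and unipotent, and unipotent groups are connected in characteristic 0.\<close>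

definition reductive_group :: "'n::finite mat set \<Rightarrow> bool" where
  "reductive_group G \<longleftrightarrow>
     (\<forall>U. normal_subgroup_of U G \<and> (\<forall>u\<in>U. unipotent u) \<longrightarrow> U = {mat 1})"

definition self_adjoint_group :: "'n::finite mat set \<Rightarrow> bool" where
  "self_adjoint_group G \<longleftrightarrow> (\<forall>g\<in>G. transpose g \<in> G)"

definition lie_algebra_of :: "'n::finite mat set \<Rightarrow> 'n mat set" where
  "lie_algebra_of G = {X. \<forall>t::real. mat_exp (t *\<^sub>R X) \<in> G}"

section \<open>Tensors and their stabilizers\<close>

text \<open>A tensor of type \<open>(r, s)\<close> is a function of \<open>r\<close> vectors and \<open>s\<close> covectors; covectors are
  identified with vectors through the canonical inner product, so that \<open>g\<close> acts on them by the
  inverse transpose.\<close>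

type_synonym 'n tensor = "(real^'n) list \<Rightarrow> (real^'n) list \<Rightarrow> real"

definition is_tensor :: "'n::finite tensor \<Rightarrow> bool" where
  "is_tensor T \<longleftrightarrow> (\<exists>r s.
     (\<forall>xs as. length xs = r \<and> length as = s \<longrightarrow>
        (\<forall>i<r. linear (\<lambda>x. T (xs[i := x]) as)) \<and> (\<forall>i<s. linear (\<lambda>a. T xs (as[i := a])))) \<and>
     (\<forall>xs as. \<not> (length xs = r \<and> length as = s) \<longrightarrow> T xs as = 0))"

definition tensor_act :: "'n::finite mat \<Rightarrow> 'n tensor \<Rightarrow> 'n tensor" where
  "tensor_act g T = (\<lambda>xs as. T (map (\<lambda>x. matrix_inv g *v x) xs) (map (\<lambda>a. transpose g *v a) as))"

text \<open>The group \<open>G\<^sub>\<gamma>\<close>; a set of tensors is fixed elementwise.\<close>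

definition stabilizer :: "'n::finite tensor set \<Rightarrow> 'n mat set" where
  "stabilizer \<gamma> = {g. invertible g \<and> (\<forall>T\<in>\<gamma>. tensor_act g T = T)}"

text \<open>\<open>g\<^sub>\<gamma>\<close>, \<open>p\<^sub>\<gamma>\<close>, \<open>a\<^sub>\<gamma>\<close> and \<open>A\<^sub>\<gamma>\<close>\<close>

definition gl_gamma :: "'n::finite tensor set \<Rightarrow> 'n mat set" where
  "gl_gamma \<gamma> = lie_algebra_of (stabilizer \<gamma>)"

definition p_gamma :: "'n::finite tensor set \<Rightarrow> 'n mat set" where
  "p_gamma \<gamma> = gl_gamma \<gamma> \<inter> symmetric_matrices"

definition a_gamma :: "'n::finite tensor set \<Rightarrow> 'n mat set" where
  "a_gamma \<gamma> = diagonal_matrices \<inter> p_gamma \<gamma>"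

definition A_gamma :: "'n::finite tensor set \<Rightarrow> 'n mat set" where
  "A_gamma \<gamma> = mat_exp ` a_gamma \<gamma>"

definition abelian_subalgebra :: "'n::finite mat set \<Rightarrow> bool" where
  "abelian_subalgebra b \<longleftrightarrow> subspace b \<and> (\<forall>X\<in>b. \<forall>Y\<in>b. X ** Y = Y ** X)"

definition maximal_abelian_in :: "'n::finite mat set \<Rightarrow> 'n mat set \<Rightarrow> bool" where
  "maximal_abelian_in b p \<longleftrightarrow> b \<subseteq> p \<and> abelian_subalgebra b \<and>
     (\<forall>c. c \<subseteq> p \<and> abelian_subalgebra c \<and> b \<subseteq> c \<longrightarrow> c = b)"

section \<open>The space of skew-symmetric bilinear maps\<close>

type_synonym 'n bracket = "real^'n \<Rightarrow> real^'n \<Rightarrow> real^'n"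

definition skew_bilinear :: "'n::finite bracket set" where
  "skew_bilinear = {\<mu>. bilinear \<mu> \<and> (\<forall>X Y. \<mu> X Y = - \<mu> Y X)}"

definition bracket_act :: "'n::finite mat \<Rightarrow> 'n bracket \<Rightarrow> 'n bracket" where
  "bracket_act g \<mu> = (\<lambda>X Y. g *v \<mu> (matrix_inv g *v X) (matrix_inv g *v Y))"

definition bracket_der :: "'n::finite mat \<Rightarrow> 'n bracket \<Rightarrow> 'n bracket" where
  "bracket_der B \<mu> = (\<lambda>X Y. B *v \<mu> X Y - \<mu> (B *v X) Y - \<mu> X (B *v Y))"

definition bracket_inner :: "'n::finite bracket \<Rightarrow> 'n bracket \<Rightarrow> real" where
  "bracket_inner \<mu> \<nu> = (\<Sum>i\<in>UNIV. \<Sum>j\<in>UNIV. \<Sum>k\<in>UNIV.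
     (\<mu> (axis i 1) (axis j 1) \<bullet> axis k 1) * (\<nu> (axis i 1) (axis j 1) \<bullet> axis k 1))"

definition bracket_subspace :: "'n::finite bracket set \<Rightarrow> bool" where
  "bracket_subspace W \<longleftrightarrow> W \<subseteq> skew_bilinear \<and> (\<lambda>X Y. 0) \<in> W \<and>
     (\<forall>\<mu>\<in>W. \<forall>\<nu>\<in>W. (\<lambda>X Y. \<mu> X Y + \<nu> X Y) \<in> W) \<and>
     (\<forall>c::real. \<forall>\<mu>\<in>W. (\<lambda>X Y. c *\<^sub>R \<mu> X Y) \<in> W)"

definition moment_map :: "'n::finite tensor set \<Rightarrow> 'n bracket \<Rightarrow> 'n mat" where
  "moment_map \<gamma> v = (THE M. M \<in> p_gamma \<gamma> \<and>
     (\<forall>X\<in>p_gamma \<gamma>. mat_inner M X = bracket_inner (bracket_der X v) v / bracket_inner v v))"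

definition nice_space :: "'n::finite tensor set \<Rightarrow> 'n bracket set \<Rightarrow> bool" where
  "nice_space \<gamma> W \<longleftrightarrow> bracket_subspace W \<and>
     (\<forall>a\<in>A_gamma \<gamma>. \<forall>w\<in>W. bracket_act a w \<in> W) \<and>
     (\<forall>w\<in>W. w \<noteq> (\<lambda>X Y. 0) \<longrightarrow> moment_map \<gamma> w \<in> a_gamma \<gamma>)"

section \<open>Left invariant metrics\<close>

type_synonym 'n form = "real^'n \<Rightarrow> real^'n \<Rightarrow> real"

definition inner_product :: "'n::finite form \<Rightarrow> bool" where
  "inner_product ip \<longleftrightarrow> bilinear ip \<and> (\<forall>X Y. ip X Y = ip Y X) \<and> (\<forall>X. X \<noteq> 0 \<longrightarrow> ip X X > 0)"

definition adjoint_wrt :: "'n::finite form \<Rightarrow> 'n mat \<Rightarrow> 'n mat" where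
  "adjoint_wrt ip X = (THE Y. \<forall>u v. ip (X *v u) v = ip u (Y *v v))"

definition mat_inner_wrt :: "'n::finite form \<Rightarrow> 'n mat \<Rightarrow> 'n mat \<Rightarrow> real" where
  "mat_inner_wrt ip X Y = trace (X ** adjoint_wrt ip Y)"

text \<open>The simply connected Lie group with Lie algebra \<open>\<mu>\<close> enters only through the curvature of
  its left invariant metrics, which is computed on left invariant vector fields.  For these, the
  terms of the Koszul formula differentiating inner products vanish.\<close>

definition levi_civita :: "'n::finite form \<Rightarrow> 'n bracket \<Rightarrow> 'n bracket" where
  "levi_civita ip \<mu> X Y = (THE D. \<forall>Z. 2 * ip D Z = ip (\<mu> X Y) Z - ip (\<mu> Y Z) X + ip (\<mu> Z X) Y)"

definition curvature ::
    "'n::finite form \<Rightarrow> 'n bracket \<Rightarrow> real^'n \<Rightarrow> real^'n \<Rightarrow> real^'n \<Rightarrow> real^'n" where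
  "curvature ip \<mu> X Y Z =
     levi_civita ip \<mu> X (levi_civita ip \<mu> Y Z) - levi_civita ip \<mu> Y (levi_civita ip \<mu> X Z)
       - levi_civita ip \<mu> (\<mu> X Y) Z"

definition ricci_tensor :: "'n::finite form \<Rightarrow> 'n bracket \<Rightarrow> 'n form" where
  "ricci_tensor ip \<mu> Y Z = trace (matrix (\<lambda>X. curvature ip \<mu> X Y Z))"

definition ricci_operator :: "'n::finite form \<Rightarrow> 'n bracket \<Rightarrow> 'n mat" where
  "ricci_operator ip \<mu> = (THE R. \<forall>Y Z. ip (R *v Y) Z = ricci_tensor ip \<mu> Y Z)"

definition scalar_curvature :: "'n::finite form \<Rightarrow> 'n bracket \<Rightarrow> real" where
  "scalar_curvature ip \<mu> = trace (ricci_operator ip \<mu>)"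

definition ricci_gamma :: "'n::finite tensor set \<Rightarrow> 'n form \<Rightarrow> 'n bracket \<Rightarrow> 'n mat" where
  "ricci_gamma \<gamma> ip \<mu> = orth_proj (mat_inner_wrt ip) (gl_gamma \<gamma>) (ricci_operator ip \<mu>)"

definition ricci_gamma_norm2 :: "'n::finite tensor set \<Rightarrow> 'n form \<Rightarrow> 'n bracket \<Rightarrow> real" where
  "ricci_gamma_norm2 \<gamma> ip \<mu> = mat_inner_wrt ip (ricci_gamma \<gamma> ip \<mu>) (ricci_gamma \<gamma> ip \<mu>)"

section \<open>Class-\<open>\<gamma>\<close> nilpotent Lie groups\<close>

definition lie_bracket :: "'n::finite bracket \<Rightarrow> bool" where
  "lie_bracket \<mu> \<longleftrightarrow> \<mu> \<in> skew_bilinear \<and>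
     (\<forall>X Y Z. \<mu> X (\<mu> Y Z) + \<mu> Y (\<mu> Z X) + \<mu> Z (\<mu> X Y) = 0)"

fun lower_central :: "'n::finite bracket \<Rightarrow> nat \<Rightarrow> (real^'n) set" where
  "lower_central \<mu> 0 = UNIV"
| "lower_central \<mu> (Suc k) = span {\<mu> X Y | X Y. Y \<in> lower_central \<mu> k}"

definition nilpotent_lie_bracket :: "'n::finite bracket \<Rightarrow> bool" where
  "nilpotent_lie_bracket \<mu> \<longleftrightarrow> lie_bracket \<mu> \<and> (\<exists>k. lower_central \<mu> k = {0})"

definition pullback :: "'n::finite form \<Rightarrow> 'n mat \<Rightarrow> 'n form" where
  "pullback ip g = (\<lambda>X Y. ip (g *v X) (g *v Y))"

definition single_orbit :: "'n::finite mat set \<Rightarrow> 'n form set \<Rightarrow> bool" where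
  "single_orbit G C \<longleftrightarrow> (\<exists>ip\<in>C. C = pullback ip ` G)"

text \<open>The integrability condition \<open>integ\<close> and the compatibility relation depend on the kind of
  geometric structure and are left abstract; \<open>C\<close> is the set of inner products compatible
  with \<open>\<gamma>\<close>.\<close>

definition class_gamma_nilpotent ::
    "('n::finite tensor set \<Rightarrow> 'n bracket \<Rightarrow> bool) \<Rightarrow> 'n form set \<Rightarrow>
     'n tensor set \<Rightarrow> 'n bracket \<Rightarrow> bool" where
  "class_gamma_nilpotent integ C \<gamma> \<mu> \<longleftrightarrow>
     nilpotent_lie_bracket \<mu> \<and> (\<forall>T\<in>\<gamma>. is_tensor T) \<and> integ \<gamma> \<mu> \<and>
     reductive_group (stabilizer \<gamma>) \<and>
     (\<forall>ip\<in>C. inner_product ip) \<and> single_orbit (stabilizer \<gamma>) C"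

definition rescalings :: "'n::finite form set \<Rightarrow> 'n form set" where
  "rescalings C = {\<lambda>X Y. c * ip X Y | c ip. c > 0 \<and> ip \<in> C}"

text \<open>A compatible metric is compared with all metrics of the same scalar curvature which are
  compatible up to a homothety.  If \<open>G\<^sub>\<gamma>\<close> contains the homotheties, these are just the compatible
  metrics (lemma \<open>rescalings_eq\<close>).  If it does not (as for symplectic structures), fixing the
  scalar curvature is a normalization of scale, and must be read in this way: the compatible
  metrics proper with a prescribed scalar curvature may even reduce to a single one.\<close>

definition minimal_metric ::
    "'n::finite form set \<Rightarrow> 'n tensor set \<Rightarrow> 'n bracket \<Rightarrow> 'n form \<Rightarrow> bool" where
  "minimal_metric C \<gamma> \<mu> ip \<longleftrightarrow> ip \<in> C \<and>
     (\<forall>ip'\<in>rescalings C. scalar_curvature ip' \<mu> = scalar_curvature ip \<mu> \<longrightarrow>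
        ricci_gamma_norm2 \<gamma> ip \<mu> \<le> ricci_gamma_norm2 \<gamma> ip' \<mu>)"

lemma matrix_inv_both:
  fixes g :: "'n::finite mat"
  assumes "invertible g"
  shows "g ** matrix_inv g = mat 1" "matrix_inv g ** g = mat 1"
  using someI_ex [OF assms [unfolded invertible_def]] by (simp_all add: matrix_inv_def)

lemma stabilizer_mult:
  fixes g h :: "'n::finite mat"
  assumes g: "g \<in> stabilizer \<gamma>" and h: "h \<in> stabilizer \<gamma>"
  shows "g ** h \<in> stabilizer \<gamma>"
proof -
  have ig: "invertible g" and ih: "invertible h"
    using g h by (auto simp: stabilizer_def)
  have inv: "matrix_inv (g ** h) = matrix_inv h ** matrix_inv g"
    using matrix_inv_both [OF ig] matrix_inv_both [OF ih] matrix_inv_both [OF invertible_mult [OF ig ih]]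
    by (metis matrix_mul_assoc matrix_mul_lid matrix_mul_rid)
  have "tensor_act (g ** h) T = tensor_act g (tensor_act h T)" for T :: "'n tensor"
    by (simp add: tensor_act_def inv matrix_transpose_mul o_def matrix_vector_mul_assoc
        del: transpose_matrix_vector)
  with g h show ?thesis
    by (auto simp: stabilizer_def invertible_mult)
qed

lemma rescalings_eq:
  fixes C :: "'n::finite form set"
  assumes C: "\<forall>ip\<in>C. inner_product ip" "single_orbit (stabilizer \<gamma>) C"
    and hom: "\<forall>r>0. r *\<^sub>R mat 1 \<in> stabilizer \<gamma>"
  shows "rescalings C = C"
proof
  show "C \<subseteq> rescalings C"
    unfolding rescalings_def by (force intro: exI [of _ 1])
  obtain ip where ip: "ip \<in> C" and orb: "C = pullback ip ` stabilizer \<gamma>"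
    using C(2) by (auto simp: single_orbit_def)
  have bil: "bilinear ip"
    using C(1) ip by (auto simp: inner_product_def)
  show "rescalings C \<subseteq> C"
  proof
    fix q assume "q \<in> rescalings C"
    then obtain c g where c: "c > 0" and g: "g \<in> stabilizer \<gamma>"
      and q: "q = (\<lambda>X Y. c * pullback ip g X Y)"
      by (auto simp: rescalings_def orb)
    let ?h = "(sqrt c *\<^sub>R mat 1) ** g"
    have act: "?h *v X = sqrt c *\<^sub>R (g *v X)" for X
      by (simp flip: matrix_vector_mul_assoc scalar_matrix_assoc add: scaleR_matrix_vector_assoc [symmetric])
    have "q = pullback ip ?h"
      using c by (simp add: q pullback_def act bilinear_lmul [OF bil] bilinear_rmul [OF bil] flip: mult.assoc)
    moreover have "?h \<in> stabilizer \<gamma>"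
      using c g hom by (intro stabilizer_mult) auto
    ultimately show "q \<in> C"
      by (auto simp: orb)
  qed
qed

section \<open>Weights\<close>

text \<open>Since \<open>\<mu>\<close> is skew-symmetric, \<open>i \<noteq> j\<close> gives the same set as \<open>i < j\<close>, without an order on
  the index type.\<close>

definition weights :: "'n::finite bracket \<Rightarrow> 'n mat set" where
  "weights \<mu> = {diag_unit k - diag_unit i - diag_unit j | i j k.
     i \<noteq> j \<and> \<mu> (axis i 1) (axis j 1) \<bullet> axis k 1 \<noteq> 0}"

definition weights_gamma :: "'n::finite tensor set \<Rightarrow> 'n bracket \<Rightarrow> 'n mat set" where
  "weights_gamma \<gamma> \<mu> = orth_proj mat_inner (a_gamma \<gamma>) ` weights \<mu>"

text \<open>The Gram matrix depends on the chosen ordering of the weights; indices start at 0.\<close>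

definition gram :: "'n::finite mat list \<Rightarrow> nat \<Rightarrow> nat \<Rightarrow> real" where
  "gram \<beta>s p q = mat_inner (\<beta>s ! p) (\<beta>s ! q)"

end

theory Submission
  imports Defs
begin

text \<open>
  Let \<open>G\<close> be the stabilizer of \<open>\<gamma>\<close>.  A compatible metric is the pullback of the canonical inner
  product under some \<open>g \<in> G\<close>, and it is isometric to the canonical metric on the moved bracket
  \<open>g \<cdot> \<mu>\<close>.  For a nilpotent bracket \<open>w\<close> the Ricci operator of the canonical metric is a quarter of the
  gradient \<open>moment_mat w\<close> of the representation, \<open>moment_mat w \<bullet> X = \<langle>\<pi>(X) w, w\<rangle>\<close>
  (\<open>bracket_der_moment\<close>, \<open>ricci_trace\<close>).  Its projection to the Lie algebra \<open>gl_gamma \<gamma>\<close> is therefore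
  the moment of \<open>w\<close> times the scalar curvature, up to sign, and a minimal metric is the same as a
  minimum of the norm of the moment \<open>m(g \<cdot> \<mu>)\<close> over \<open>g \<in> G\<close> (\<open>minimal_metric_iff_moment\<close>).

  Let \<open>\<beta>\<close> be the point closest to \<open>0\<close> in the convex hull of the projected weights.  Then every
  weight \<open>p\<close> satisfies \<open>p \<bullet> \<beta> \<ge> \<beta> \<bullet> \<beta>\<close>.  The infimum of the norm of the moment over the orbit is
  \<open>norm \<beta>\<close>:

  \<^item> On the orbit of the diagonal group niceness makes the moment diagonal, hence equal to a mean of the
    weights with positive coefficients, the gradient of a convex function of log-sum-exp type
    (\<open>moment_exp\<close>).  Minimizing that function shows that \<open>\<beta>\<close> is a limit of such means
    (\<open>tilted_mean_approx\<close>), and that it is itself one if it lies in the relative interior of the hull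
    (\<open>tilted_mean_attained\<close>).

  \<^item> No \<open>g \<in> G\<close> gives a smaller norm (\<open>norm_moment_ge\<close>).  Write \<open>g = k q\<close> with \<open>k\<close> orthogonal and \<open>q\<close>
    triangular for the order of the diagonal entries of \<open>\<beta>\<close>.  The factor \<open>k\<close> need not lie in \<open>G\<close>, but
    \<open>k \<beta> k\<^sup>T\<close> lies in the Lie algebra (\<open>gl_gamma_flag_conj\<close>).  Acting with \<open>q\<close> can only raise
    \<open>\<beta>\<close>-weights, so the moment of \<open>g \<cdot> \<mu>\<close> pairs with \<open>k \<beta> k\<^sup>T\<close> to at least \<open>\<beta> \<bullet> \<beta>\<close>, and the
    Cauchy-Schwarz inequality applies.

  If the infimum is attained, then all weights pair with \<open>\<beta>\<close> to \<open>\<beta> \<bullet> \<beta>\<close>, and every direction that weakly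
  separates \<open>\<beta>\<close> from the weights is constant on them (\<open>moment_minimum_rigid\<close>).  So \<open>\<beta>\<close> lies in the
  relative interior of the hull (\<open>positive_combination\<close>).  This is exactly what a positive
  solution \<open>x\<close> of the Gram equation encodes: after normalization \<open>\<beta> = \<Sum> x\<^sub>p p\<close>, and all the inner products
  of \<open>\<beta>\<close> with the weights agree.
\<close>

section \<open>Matrix algebra\<close>

lemma mat_mult_scaleR_left: "(c *\<^sub>R A) ** B = c *\<^sub>R (A ** B)" for A B :: "'n::finite mat"
  by (simp add: matrix_matrix_mult_def vec_eq_iff sum_distrib_left mult.assoc)

lemma mat_mult_scaleR_right: "A ** (c *\<^sub>R B) = c *\<^sub>R (A ** B)" for A B :: "'n::finite mat"
  by (simp add: matrix_matrix_mult_def vec_eq_iff sum_distrib_left mult.left_commute)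

lemma mat_mult_add_left: "(A + B) ** D = A ** D + B ** D" for A B D :: "'n::finite mat"
  by (simp add: matrix_matrix_mult_def vec_eq_iff sum.distrib distrib_right)

lemma mat_mult_diff_left: "(A - B) ** D = A ** D - B ** D" for A B D :: "'n::finite mat"
  by (simp add: matrix_matrix_mult_def vec_eq_iff sum_subtractf left_diff_distrib)

lemma mat_mult_diff_right: "D ** (A - B) = D ** A - D ** B" for A B D :: "'n::finite mat"
  by (simp add: matrix_matrix_mult_def vec_eq_iff sum_subtractf right_diff_distrib)

lemmas mat_ring = mat_mult_scaleR_left mat_mult_scaleR_right mat_mult_add_left matrix_add_ldistrib
  mat_mult_diff_left mat_mult_diff_right

lemma mat_mult_nth: "(A ** B) $ i $ j = (\<Sum>l\<in>UNIV. A $ i $ l * B $ l $ j)" for A B :: "'n::finite mat"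
  by (simp add: matrix_matrix_mult_def)

lemma bounded_linear_mat_mult:
  fixes A B :: "'n::finite mat"
  shows "bounded_linear (\<lambda>M. A ** M ** B)"
  by (auto intro!: linearI simp: mat_ring simp flip: linear_conv_bounded_linear)

section \<open>The matrix exponential\<close>

lemma mat_pow_0 [simp]: "mat_pow X 0 = mat 1"
  by (simp add: mat_pow_def)

lemma mat_pow_Suc [simp]: "mat_pow X (Suc k) = X ** mat_pow X k"
  by (simp add: mat_pow_def)

lemma mat_pow_scaleR: "mat_pow (t *\<^sub>R X) k = t ^ k *\<^sub>R mat_pow X k"
  by (induction k) (simp_all add: mat_ring mult.commute)

lemma mat_pow_commute: "X ** mat_pow X k = mat_pow X k ** X"
proof (induction k)
  case (Suc k)
  then show ?case
    by (metis mat_pow_Suc matrix_mul_assoc)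
qed simp

lemma mat_pow_entry_le:
  fixes X :: "'n::finite mat"
  shows "\<bar>mat_pow X k $ i $ j\<bar> \<le> (\<Sum>i\<in>UNIV. \<Sum>j\<in>UNIV. \<bar>X $ i $ j\<bar>) ^ k"
proof (induction k arbitrary: i j)
  case 0
  show ?case by (simp add: mat_def)
next
  case (Suc k)
  let ?b = "\<Sum>i\<in>UNIV. \<Sum>j\<in>UNIV. \<bar>X $ i $ j\<bar>"
  have "\<bar>mat_pow X (Suc k) $ i $ j\<bar> \<le> (\<Sum>l\<in>UNIV. \<bar>X $ i $ l\<bar> * \<bar>mat_pow X k $ l $ j\<bar>)"
    by (simp add: matrix_matrix_mult_def flip: abs_mult)
  also have "\<dots> \<le> (\<Sum>l\<in>UNIV. \<bar>X $ i $ l\<bar> * ?b ^ k)"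
    by (intro sum_mono mult_left_mono Suc.IH) auto
  also have "\<dots> = (\<Sum>l\<in>UNIV. \<bar>X $ i $ l\<bar>) * ?b ^ k"
    by (simp add: sum_distrib_right)
  also have "\<dots> \<le> ?b * ?b ^ k"
    by (intro mult_right_mono member_le_sum [where f = "\<lambda>i. \<Sum>j\<in>UNIV. \<bar>X $ i $ j\<bar>"] zero_le_power sum_nonneg) auto
  finally show ?case by simp
qed

lemma summable_mat_exp_entry:
  "summable (\<lambda>k. mat_pow X k $ i $ j / fact k * t ^ k :: real)"
proof (rule summable_comparison_test')
  let ?b = "\<Sum>i\<in>UNIV. \<Sum>j\<in>UNIV. \<bar>X $ i $ j\<bar>"
  show "summable (\<lambda>k. inverse (fact k) * (?b * \<bar>t\<bar>) ^ k)"
    by (rule summable_exp)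
  fix k :: nat
  have "\<bar>mat_pow X k $ i $ j\<bar> * \<bar>t\<bar> ^ k \<le> ?b ^ k * \<bar>t\<bar> ^ k"
    by (intro mult_right_mono mat_pow_entry_le) auto
  then show "norm (mat_pow X k $ i $ j / fact k * t ^ k) \<le> inverse (fact k) * (?b * \<bar>t\<bar>) ^ k"
    by (simp add: abs_mult power_abs power_mult_distrib field_simps)
qed

lemma mat_exp_sums: "(\<lambda>k. mat_pow X k /\<^sub>R fact k) sums mat_exp X"
proof -
  have "(\<lambda>k. mat_pow X k /\<^sub>R fact k) sums (\<chi> i j. \<Sum>k. mat_pow X k $ i $ j / fact k)"
    unfolding sums_def
    using summable_LIMSEQ [OF summable_mat_exp_entry [of X _ _ 1]]
    by (intro vec_tendstoI) (simp add: divide_inverse mult.commute)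
  then show ?thesis
    unfolding mat_exp_def by (simp add: sums_iff)
qed

lemma mat_exp_entry_sums:
  "(\<lambda>k. mat_pow X k $ i $ j / fact k * t ^ k) sums (mat_exp (t *\<^sub>R X) $ i $ j)"
proof -
  have "bounded_linear (\<lambda>M::'a mat. M $ i $ j)"
    by (intro bounded_linear_compose [OF bounded_linear_vec_nth] bounded_linear_vec_nth)
  from bounded_linear.sums [OF this mat_exp_sums [of "t *\<^sub>R X"]] show ?thesis
    by (simp add: mat_pow_scaleR field_simps)
qed

lemma mat_exp_0 [simp]: "mat_exp 0 = (mat 1 :: 'n::finite mat)"
proof -
  have "mat_pow (0::'n mat) k /\<^sub>R fact k = (if k = 0 then mat 1 else 0)" for k
    by (cases k) auto
  then have "(\<lambda>k. mat_pow (0::'n mat) k /\<^sub>R fact k) sums mat 1"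
    using sums_single [of 0 "\<lambda>_. mat 1 :: 'n mat"] by simp
  then show ?thesis
    using mat_exp_sums sums_unique2 by blast
qed

lemma mat_exp_commute: "X ** mat_exp (t *\<^sub>R X) = mat_exp (t *\<^sub>R X) ** X"
proof -
  have "X ** mat_pow (t *\<^sub>R X) k = mat_pow (t *\<^sub>R X) k ** X" for k
    by (simp add: mat_pow_scaleR mat_ring mat_pow_commute)
  then show ?thesis
    using bounded_linear.sums [OF bounded_linear_mat_mult [of X "mat 1"] mat_exp_sums [of "t *\<^sub>R X"]]
      bounded_linear.sums [OF bounded_linear_mat_mult [of "mat 1" X] mat_exp_sums [of "t *\<^sub>R X"]]
    by (simp add: mat_ring sums_unique2)
qed

text \<open>Every entry of \<open>mat_exp (t X)\<close> is a power series in \<open>t\<close>, so it can be differentiated termwise.\<close>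

lemma mat_exp_entry_deriv:
  "((\<lambda>t. mat_exp (t *\<^sub>R X) $ i $ j) has_real_derivative (X ** mat_exp (t *\<^sub>R X)) $ i $ j) (at t)"
proof -
  let ?c = "\<lambda>i j k. mat_pow X k $ i $ j / fact k :: real"
  have eq: "mat_exp (t *\<^sub>R X) $ i $ j = (\<Sum>k. ?c i j k * t ^ k)" for t i j
    using mat_exp_entry_sums [of X i j t] by (simp add: sums_iff)
  have "diffs (?c i j) k = (\<Sum>l\<in>UNIV. X $ i $ l * ?c l j k)" for k
    by (simp add: diffs_def matrix_matrix_mult_def sum_divide_distrib sum_distrib_left
        del: of_nat_Suc)
  then have "(\<lambda>k. diffs (?c i j) k * t ^ k) = (\<lambda>k. \<Sum>l\<in>UNIV. X $ i $ l * (?c l j k * t ^ k))"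
    by (auto simp: sum_distrib_right mult.assoc)
  moreover have "(\<lambda>k. \<Sum>l\<in>UNIV. X $ i $ l * (?c l j k * t ^ k)) sums
      (\<Sum>l\<in>UNIV. X $ i $ l * mat_exp (t *\<^sub>R X) $ l $ j)"
    by (intro sums_sum sums_mult mat_exp_entry_sums)
  ultimately have "(\<Sum>k. diffs (?c i j) k * t ^ k) = (X ** mat_exp (t *\<^sub>R X)) $ i $ j"
    by (simp add: sums_iff matrix_matrix_mult_def)
  then show ?thesis
    using termdiffs_strong_converges_everywhere [OF summable_mat_exp_entry [of X i j], of t]
    by (simp add: eq)
qed

lemma has_vector_derivative_vecI:
  fixes c :: "real \<Rightarrow> real^'n"
  assumes "\<And>i. ((\<lambda>t. c t $ i) has_real_derivative d $ i) (at t)"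
  shows "(c has_vector_derivative d) (at t)"
  unfolding has_vector_derivative_def
proof (subst has_derivative_componentwise_within, intro ballI)
  fix b :: "real^'n" assume "b \<in> Basis"
  then obtain i where "b = axis i 1"
    by (auto simp: Basis_vec_def)
  then show "((\<lambda>x. c x \<bullet> b) has_derivative (\<lambda>x. (x *\<^sub>R d) \<bullet> b)) (at t)"
    using assms [of i] unfolding has_field_derivative_def
      by (simp add: inner_axis mult_commute_abs)
qed

lemma mat_exp_vec_deriv:
  "((\<lambda>t. mat_exp (t *\<^sub>R X) *v x) has_vector_derivative (X ** mat_exp (t *\<^sub>R X)) *v x) (at t)"
  by (rule has_vector_derivative_vecI)
    (auto simp: matrix_vector_mult_def intro!: derivative_eq_intros mat_exp_entry_deriv sum.cong)

lemma mat_exp_transpose_vec_deriv: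
  "((\<lambda>t. transpose (mat_exp (t *\<^sub>R X)) *v x) has_vector_derivative
     transpose (X ** mat_exp (t *\<^sub>R X)) *v x) (at t)"
  by (rule has_vector_derivative_vecI)
    (auto simp: matrix_vector_mult_def transpose_def simp del: transpose_matrix_vector
      intro!: derivative_eq_intros mat_exp_entry_deriv sum.cong)

text \<open>The product has derivative \<open>X E - E X = 0\<close>, where \<open>E\<close> is the exponential, which commutes with \<open>X\<close>.\<close>

lemma mat_exp_minus: "mat_exp (t *\<^sub>R X) ** mat_exp ((- t) *\<^sub>R X) = mat 1"
proof -
  let ?E = "\<lambda>t. mat_exp (t *\<^sub>R X)"
  have m: "((\<lambda>t. ?E (- t) $ i $ j) has_real_derivative - (X ** ?E (- t)) $ i $ j) (at t)" for i j t
    using DERIV_chain' [OF DERIV_minus [OF DERIV_ident] mat_exp_entry_deriv [of X i j], of t UNIV] by simp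
  have "((\<lambda>t. (?E t ** ?E (- t)) $ i $ j) has_real_derivative 0) (at t)" for i j t
  proof -
    have "((\<lambda>t. \<Sum>l\<in>UNIV. ?E t $ i $ l * ?E (- t) $ l $ j) has_real_derivative
        (\<Sum>l\<in>UNIV. (X ** ?E t) $ i $ l * ?E (- t) $ l $ j + - (X ** ?E (- t)) $ l $ j * ?E t $ i $ l)) (at t)"
      by (intro DERIV_sum DERIV_mult mat_exp_entry_deriv m)
    then have "((\<lambda>t. (?E t ** ?E (- t)) $ i $ j) has_real_derivative
        ((X ** ?E t) ** ?E (- t)) $ i $ j - (?E t ** (X ** ?E (- t))) $ i $ j) (at t)"
      by (simp add: mat_mult_nth [of "mat_exp Y" B for Y B]
          mat_mult_nth [of "X ** Y" B for Y B] sum_subtractf mult.commute)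
    then show ?thesis
      using mat_exp_commute [of X t] by (simp add: matrix_mul_assoc)
  qed
  then have "(?E t ** ?E (- t)) $ i $ j = (?E 0 ** ?E (- 0)) $ i $ j" for i j
    by (intro DERIV_isconst_all) auto
  then show ?thesis
    by (simp add: vec_eq_iff)
qed

lemma mat_exp_invertible: "invertible (mat_exp (t *\<^sub>R X))"
  unfolding invertible_def
  using mat_exp_minus [of t X] mat_exp_minus [of "- t" X] by auto

lemma mat_exp_conj:
  fixes k h X :: "'n::finite mat"
  assumes "h ** k = mat 1"
  shows "mat_exp (k ** X ** h) = k ** mat_exp X ** h"
proof -
  have kh: "k ** h = mat 1"
    using assms by (simp add: matrix_left_right_inverse)
  have "mat_pow (k ** X ** h) m = k ** mat_pow X m ** h" for m
  proof (induction m)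
    case 0
    show ?case by (simp add: kh)
  next
    case (Suc m)
    have "k ** X ** h ** (k ** mat_pow X m ** h) = k ** X ** (h ** k) ** mat_pow X m ** h"
      by (simp add: matrix_mul_assoc)
    then show ?case by (simp add: Suc assms matrix_mul_assoc)
  qed
  then have "(\<lambda>m. mat_pow (k ** X ** h) m /\<^sub>R fact m) sums (k ** mat_exp X ** h)"
    using bounded_linear.sums [OF bounded_linear_mat_mult mat_exp_sums [of X], of k h]
    by (simp add: mat_ring)
  then show ?thesis
    using mat_exp_sums sums_unique2 by blast
qed

definition diag_mat :: "('n::finite \<Rightarrow> real) \<Rightarrow> 'n mat" where
  "diag_mat d = (\<chi> i j. if i = j then d i else 0)"

lemma diag_mat_nth [simp]: "diag_mat d $ i $ j = (if i = j then d i else 0)"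
  by (simp add: diag_mat_def)

lemma diag_mat_mult_left [simp]: "(diag_mat d ** M) $ i $ j = d i * M $ i $ j"
  by (simp add: matrix_matrix_mult_def if_distrib [of "\<lambda>x. x * _"] sum.delta' cong: if_cong)

lemma diag_mat_mult_right [simp]: "(M ** diag_mat d) $ i $ j = M $ i $ j * d j"
  by (simp add: matrix_matrix_mult_def if_distrib [of "\<lambda>x. _ * x"] sum.delta' cong: if_cong)

lemma diag_mat_mult: "diag_mat d ** diag_mat e = diag_mat (\<lambda>i. d i * e i)"
  by (simp add: vec_eq_iff)

lemma diag_mat_vec [simp]: "(diag_mat d *v x) $ i = d i * x $ i"
  by (simp add: matrix_vector_mult_def if_distrib [of "\<lambda>x. x * _"] sum.delta' cong: if_cong)

lemma diag_mat_1: "diag_mat (\<lambda>i. 1) = mat 1"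
  by (simp add: vec_eq_iff mat_def)

lemma transpose_diag_mat [simp]: "transpose (diag_mat d) = diag_mat d"
  by (auto simp: vec_eq_iff transpose_def)

lemma scaleR_diag_mat: "t *\<^sub>R diag_mat d = diag_mat (\<lambda>i. t * d i)"
  by (simp add: vec_eq_iff)

lemma mat_exp_diag: "mat_exp (diag_mat d) = diag_mat (\<lambda>i. exp (d i))"
proof -
  have "mat_pow (diag_mat d) m = diag_mat (\<lambda>i. d i ^ m)" for m
    by (induction m) (simp_all add: diag_mat_1 diag_mat_mult)
  moreover have "(\<lambda>m. diag_mat (\<lambda>i. d i ^ m) /\<^sub>R fact m) sums diag_mat (\<lambda>i. exp (d i))"
    unfolding sums_def
  proof (intro vec_tendstoI)
    fix i j
    have "(\<lambda>n. \<Sum>m<n. d i ^ m /\<^sub>R fact m) \<longlonglongrightarrow> exp (d i)"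
      using exp_converges [of "d i"] by (simp add: sums_def)
    then show "(\<lambda>n. (\<Sum>m<n. diag_mat (\<lambda>i. d i ^ m) /\<^sub>R fact m) $ i $ j)
        \<longlonglongrightarrow> diag_mat (\<lambda>i. exp (d i)) $ i $ j"
      by (cases "i = j") auto
  qed
  ultimately have "(\<lambda>m. mat_pow (diag_mat d) m /\<^sub>R fact m) sums diag_mat (\<lambda>i. exp (d i))"
    by simp
  then show ?thesis
    using mat_exp_sums sums_unique2 by blast
qed

lemma mat_pow_transpose: "mat_pow (transpose X) k = transpose (mat_pow X k)"
  by (induction k) (simp_all add: matrix_transpose_mul mat_pow_commute)

lemma mat_exp_transpose: "mat_exp (transpose X) = transpose (mat_exp X)"
proof -
  have "bounded_linear (transpose :: 'a mat \<Rightarrow> 'a mat)"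
    by (auto intro!: linearI simp: transpose_def vec_eq_iff simp flip: linear_conv_bounded_linear)
  from bounded_linear.sums [OF this mat_exp_sums [of X]]
  have "(\<lambda>k. mat_pow (transpose X) k /\<^sub>R fact k) sums transpose (mat_exp X)"
    by (simp add: mat_pow_transpose transpose_scalar)
  then show ?thesis
    using mat_exp_sums sums_unique2 by blast
qed

section \<open>Multilinear forms on lists\<close>

text \<open>A recursive form of multilinearity, made for induction on the list of arguments.  It constrains
  \<open>U\<close> only on lists of length \<open>m\<close>.\<close>

fun multilinear :: "nat \<Rightarrow> ('a::real_vector list \<Rightarrow> real) \<Rightarrow> bool" where
  "multilinear 0 U \<longleftrightarrow> True"
| "multilinear (Suc m) U \<longleftrightarrow>
     (\<forall>zs. length zs = m \<longrightarrow> linear (\<lambda>z. U (z # zs))) \<and> (\<forall>z. multilinear m (\<lambda>zs. U (z # zs)))"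

lemma multilinearI:
  assumes "\<And>zs i. length zs = m \<Longrightarrow> i < m \<Longrightarrow> linear (\<lambda>z. U (zs[i := z]))"
  shows "multilinear m U"
  using assms
proof (induction m arbitrary: U)
  case (Suc m)
  have "linear (\<lambda>z. U (z # zs))" if "length zs = m" for zs
    using Suc.prems [of "0 # zs" 0] that by simp
  moreover have "linear (\<lambda>y. U (z # zs[i := y]))" if "length zs = m" "i < m" for z zs i
    using Suc.prems [of "z # zs" "Suc i"] that by simp
  ultimately show ?case
    by (auto intro!: Suc.IH)
qed simp

lemma multilinear_compose:
  assumes "multilinear (length fs) U" "\<And>f. f \<in> set fs \<Longrightarrow> linear f"
  shows "multilinear (length fs) (\<lambda>zs. U (map2 (\<lambda>f z. f z) fs zs))"
  using assms
proof (induction fs arbitrary: U)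
  case (Cons f fs)
  have "linear (\<lambda>z. U (f z # map2 (\<lambda>f z. f z) fs zs))" if zs: "length zs = length fs" for zs
  proof -
    have "linear f"
      by (rule Cons.prems(2)) simp
    moreover have "linear (\<lambda>z. U (z # map2 (\<lambda>f z. f z) fs zs))"
      using Cons.prems(1) zs by simp
    ultimately show ?thesis
      using linear_compose unfolding o_def by blast
  qed
  moreover have "multilinear (length fs) (\<lambda>zs. U (f z # map2 (\<lambda>f z. f z) fs zs))" for z
  proof (rule Cons.IH [of "\<lambda>zs. U (f z # zs)"])
    show "multilinear (length fs) (\<lambda>zs. U (f z # zs))"
      using Cons.prems(1) by simp
    show "linear h" if "h \<in> set fs" for h
      using Cons.prems(2) that by simp
  qed
  ultimately show ?case
    by simp
qed simp

lemma multilinear_scale: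
  assumes "multilinear (length zs) U" "length cs = length zs"
  shows "U (map2 (*\<^sub>R) cs zs) = prod_list cs * U zs"
  using assms
proof (induction zs arbitrary: U cs)
  case (Cons z zs)
  then obtain c cs' where cs: "cs = c # cs'" "length cs' = length zs"
    by (cases cs) auto
  have "linear (\<lambda>z. U (z # map2 (*\<^sub>R) cs' zs))"
    using Cons.prems cs by auto
  then have "U (c *\<^sub>R z # map2 (*\<^sub>R) cs' zs) = c * U (z # map2 (*\<^sub>R) cs' zs)"
    using linear_scale [of "\<lambda>z. U (z # map2 (*\<^sub>R) cs' zs)" c z] by simp
  also have "\<dots> = c * (prod_list cs' * U (z # zs))"
    using Cons.IH [of "\<lambda>zs. U (z # zs)" cs'] Cons.prems cs by auto
  finally show ?case
    by (simp add: cs)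
qed simp

lemma multilinear_eqI:
  assumes "multilinear m U" "multilinear m V" "span S = UNIV"
    and "\<And>zs. length zs = m \<Longrightarrow> set zs \<subseteq> S \<Longrightarrow> U zs = V zs"
    and "length zs = m"
  shows "U zs = V zs"
  using assms
proof (induction m arbitrary: U V zs)
  case (Suc m)
  obtain y ys where zs: "zs = y # ys" and ys: "length ys = m"
    using Suc.prems(5) by (cases zs) auto
  have "U (z # ys) = V (z # ys)" if "z \<in> S" for z
  proof (rule Suc.IH [of "\<lambda>zs. U (z # zs)" "\<lambda>zs. V (z # zs)"])
    show "U (z # zs) = V (z # zs)" if "length zs = m" "set zs \<subseteq> S" for zs
      using Suc.prems(4) [of "z # zs"] that \<open>z \<in> S\<close> by simp
  qed (use Suc.prems(1-3) ys in simp_all)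
  moreover have "linear (\<lambda>z. U (z # ys))" "linear (\<lambda>z. V (z # ys))"
    using Suc.prems ys by auto
  ultimately show ?case
    using linear_eq_on [of "\<lambda>z. U (z # ys)" "\<lambda>z. V (z # ys)" y S] Suc.prems(3)
    unfolding zs by blast
qed simp

lemma linear_vec_expand:
  fixes f :: "real^'n \<Rightarrow> real"
  assumes "linear f"
  shows "f x = (\<Sum>i\<in>UNIV. x $ i * f (axis i 1))"
proof -
  have "f x = f (\<Sum>i\<in>UNIV. x $ i *\<^sub>R axis i 1)"
    using basis_expansion [of x] by (simp add: scalar_mult_eq_scaleR)
  then show ?thesis
    using assms by (simp add: linear_sum linear_scale)
qed

lemma multilinear_tendsto:
  fixes U :: "(real^'n) list \<Rightarrow> real"
  assumes "multilinear (length cs) U" "length ls = length cs"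
    and "\<And>i. i < length cs \<Longrightarrow> ((cs ! i) \<longlongrightarrow> ls ! i) F"
  shows "((\<lambda>t. U (map (\<lambda>c. c t) cs)) \<longlongrightarrow> U ls) F"
  using assms
proof (induction cs arbitrary: U ls)
  case (Cons c cs)
  obtain l ls' where ls: "ls = l # ls'" "length ls' = length cs"
    using Cons.prems(2) by (cases ls) auto
  have c: "(c \<longlongrightarrow> l) F" and cs: "\<And>i. i < length cs \<Longrightarrow> ((cs ! i) \<longlongrightarrow> ls' ! i) F"
    using Cons.prems(3) [of 0] Cons.prems(3) [of "Suc i" for i] ls by auto
  have e: "U (x # ys) = (\<Sum>i\<in>UNIV. x $ i * U (axis i 1 # ys))" if "length ys = length cs" for x ys
    using Cons.prems(1) that by (intro linear_vec_expand [of "\<lambda>z. U (z # ys)"]) auto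
  have "((\<lambda>t. U (z # map (\<lambda>c. c t) cs)) \<longlongrightarrow> U (z # ls')) F" for z
    using Cons.prems(1) cs ls by (intro Cons.IH) auto
  then have "((\<lambda>t. \<Sum>i\<in>UNIV. c t $ i * U (axis i 1 # map (\<lambda>c. c t) cs)) \<longlongrightarrow>
      (\<Sum>i\<in>UNIV. l $ i * U (axis i 1 # ls'))) F"
    by (intro tendsto_intros c)
  then show ?case
    using e [of ls' l] e [of "map (\<lambda>c. c t) cs" "c t" for t] ls by simp
qed auto

lemma multilinear_deriv:
  fixes U :: "(real^'n) list \<Rightarrow> real"
  assumes "multilinear (length cs) U" "length ds = length cs"
    and "\<And>i. i < length cs \<Longrightarrow> ((cs ! i) has_vector_derivative ds ! i) (at t)"
  shows "((\<lambda>t. U (map (\<lambda>c. c t) cs)) has_real_derivative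
    (\<Sum>i<length cs. U ((map (\<lambda>c. c t) cs)[i := ds ! i]))) (at t)"
  using assms
proof (induction cs arbitrary: U ds)
  case (Cons c cs)
  obtain d ds' where ds: "ds = d # ds'" "length ds' = length cs"
    using Cons.prems(2) by (cases ds) auto
  have c: "(c has_vector_derivative d) (at t)"
    and cs: "\<And>i. i < length cs \<Longrightarrow> ((cs ! i) has_vector_derivative ds' ! i) (at t)"
    using Cons.prems(3) [of 0] Cons.prems(3) [of "Suc i" for i] ds by auto
  have ci: "((\<lambda>t. c t $ i) has_real_derivative d $ i) (at t)" for i
    using bounded_linear.has_vector_derivative [OF bounded_linear_vec_nth c]
    by (simp add: has_real_derivative_iff_has_vector_derivative)
  have e: "U (x # ys) = (\<Sum>i\<in>UNIV. x $ i * U (axis i 1 # ys))" if "length ys = length cs" for x ys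
    using Cons.prems(1) that by (intro linear_vec_expand [of "\<lambda>z. U (z # ys)"]) auto
  let ?D = "\<lambda>z. \<Sum>i<length cs. U (z # (map (\<lambda>c. c t) cs)[i := ds' ! i])"
  have "((\<lambda>t. U (z # map (\<lambda>c. c t) cs)) has_real_derivative ?D z) (at t)" for z
    using Cons.prems(1) cs ds by (intro Cons.IH) auto
  then have "((\<lambda>t. \<Sum>i\<in>UNIV. c t $ i * U (axis i 1 # map (\<lambda>c. c t) cs)) has_real_derivative
      (\<Sum>i\<in>UNIV. d $ i * U (axis i 1 # map (\<lambda>c. c t) cs) + ?D (axis i 1) * c t $ i)) (at t)"
    by (intro DERIV_sum DERIV_mult ci)
  also have "(\<Sum>i\<in>UNIV. d $ i * U (axis i 1 # map (\<lambda>c. c t) cs) + ?D (axis i 1) * c t $ i) =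
      U (d # map (\<lambda>c. c t) cs) + (\<Sum>i\<in>UNIV. \<Sum>j<length cs. c t $ i * U (axis i 1 # (map (\<lambda>c. c t) cs)[j := ds' ! j]))"
    by (simp add: sum.distrib e [of "map (\<lambda>c. c t) cs" d] sum_distrib_left mult.commute)
  also have "(\<Sum>i\<in>UNIV. \<Sum>j<length cs. c t $ i * U (axis i 1 # (map (\<lambda>c. c t) cs)[j := ds' ! j])) = ?D (c t)"
    by (subst sum.swap) (simp add: e [of "(map (\<lambda>c. c t) cs)[j := ds' ! j]" "c t" for j])
  finally show ?case
    using e [of "map (\<lambda>c. c t) cs" "c t" for t] ds by (simp add: sum.lessThan_Suc_shift del: sum.lessThan_Suc)
qed auto

section \<open>The stabilizer of a set of tensors\<close>

text \<open>Vectors and covectors are concatenated into one list, so that the lemmas on multilinear forms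
  treat both kinds of argument at once.\<close>

lemma tensor_multilinear:
  assumes "is_tensor T"
  obtains r s where "multilinear (r + s) (\<lambda>zs. T (take r zs) (drop r zs))"
    and "\<And>xs as. \<not> (length xs = r \<and> length as = s) \<Longrightarrow> T xs as = 0"
proof -
  obtain r s where rs: "\<And>xs as. length xs = r \<Longrightarrow> length as = s \<Longrightarrow>
        (\<forall>i<r. linear (\<lambda>x. T (xs[i := x]) as)) \<and> (\<forall>i<s. linear (\<lambda>a. T xs (as[i := a])))"
      "\<And>xs as. \<not> (length xs = r \<and> length as = s) \<Longrightarrow> T xs as = 0"
    using assms unfolding is_tensor_def by (elim exE conjE) (rule that; blast)
  have "linear (\<lambda>z. T (take r (zs[i := z])) (drop r (zs[i := z])))"
    if "length zs = r + s" "i < r + s" for zs i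
  proof (cases "i < r")
    case True
    then show ?thesis
      using rs(1) [of "take r zs" "drop r zs"] that by (simp add: take_update_swap)
  next
    case False
    then have "linear (\<lambda>z. T (take r zs) ((drop r zs)[i - r := z]))"
      using rs(1) [of "take r zs" "drop r zs"] that by simp
    then show ?thesis
      using False that by (simp add: take_update_swap drop_update_swap list_update_beyond)
  qed
  then show ?thesis
    using that rs(2) multilinearI [of "r + s" "\<lambda>zs. T (take r zs) (drop r zs)"] by blast
qed

text \<open>Moving \<open>g\<close> from the vectors to the covectors removes the inverse from the action.\<close>

lemma tensor_act_fixed_iff:
  fixes g :: "'n::finite mat"
  assumes "invertible g"
  shows "tensor_act g T = T \<longleftrightarrow>
    (\<forall>xs as. T (map (\<lambda>x. g *v x) xs) as = T xs (map (\<lambda>a. transpose g *v a) as))"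
    (is "?L \<longleftrightarrow> ?R")
proof
  assume ?L
  then have "T xs as = T (map (\<lambda>x. matrix_inv g *v x) xs) (map (\<lambda>a. transpose g *v a) as)" for xs as
    unfolding tensor_act_def by metis
  from this [of "map (\<lambda>x. g *v x) xs" for xs] show ?R
    using matrix_inv_both(2) [OF assms]
    by (simp add: o_def matrix_vector_mul_assoc del: transpose_matrix_vector)
next
  assume R: ?R
  show ?L
    unfolding tensor_act_def
  proof (intro ext)
    fix xs as
    show "T (map (\<lambda>x. matrix_inv g *v x) xs) (map (\<lambda>a. transpose g *v a) as) = T xs as"
      using R [rule_format, of "map (\<lambda>x. matrix_inv g *v x) xs" as] matrix_inv_both(1) [OF assms]
      by (simp add: o_def matrix_vector_mul_assoc del: transpose_matrix_vector)
  qed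
qed

lemma stabilizer_iff:
  fixes g :: "'n::finite mat"
  shows "g \<in> stabilizer \<gamma> \<longleftrightarrow> invertible g \<and>
    (\<forall>T\<in>\<gamma>. \<forall>xs as. T (map (\<lambda>x. g *v x) xs) as = T xs (map (\<lambda>a. transpose g *v a) as))"
  unfolding stabilizer_def using tensor_act_fixed_iff by blast

lemma stabilizer_inv:
  assumes "g \<in> stabilizer \<gamma>" "g ** h = mat 1"
  shows "h \<in> stabilizer \<gamma>"
  unfolding stabilizer_iff
proof (intro conjI ballI allI)
  have hg: "h ** g = mat 1"
    using assms(2) by (simp add: matrix_left_right_inverse)
  then show "invertible h"
    using assms(2) by (auto simp: invertible_def)
  fix T xs as assume "T \<in> \<gamma>"
  then have *: "T (map (\<lambda>x. g *v x) xs) as = T xs (map (\<lambda>a. transpose g *v a) as)" for xs as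
    using assms(1) by (auto simp: stabilizer_iff)
  have "transpose g ** transpose h = mat 1"
    using hg by (metis matrix_transpose_mul transpose_mat)
  then show "T (map (\<lambda>x. h *v x) xs) as = T xs (map (\<lambda>a. transpose h *v a) as)"
    using * [of "map (\<lambda>x. h *v x) xs" "map (\<lambda>a. transpose h *v a) as"] assms(2)
    by (simp add: o_def matrix_vector_mul_assoc del: transpose_matrix_vector)
qed

lemma stabilizer_closed:
  fixes L :: "'n::finite mat"
  assumes T: "\<forall>T\<in>\<gamma>. is_tensor T" and g: "\<And>m::nat. g m \<in> stabilizer \<gamma>"
    and lim: "g \<longlonglongrightarrow> L" and inv: "invertible L"
  shows "L \<in> stabilizer \<gamma>"
  unfolding stabilizer_iff
proof (intro conjI ballI allI inv)
  fix T xs as assume "T \<in> \<gamma>"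
  obtain r s where ml: "multilinear (r + s) (\<lambda>zs. T (take r zs) (drop r zs))"
    and z: "\<And>xs as. \<not> (length xs = r \<and> length as = s) \<Longrightarrow> T xs as = 0"
    using T \<open>T \<in> \<gamma>\<close> tensor_multilinear by blast
  have ge: "(\<lambda>m. g m $ i $ j) \<longlonglongrightarrow> L $ i $ j" for i j
    by (intro tendsto_vec_nth lim)
  have l1: "(\<lambda>m. g m *v x) \<longlonglongrightarrow> L *v x" for x
    unfolding matrix_vector_mult_def
    by (intro vec_tendstoI) (simp, intro tendsto_sum tendsto_mult ge tendsto_const)
  have l2: "(\<lambda>m. transpose (g m) *v x) \<longlonglongrightarrow> transpose L *v x" for x
    unfolding matrix_vector_mult_def transpose_def
    by (intro vec_tendstoI) (simp, intro tendsto_sum tendsto_mult ge tendsto_const)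
  show "T (map (\<lambda>x. L *v x) xs) as = T xs (map (\<lambda>a. transpose L *v a) as)"
  proof (cases "length xs = r \<and> length as = s")
    case True
    let ?U = "\<lambda>zs. T (take r zs) (drop r zs)"
    let ?cs = "map (\<lambda>x m. g m *v x) xs @ map (\<lambda>a m. a) as"
    have "((\<lambda>m. ?U (map (\<lambda>c. c m) ?cs)) \<longlongrightarrow> ?U (map (\<lambda>x. L *v x) xs @ as)) sequentially"
    proof (rule multilinear_tendsto)
      show "((?cs ! i) \<longlongrightarrow> (map (\<lambda>x. L *v x) xs @ as) ! i) sequentially" if "i < length ?cs" for i
        using that l1 by (simp add: nth_append)
    qed (use True ml in simp_all)
    then have "(\<lambda>m. T (map (\<lambda>x. g m *v x) xs) as) \<longlonglongrightarrow> T (map (\<lambda>x. L *v x) xs) as"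
      using True by (simp add: o_def)
    moreover
    let ?cs = "map (\<lambda>x m. x) xs @ map (\<lambda>a m. transpose (g m) *v a) as"
    have "((\<lambda>m. ?U (map (\<lambda>c. c m) ?cs)) \<longlongrightarrow> ?U (xs @ map (\<lambda>a. transpose L *v a) as)) sequentially"
    proof (rule multilinear_tendsto)
      show "((?cs ! i) \<longlongrightarrow> (xs @ map (\<lambda>a. transpose L *v a) as) ! i) sequentially" if "i < length ?cs" for i
        using that l2 by (simp add: nth_append del: transpose_matrix_vector)
    qed (use True ml in simp_all)
    then have "(\<lambda>m. T xs (map (\<lambda>a. transpose (g m) *v a) as)) \<longlonglongrightarrow> T xs (map (\<lambda>a. transpose L *v a) as)"
      using True by (simp add: o_def del: transpose_matrix_vector)
    moreover have "T (map (\<lambda>x. g m *v x) xs) as = T xs (map (\<lambda>a. transpose (g m) *v a) as)" for m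
      using g [of m] \<open>T \<in> \<gamma>\<close> unfolding stabilizer_iff by blast
    ultimately show ?thesis
      by (simp only: LIMSEQ_unique)
  qed (auto simp: z)
qed

lemma tensor_linear:
  assumes "is_tensor T"
  shows "i < length xs \<Longrightarrow> linear (\<lambda>x. T (xs[i := x]) as)"
    and "i < length as \<Longrightarrow> linear (\<lambda>a. T xs (as[i := a]))"
proof -
  obtain r s where rs: "\<And>xs as. length xs = r \<Longrightarrow> length as = s \<Longrightarrow>
        (\<forall>i<r. linear (\<lambda>x. T (xs[i := x]) as)) \<and> (\<forall>i<s. linear (\<lambda>a. T xs (as[i := a])))"
      "\<And>xs as. \<not> (length xs = r \<and> length as = s) \<Longrightarrow> T xs as = 0"
    using assms unfolding is_tensor_def by (elim exE conjE) (rule that; blast)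
  have z: "linear (\<lambda>x. T (xs[i := x]) as)" "linear (\<lambda>a. T xs (as[i := a]))"
    if "\<not> (length xs = r \<and> length as = s)"
    using that rs(2) by (simp_all add: linear_iff)
  show "i < length xs \<Longrightarrow> linear (\<lambda>x. T (xs[i := x]) as)" "i < length as \<Longrightarrow> linear (\<lambda>a. T xs (as[i := a]))"
    using rs(1) [of xs as] z by (cases "length xs = r \<and> length as = s"; blast)+
qed

lemma sum_lessThan_add:
  "(\<Sum>i<m + n. f i) = (\<Sum>i<m. f i) + (\<Sum>i<n. f (m + i :: nat) :: real)"
  by (induction n) (simp_all add: add.assoc [symmetric])

lemma tensor_deriv:
  fixes A B :: "real \<Rightarrow> 'n::finite mat"
  assumes "is_tensor T"
    and A: "\<And>x. ((\<lambda>t. A t *v x) has_vector_derivative A' *v x) (at t)"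
    and B: "\<And>x. ((\<lambda>t. B t *v x) has_vector_derivative B' *v x) (at t)"
  shows "((\<lambda>t. T (map (\<lambda>x. A t *v x) xs) (map (\<lambda>a. B t *v a) as)) has_real_derivative
    (\<Sum>i<length xs. T ((map (\<lambda>x. A t *v x) xs)[i := A' *v xs ! i]) (map (\<lambda>a. B t *v a) as)) +
    (\<Sum>i<length as. T (map (\<lambda>x. A t *v x) xs) ((map (\<lambda>a. B t *v a) as)[i := B' *v as ! i]))) (at t)"
proof -
  obtain r s where ml: "multilinear (r + s) (\<lambda>zs. T (take r zs) (drop r zs))"
    and z: "\<And>xs as. \<not> (length xs = r \<and> length as = s) \<Longrightarrow> T xs as = 0"
    using assms(1) tensor_multilinear by blast
  show ?thesis
  proof (cases "length xs = r \<and> length as = s")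
    case False
    then show ?thesis
      by (subst z, simp)+ (simp add: z False)
  next
    case True
    let ?U = "\<lambda>zs. T (take r zs) (drop r zs)"
    let ?cs = "map (\<lambda>x t. A t *v x) xs @ map (\<lambda>a t. B t *v a) as"
    let ?ds = "map (\<lambda>x. A' *v x) xs @ map (\<lambda>a. B' *v a) as"
    have "((\<lambda>t. ?U (map (\<lambda>c. c t) ?cs)) has_real_derivative
        (\<Sum>i<length ?cs. ?U ((map (\<lambda>c. c t) ?cs)[i := ?ds ! i]))) (at t)"
    proof (rule multilinear_deriv)
      show "((?cs ! i) has_vector_derivative (?ds ! i)) (at t)" if "i < length ?cs" for i
        using that A B by (simp add: nth_append)
    qed (use True ml in simp_all)
    then show ?thesis
      using True by (simp add: o_def sum_lessThan_add list_update_append nth_append)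
  qed
qed

section \<open>The Lie algebra of the stabilizer\<close>

definition tensor_der :: "'n::finite mat \<Rightarrow> 'n tensor \<Rightarrow> 'n tensor" where
  "tensor_der X T = (\<lambda>xs as. (\<Sum>i<length xs. T (xs[i := X *v xs ! i]) as) -
     (\<Sum>i<length as. T xs (as[i := transpose X *v as ! i])))"

text \<open>Applying \<open>mat_exp (t X)\<close> to the vectors and \<open>mat_exp (- t X)\<^sup>T\<close> to the covectors is a flow on
  tensors; \<open>tensor_der X\<close> is its generator.\<close>

lemma tensor_der_flow:
  fixes X :: "'n::finite mat"
  assumes T: "is_tensor T"
  shows "((\<lambda>t. T (map (\<lambda>x. mat_exp (t *\<^sub>R X) *v x) xs) (map (\<lambda>a. transpose (mat_exp ((- t) *\<^sub>R X)) *v a) as))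
    has_real_derivative tensor_der X T (map (\<lambda>x. mat_exp (t *\<^sub>R X) *v x) xs)
      (map (\<lambda>a. transpose (mat_exp ((- t) *\<^sub>R X)) *v a) as)) (at t)"
proof -
  let ?E = "\<lambda>t. mat_exp (t *\<^sub>R X)"
  let ?B' = "- (transpose X ** transpose (?E (- t)))"
  have "((\<lambda>t. transpose (?E (- t)) *v x) has_vector_derivative ?B' *v x) (at t)" for x
  proof -
    have "((\<lambda>t. - t) has_vector_derivative - 1) (at t)"
      by (auto intro!: derivative_eq_intros)
    from vector_diff_chain_at [OF this mat_exp_transpose_vec_deriv [of X x "- t"]]
    have "((\<lambda>t. transpose (?E (- t)) *v x) has_vector_derivative
        - (transpose (X ** ?E (- t)) *v x)) (at t)"
      by (simp add: o_def del: transpose_matrix_vector)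
    also have "- (transpose (X ** ?E (- t)) *v x) = ?B' *v x"
      unfolding mat_exp_commute matrix_transpose_mul
      using matrix_vector_mult_diff_rdistrib [of 0 "transpose X ** transpose (?E (- t))" x] by simp
    finally show ?thesis .
  qed
  note d = tensor_deriv [OF T mat_exp_vec_deriv this, of X xs as]
  have m: "?B' *v a = - (transpose X *v (transpose (?E (- t)) *v a))" for a
    using matrix_vector_mult_diff_rdistrib [of 0 "transpose X ** transpose (?E (- t))" a]
    by (simp add: matrix_vector_mul_assoc del: transpose_matrix_vector)
  have neg: "T ys (bs[i := - v]) = - T ys (bs[i := v])" if "i < length bs" for ys bs i v
    using linear_neg [OF tensor_linear(2) [OF T that, of ys], of v] .
  have "(\<Sum>i<length as. T ys ((map (\<lambda>a. transpose (?E (- t)) *v a) as)[i := ?B' *v as ! i])) =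
      - (\<Sum>i<length as. T ys ((map (\<lambda>a. transpose (?E (- t)) *v a) as)
          [i := transpose X *v map (\<lambda>a. transpose (?E (- t)) *v a) as ! i]))" for ys
    unfolding m sum_negf [symmetric] by (intro sum.cong) (simp_all add: neg del: transpose_matrix_vector)
  moreover have "(\<Sum>i<length xs. T ((map (\<lambda>x. ?E t *v x) xs)[i := (X ** ?E t) *v xs ! i]) bs) =
      (\<Sum>i<length xs. T ((map (\<lambda>x. ?E t *v x) xs)[i := X *v map (\<lambda>x. ?E t *v x) xs ! i]) bs)" for bs
    by (intro sum.cong) (simp_all add: matrix_vector_mul_assoc)
  ultimately show ?thesis
    using d unfolding tensor_der_def by (simp del: transpose_matrix_vector)
qed

text \<open>Differentiating \<open>T\<close> along the flow of \<open>X\<close> turns invariance under the one-parameter group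
  into a condition that is linear in \<open>X\<close>.  This is why the Lie algebra is a subspace.\<close>

lemma gl_gamma_iff:
  fixes X :: "'n::finite mat"
  assumes "\<forall>T\<in>\<gamma>. is_tensor T"
  shows "X \<in> gl_gamma \<gamma> \<longleftrightarrow> (\<forall>T\<in>\<gamma>. \<forall>xs as. tensor_der X T xs as = 0)"
proof -
  let ?E = "\<lambda>t. mat_exp (t *\<^sub>R X)"
  let ?phi = "\<lambda>T xs as t. T (map (\<lambda>x. ?E t *v x) xs) (map (\<lambda>a. transpose (?E (- t)) *v a) as)"
  have tt: "transpose (?E t) ** transpose (?E (- t)) = mat 1"
    "transpose (?E (- t)) ** transpose (?E t) = mat 1" for t
    using mat_exp_minus [of "- t" X] mat_exp_minus [of t X]
    by (simp_all flip: matrix_transpose_mul add: transpose_mat)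
  have inG: "X \<in> gl_gamma \<gamma> \<longleftrightarrow> (\<forall>T\<in>\<gamma>. \<forall>xs as t. ?phi T xs as t = T xs as)"
  proof
    assume "X \<in> gl_gamma \<gamma>"
    then have "?E t \<in> stabilizer \<gamma>" for t
      by (simp add: gl_gamma_def lie_algebra_of_def)
    then have "T (map (\<lambda>x. ?E t *v x) xs) bs = T xs (map (\<lambda>a. transpose (?E t) *v a) bs)"
      if "T \<in> \<gamma>" for T xs bs t
      using that unfolding stabilizer_iff by blast
    then have "?phi T xs as t = T xs (map (\<lambda>a. transpose (?E t) *v a) (map (\<lambda>a. transpose (?E (- t)) *v a) as))"
      if "T \<in> \<gamma>" for T xs as t
      using that by blast
    then show "\<forall>T\<in>\<gamma>. \<forall>xs as t. ?phi T xs as t = T xs as"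
      using tt by (simp add: o_def matrix_vector_mul_assoc del: transpose_matrix_vector)
  next
    assume *: "\<forall>T\<in>\<gamma>. \<forall>xs as t. ?phi T xs as t = T xs as"
    have "?E t \<in> stabilizer \<gamma>" for t
      unfolding stabilizer_iff
    proof (intro conjI mat_exp_invertible ballI allI)
      fix T xs as assume "T \<in> \<gamma>"
      then have "?phi T xs (map (\<lambda>a. transpose (?E t) *v a) as) t = T xs (map (\<lambda>a. transpose (?E t) *v a) as)"
        using * by blast
      then show "T (map (\<lambda>x. ?E t *v x) xs) as = T xs (map (\<lambda>a. transpose (?E t) *v a) as)"
        using tt by (simp add: o_def matrix_vector_mul_assoc del: transpose_matrix_vector)
    qed
    then show "X \<in> gl_gamma \<gamma>"
      by (simp add: gl_gamma_def lie_algebra_of_def)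
  qed
  have "(\<forall>xs as t. ?phi T xs as t = T xs as) \<longleftrightarrow> (\<forall>xs as. tensor_der X T xs as = 0)"
    if "T \<in> \<gamma>" for T
  proof (intro iffI allI)
    fix xs as assume *: "\<forall>xs as t. ?phi T xs as t = T xs as"
    have "(?phi T xs as has_real_derivative tensor_der X T xs as) (at 0)"
      using tensor_der_flow [of T X xs as 0] assms that
      by (simp add: transpose_mat del: transpose_matrix_vector)
    moreover have "(?phi T xs as has_real_derivative 0) (at 0)"
      using * by simp
    ultimately show "tensor_der X T xs as = 0"
      by (rule DERIV_unique)
  next
    fix xs as t assume *: "\<forall>xs as. tensor_der X T xs as = 0"
    have "(?phi T xs as has_real_derivative 0) (at t)" for t
      using tensor_der_flow [of T X xs as t] assms that * by simp
    then have "?phi T xs as t = ?phi T xs as 0"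
      by (intro DERIV_isconst_all) auto
    then show "?phi T xs as t = T xs as"
      by (simp add: transpose_mat del: transpose_matrix_vector)
  qed
  then show ?thesis
    using inG by blast
qed

lemma tensor_der_add:
  assumes "is_tensor T"
  shows "tensor_der (X + Y) T xs as = tensor_der X T xs as + tensor_der Y T xs as"
proof -
  have "transpose (X + Y) = transpose X + transpose Y"
    by (simp add: transpose_def vec_eq_iff)
  then show ?thesis
    using linear_add [OF tensor_linear(1) [OF assms]] linear_add [OF tensor_linear(2) [OF assms]]
    by (simp add: tensor_der_def matrix_vector_mult_add_rdistrib sum.distrib del: transpose_matrix_vector)
qed

lemma tensor_der_scaleR:
  assumes "is_tensor T"
  shows "tensor_der (c *\<^sub>R X) T xs as = c * tensor_der X T xs as"
  using linear_scale [OF tensor_linear(1) [OF assms]] linear_scale [OF tensor_linear(2) [OF assms]]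
  by (simp add: tensor_der_def transpose_scalar sum_distrib_left right_diff_distrib
      flip: scaleR_matrix_vector_assoc del: transpose_matrix_vector)

lemma subspace_gl_gamma:
  assumes "\<forall>T\<in>\<gamma>. is_tensor T"
  shows "subspace (gl_gamma \<gamma>)"
  unfolding subspace_def
  using assms tensor_der_scaleR [of _ 0 0]
  by (auto simp: gl_gamma_iff [OF assms] tensor_der_add tensor_der_scaleR)

lemma subspace_a_gamma:
  assumes "\<forall>T\<in>\<gamma>. is_tensor T"
  shows "subspace (a_gamma \<gamma>)"
proof -
  have "subspace (diagonal_matrices :: 'a mat set)" "subspace (symmetric_matrices :: 'a mat set)"
    by (auto simp: subspace_def diagonal_matrices_def symmetric_matrices_def transpose_def vec_eq_iff)
  then show ?thesis
    unfolding a_gamma_def p_gamma_def by (intro subspace_inter subspace_gl_gamma assms)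
qed

lemma gl_gamma_conj:
  assumes "X \<in> gl_gamma \<gamma>" "g \<in> stabilizer \<gamma>" "g ** h = mat 1"
  shows "g ** X ** h \<in> gl_gamma \<gamma>"
proof -
  have "h ** g = mat 1"
    using assms(3) by (simp add: matrix_left_right_inverse)
  then have "mat_exp (t *\<^sub>R (g ** X ** h)) = g ** mat_exp (t *\<^sub>R X) ** h" for t
    using mat_exp_conj [of h g "t *\<^sub>R X"] by (simp add: mat_ring)
  then show ?thesis
    using assms(1) stabilizer_mult [OF stabilizer_mult [OF assms(2)] stabilizer_inv [OF assms(2,3)]]
    by (simp add: gl_gamma_def lie_algebra_of_def)
qed

lemma gl_gamma_transpose:
  assumes "self_adjoint_group (stabilizer \<gamma>)" "X \<in> gl_gamma \<gamma>"
  shows "transpose X \<in> gl_gamma \<gamma>"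
  using assms by (auto simp: gl_gamma_def lie_algebra_of_def self_adjoint_group_def
      mat_exp_transpose simp flip: transpose_scalar)

section \<open>Real powers of positive definite elements\<close>

definition spectral :: "'n::finite mat \<Rightarrow> ('n \<Rightarrow> real) \<Rightarrow> 'n mat" where
  "spectral Q d = Q ** diag_mat d ** transpose Q"

lemma orthogonal_transpose_mult:
  "orthogonal_matrix Q \<Longrightarrow> transpose Q ** Q = mat 1" "orthogonal_matrix Q \<Longrightarrow> Q ** transpose Q = mat 1"
  by (auto simp: orthogonal_matrix_def)

lemma spectral_mult:
  assumes "orthogonal_matrix Q"
  shows "spectral Q d ** spectral Q e = spectral Q (\<lambda>i. d i * e i)"
proof -
  have "spectral Q d ** spectral Q e = Q ** diag_mat d ** (transpose Q ** Q) ** diag_mat e ** transpose Q"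
    by (simp add: spectral_def matrix_mul_assoc)
  also have "\<dots> = Q ** (diag_mat d ** diag_mat e) ** transpose Q"
    by (simp add: orthogonal_transpose_mult [OF assms] matrix_mul_assoc)
  finally show ?thesis
    by (simp add: spectral_def diag_mat_mult)
qed

lemma transpose_spectral [simp]: "transpose (spectral Q d) = spectral Q d"
  by (simp add: spectral_def matrix_transpose_mul matrix_mul_assoc)

lemma spectral_column:
  assumes "orthogonal_matrix Q"
  shows "spectral Q d *v (Q *v axis i 1) = d i *\<^sub>R (Q *v axis i 1)"
proof -
  have "spectral Q d *v (Q *v axis i 1) = (Q ** diag_mat d ** (transpose Q ** Q)) *v axis i 1"
    by (simp add: spectral_def matrix_vector_mul_assoc matrix_mul_assoc)
  also have "\<dots> = Q *v (diag_mat d *v axis i 1)"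
    by (simp add: orthogonal_transpose_mult [OF assms] matrix_vector_mul_assoc)
  also have "diag_mat d *v axis i 1 = d i *\<^sub>R axis i 1"
    by (simp add: vec_eq_iff axis_def)
  finally show ?thesis
    by (simp add: matrix_vector_mult_scaleR)
qed

lemma map2_apply_replicate: "map2 (\<lambda>f z. f z) (replicate (length zs) f) zs = map f zs"
  by (induction zs) auto

lemma map2_scaleR_one: "map2 (*\<^sub>R) (replicate (length zs) 1) zs = (zs :: 'a::real_vector list)"
  by (induction zs) auto

lemma map2_scaleR_map: "map2 (*\<^sub>R) (map f ks) (map q ks) = map (\<lambda>i. f i *\<^sub>R q i) ks"
  by (induction ks) auto

lemma prod_list_powr:
  assumes "\<And>i. d i > 0"
  shows "prod_list (map (\<lambda>i. d i powr u) l) = prod_list (map d l) powr u \<and> prod_list (map d l) > (0::real)"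
  using assms by (induction l) (auto simp: powr_mult less_imp_le)

text \<open>In an eigenbasis of \<open>P\<close> every component of \<open>T\<close> is scaled by a quotient of two products of
  eigenvalues.  A component can thus only be fixed by \<open>P\<close> if it vanishes or if these products
  agree, and then their powers agree as well.\<close>

lemma stabilizer_powr:
  fixes Q :: "'n::finite mat"
  assumes \<gamma>: "\<forall>T\<in>\<gamma>. is_tensor T" and Q: "orthogonal_matrix Q" and d: "\<And>i. d i > 0"
    and P: "spectral Q d \<in> stabilizer \<gamma>"
  shows "spectral Q (\<lambda>i. d i powr u) \<in> stabilizer \<gamma>"
proof -
  define P where "P u = spectral Q (\<lambda>i. d i powr u)" for u
  have tP: "transpose (P u) = P u" for u
    by (simp add: P_def)
  have PP: "P u ** P v = P (u + v)" for u v
    by (simp add: P_def spectral_mult [OF Q] powr_add)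
  have P0: "P 0 = mat 1"
    using d by (simp add: P_def spectral_def diag_mat_1 orthogonal_transpose_mult [OF Q] less_imp_neq [symmetric])
  have P1: "P 1 = spectral Q d"
    using d by (simp add: P_def less_imp_le)
  have inv: "invertible (P u)"
    unfolding invertible_def using PP [of u "- u"] PP [of "- u" u] P0 by auto
  define q where "q i = Q *v axis i 1" for i
  have Pq: "P u *v q i = (d i powr u) *\<^sub>R q i" for u i
    by (simp add: P_def q_def spectral_column [OF Q])
  have span: "span (range q) = UNIV"
  proof -
    have "x \<in> span (range q)" for x
    proof -
      have "x = Q *v (transpose Q *v x)"
        by (simp add: matrix_vector_mul_assoc orthogonal_transpose_mult [OF Q] del: transpose_matrix_vector)
      also have "transpose Q *v x = (\<Sum>i\<in>UNIV. (transpose Q *v x) $ i *\<^sub>R axis i 1)"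
        using basis_expansion [of "transpose Q *v x"] by (simp add: scalar_mult_eq_scaleR del: transpose_matrix_vector)
      finally have "x = (\<Sum>i\<in>UNIV. (transpose Q *v x) $ i *\<^sub>R q i)"
        by (simp add: q_def linear_sum [OF matrix_vector_mul_linear] matrix_vector_mult_scaleR o_def
            del: transpose_matrix_vector)
      then show ?thesis
        by (metis (no_types, lifting) span_base span_scale span_sum rangeI)
    qed
    then show ?thesis by blast
  qed
  have "T (map (\<lambda>x. P u *v x) xs) as = T xs (map (\<lambda>a. P u *v a) as)" if tin: "T \<in> \<gamma>" for T xs as
  proof -
    obtain r s where ml: "multilinear (r + s) (\<lambda>zs. T (take r zs) (drop r zs))"
      and z: "\<And>xs as. \<not> (length xs = r \<and> length as = s) \<Longrightarrow> T xs as = 0"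
      using tensor_multilinear [OF bspec [OF \<gamma> tin]] by blast
    let ?U = "\<lambda>zs. T (take r zs) (drop r zs)"
    show ?thesis
    proof (cases "length xs = r \<and> length as = s")
      case False
      then show ?thesis by (simp add: z)
    next
      case True
      let ?f = "replicate r (\<lambda>x. P u *v x) @ replicate s (\<lambda>x. x)"
      let ?h = "replicate r (\<lambda>x. x) @ replicate s (\<lambda>x. P u *v x)"
      have f: "?U (map2 (\<lambda>f z. f z) ?f (ys @ bs)) = T (map (\<lambda>x. P u *v x) ys) bs"
        and h: "?U (map2 (\<lambda>f z. f z) ?h (ys @ bs)) = T ys (map (\<lambda>x. P u *v x) bs)"
        if "length ys = r" "length bs = s" for ys bs
        using that map2_apply_replicate [of ys "\<lambda>x. P u *v x"] map2_apply_replicate [of bs "\<lambda>x. x"]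
          map2_apply_replicate [of ys "\<lambda>x. x"] map2_apply_replicate [of bs "\<lambda>x. P u *v x"]
        by simp_all
      have lin: "linear g" if "g \<in> set ?f \<union> set ?h" for g
        using that by (auto simp: linear_ident split: if_splits)
      have "?U (map2 (\<lambda>f z. f z) ?f zs) = ?U (map2 (\<lambda>f z. f z) ?h zs)" if "length zs = r + s" for zs
      proof (rule multilinear_eqI [OF _ _ span _ that])
        show "multilinear (r + s) (\<lambda>zs. ?U (map2 (\<lambda>f z. f z) ?f zs))"
          using multilinear_compose [of ?f ?U] ml lin by simp
        show "multilinear (r + s) (\<lambda>zs. ?U (map2 (\<lambda>f z. f z) ?h zs))"
          using multilinear_compose [of ?h ?U] ml lin by simp
      next
        fix zs :: "(real^'n) list" assume len: "length zs = r + s" and "set zs \<subseteq> range q"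
        then have "set (take r zs) \<subseteq> range q" "set (drop r zs) \<subseteq> range q"
          using set_take_subset [of r zs] set_drop_subset [of r zs] by auto
        then obtain ks js where "take r zs = map q ks" "drop r zs = map q js"
          by (metis ex_map_conv image_iff subset_iff)
        moreover from this have lens: "length ks = r" "length js = s"
          using len by (metis length_map length_take min_absorb2 le_add1)
            (metis \<open>drop r zs = map q js\<close> add_diff_cancel_left' len length_drop length_map)
        ultimately have zs: "zs = map q ks @ map q js"
          by (metis append_take_drop_id)
        have s1: "T (map (\<lambda>x. P v *v x) (map q ks)) (map q js) =
            prod_list (map d ks) powr v * T (map q ks) (map q js)" for v
        proof -
          have "T (map (\<lambda>x. P v *v x) (map q ks)) (map q js) =
              ?U (map2 (*\<^sub>R) (map (\<lambda>i. d i powr v) ks @ replicate s 1) (map q ks @ map q js))"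
            using lens map2_scaleR_one [of "map q js"]
            by (simp add: Pq o_def map2_scaleR_map)
          also have "\<dots> = prod_list (map (\<lambda>i. d i powr v) ks @ replicate s 1) * ?U (map q ks @ map q js)"
            using lens ml by (intro multilinear_scale) auto
          finally show ?thesis
            using prod_list_powr [of d v ks] d lens by simp
        qed
        have s2: "T (map q ks) (map (\<lambda>x. P v *v x) (map q js)) =
            prod_list (map d js) powr v * T (map q ks) (map q js)" for v
        proof -
          have "T (map q ks) (map (\<lambda>x. P v *v x) (map q js)) =
              ?U (map2 (*\<^sub>R) (replicate r 1 @ map (\<lambda>i. d i powr v) js) (map q ks @ map q js))"
            using lens map2_scaleR_one [of "map q ks"]
            by (simp add: Pq o_def map2_scaleR_map)
          also have "\<dots> = prod_list (replicate r 1 @ map (\<lambda>i. d i powr v) js) * ?U (map q ks @ map q js)"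
            using lens ml by (intro multilinear_scale) auto
          finally show ?thesis
            using prod_list_powr [of d v js] d lens by simp
        qed
        have "T (map (\<lambda>x. P 1 *v x) (map q ks)) (map q js) = T (map q ks) (map (\<lambda>x. P 1 *v x) (map q js))"
          using P tin tP [of 1] unfolding stabilizer_iff P1 by metis
        then have "T (map q ks) (map q js) = 0 \<or> prod_list (map d ks) = prod_list (map d js)"
          using prod_list_powr [of d 1 ks] prod_list_powr [of d 1 js] d unfolding s1 s2 by auto
        then have "T (map (\<lambda>x. P u *v x) (map q ks)) (map q js) = T (map q ks) (map (\<lambda>x. P u *v x) (map q js))"
          unfolding s1 s2 by auto
        then show "?U (map2 (\<lambda>f z. f z) ?f zs) = ?U (map2 (\<lambda>f z. f z) ?h zs)"
          unfolding zs using f [of "map q ks" "map q js"] h [of "map q ks" "map q js"] lens by simp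
      qed
      from this [of "xs @ as"] show ?thesis
        using True f [of xs as] h [of xs as] by simp
    qed
  qed
  then show ?thesis
    unfolding stabilizer_iff P_def [symmetric] tP using inv by blast
qed

section \<open>The spectral theorem and the Loewner order\<close>

text \<open>A minimum of the quadratic form on the unit sphere of \<open>V\<close> is an eigenvector: otherwise moving
  along the residual \<open>r = f x - l x\<close> would decrease the form to first order.\<close>

lemma min_eigenvector:
  fixes f :: "'a::euclidean_space \<Rightarrow> 'a"
  assumes f: "linear f" "\<And>x y. f x \<bullet> y = x \<bullet> f y"
    and V: "subspace V" "V \<noteq> {0}" "f ` V \<subseteq> V"
  obtains x l where "x \<in> V" "norm x = 1" "f x = l *\<^sub>R x" "\<And>y. y \<in> V \<Longrightarrow> l * (y \<bullet> y) \<le> f y \<bullet> y"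
proof -
  obtain v where v: "v \<in> V" "v \<noteq> 0"
    using V subspace_0 by blast
  then have "v /\<^sub>R norm v \<in> sphere 0 1 \<inter> V"
    using V(1) by (simp add: subspace_scale)
  then have "sphere 0 1 \<inter> V \<noteq> {}" by blast
  moreover have "compact (sphere 0 1 \<inter> V)"
    using V(1) by (intro compact_Int_closed compact_sphere closed_subspace)
  moreover have "continuous_on (sphere 0 1 \<inter> V) (\<lambda>x. f x \<bullet> x)"
    by (intro continuous_intros linear_continuous_on linear_conv_bounded_linear [THEN iffD1] f)
  ultimately have "\<exists>x\<in>sphere 0 1 \<inter> V. \<forall>y\<in>sphere 0 1 \<inter> V. f x \<bullet> x \<le> f y \<bullet> y"
    by (intro continuous_attains_inf)
  then obtain x where x: "x \<in> V" "norm x = 1"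
    and "\<forall>y\<in>sphere 0 1 \<inter> V. f x \<bullet> x \<le> f y \<bullet> y"
    by auto
  then have min: "\<And>y. y \<in> V \<Longrightarrow> norm y = 1 \<Longrightarrow> f x \<bullet> x \<le> f y \<bullet> y"
    by simp
  define l where "l = f x \<bullet> x"
  have le: "l * (y \<bullet> y) \<le> f y \<bullet> y" if "y \<in> V" for y
  proof (cases "y = 0")
    case False
    have "l \<le> f (y /\<^sub>R norm y) \<bullet> (y /\<^sub>R norm y)"
      unfolding l_def using False that V(1) by (intro min) (auto simp: subspace_scale)
    also have "\<dots> = (f y \<bullet> y) / (norm y)\<^sup>2"
      using f(1) by (simp add: linear_scale power2_eq_square divide_inverse)
    finally show ?thesis
      using False by (simp add: pos_le_divide_eq dot_square_norm)
  qed (use f(1) in \<open>simp add: linear_0\<close>)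
  define r where "r = f x - l *\<^sub>R x"
  have rV: "r \<in> V"
    unfolding r_def using x V by (auto intro!: subspace_diff subspace_scale)
  have xx: "x \<bullet> x = 1"
    using x by (simp add: dot_square_norm)
  have quad: "0 \<le> 2 * t * (r \<bullet> r) + t\<^sup>2 * (f r \<bullet> r - l * (r \<bullet> r))" for t
  proof -
    have "l * ((x + t *\<^sub>R r) \<bullet> (x + t *\<^sub>R r)) \<le> f (x + t *\<^sub>R r) \<bullet> (x + t *\<^sub>R r)"
      using x rV V(1) by (intro le) (auto intro!: subspace_add subspace_scale)
    moreover have "f x = r + l *\<^sub>R x"
      by (simp add: r_def)
    moreover have "f r \<bullet> x = r \<bullet> (r + l *\<^sub>R x)"
      using f(2) [of r x] by (simp add: r_def)
    moreover have "r \<bullet> x = 0"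
      using xx by (simp add: r_def l_def inner_diff_left)
    ultimately show ?thesis
      using f(1) xx
      by (simp add: linear_add linear_scale inner_add_left inner_add_right power2_eq_square
          inner_commute [of x r] algebra_simps)
  qed
  have "r \<bullet> r = 0"
  proof (rule ccontr)
    assume "r \<bullet> r \<noteq> 0"
    then have rr: "r \<bullet> r > 0"
      using inner_ge_zero [of r] by linarith
    define a b c where "a = r \<bullet> r" and "b = f r \<bullet> r - l * (r \<bullet> r)" and "c = \<bar>b\<bar> + 1"
    have c: "c > 0" "b \<le> c"
      by (auto simp: c_def)
    have "(- a / c)\<^sup>2 * b \<le> (- a / c)\<^sup>2 * c"
      using c by (intro mult_left_mono) auto
    also have "\<dots> = a\<^sup>2 / c"
      using c by (simp add: power2_eq_square)
    finally have "2 * (- a / c) * a + (- a / c)\<^sup>2 * b \<le> - (a\<^sup>2 / c)"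
      by (simp add: power2_eq_square)
    moreover have "a\<^sup>2 / c > 0"
      using rr c by (simp add: a_def)
    ultimately show False
      using quad [of "- a / c"] by (simp add: a_def b_def)
  qed
  then have "f x = l *\<^sub>R x"
    by (simp add: r_def)
  then show ?thesis
    using that x le by blast
qed

lemma orthonormal_eigenbasis:
  fixes f :: "'a::euclidean_space \<Rightarrow> 'a"
  assumes f: "linear f" "\<And>x y. f x \<bullet> y = x \<bullet> f y"
    and V: "subspace V" "f ` V \<subseteq> V"
  shows "\<exists>B\<subseteq>V. pairwise orthogonal B \<and> span B = V \<and> (\<forall>b\<in>B. norm b = 1 \<and> (\<exists>l. f b = l *\<^sub>R b))"
  using V
proof (induction "dim V" arbitrary: V rule: less_induct)
  case less
  show ?case
  proof (cases "V = {0}")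
    case True
    then show ?thesis
      by (intro exI [of _ "{}"]) auto
  next
    case False
    obtain x l where x: "x \<in> V" "norm x = 1" "f x = l *\<^sub>R x"
      using min_eigenvector [OF f less.prems(1) False less.prems(2)] by blast
    let ?V = "{y \<in> V. y \<bullet> x = 0}"
    have xx: "x \<bullet> x = 1"
      using x by (simp add: dot_square_norm)
    have sub: "subspace ?V"
      using less.prems(1) by (auto simp: subspace_def inner_add_left)
    have fV: "f ` ?V \<subseteq> ?V"
      using less.prems(2) f(2) x(3) by auto
    have "x \<notin> ?V"
      using xx by simp
    then have "?V \<subset> V"
      using x by blast
    then have "dim ?V < dim V"
      using dim_psubset [of ?V V] sub less.prems(1) by (metis span_eq_iff)
    then obtain B where B: "B \<subseteq> ?V" "pairwise orthogonal B" "span B = ?V"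
      "\<forall>b\<in>B. norm b = 1 \<and> (\<exists>l. f b = l *\<^sub>R b)"
      using less.hyps [OF _ sub fV] by blast
    have "span (insert x B) = V"
    proof
      show "span (insert x B) \<subseteq> V"
        using x B less.prems(1) by (intro span_minimal) auto
      show "V \<subseteq> span (insert x B)"
      proof
        fix y assume y: "y \<in> V"
        have "y - (y \<bullet> x) *\<^sub>R x \<in> ?V"
          using x y less.prems(1) xx by (auto simp: inner_diff_left intro!: subspace_diff subspace_scale)
        then have "y - (y \<bullet> x) *\<^sub>R x \<in> span B"
          using B(3) by blast
        then show "y \<in> span (insert x B)"
          using span_breakdown_eq by blast
      qed
    qed
    moreover have "pairwise orthogonal (insert x B)"
      using B(1,2) by (auto simp: pairwise_insert orthogonal_def inner_commute)
    ultimately show ?thesis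
      using B x by (intro exI [of _ "insert x B"]) auto
  qed
qed

lemma spectral_nth_inner:
  fixes x :: "real^'n::finite"
  shows "x \<bullet> (spectral Q d *v x) = (\<Sum>i\<in>UNIV. d i * ((transpose Q *v x) $ i)\<^sup>2)"
proof -
  have "x \<bullet> (spectral Q d *v x) = x \<bullet> (Q *v (diag_mat d *v (transpose Q *v x)))"
    by (simp add: spectral_def matrix_vector_mul_assoc matrix_mul_assoc del: transpose_matrix_vector)
  also have "\<dots> = (transpose Q *v x) \<bullet> (diag_mat d *v (transpose Q *v x))"
    by (simp add: dot_lmul_matrix)
  also have "\<dots> = (\<Sum>i\<in>UNIV. d i * ((transpose Q *v x) $ i)\<^sup>2)"
    unfolding inner_vec_def by (intro sum.cong) (simp_all add: power2_eq_square del: transpose_matrix_vector)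
  finally show ?thesis .
qed

lemma spectral_pos_def:
  assumes "orthogonal_matrix Q" "\<And>i. d i > 0" "x \<noteq> 0"
  shows "x \<bullet> (spectral Q d *v x) > 0"
proof -
  have "transpose Q *v x \<noteq> 0"
    using assms(3) orthogonal_transpose_mult [OF assms(1)]
    by (metis matrix_vector_mul_assoc matrix_vector_mul_lid matrix_vector_mult_0_right)
  then obtain i where "(transpose Q *v x) $ i \<noteq> 0"
    by (metis vec_eq_iff zero_index)
  then show ?thesis
    unfolding spectral_nth_inner using assms(2)
    by (intro sum_pos2 [of _ i]) (auto simp: less_imp_le simp del: transpose_matrix_vector)
qed

lemma symmetric_inner:
  fixes A :: "'n::finite mat"
  assumes "transpose A = A"
  shows "(A *v x) \<bullet> y = x \<bullet> (A *v y)"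
  using assms by (metis dot_lmul_matrix transpose_matrix_vector)

lemma spectral_theorem:
  fixes A :: "'n::finite mat"
  assumes A: "transpose A = A"
  obtains Q d where "orthogonal_matrix Q" "A = spectral Q d"
proof -
  obtain B where B: "pairwise orthogonal B" "span B = (UNIV :: (real^'n) set)"
    "\<forall>b\<in>B. norm b = 1 \<and> (\<exists>l. A *v b = l *\<^sub>R b)"
    using orthonormal_eigenbasis [of "\<lambda>x. A *v x" UNIV] symmetric_inner [OF A] by auto
  have "0 \<notin> B"
    using B(3) by force
  then have ind: "independent B"
    using B(1) pairwise_orthogonal_independent by blast
  then have "card B = CARD('n)"
    using B(2) dim_span [of B] by (simp add: dim_eq_card_independent)
  moreover have "finite B"
    using ind independent_imp_finite by blast
  ultimately obtain h where h: "bij_betw h (UNIV :: 'n set) B"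
    using finite_same_card_bij [of "UNIV :: 'n set" B] by auto
  then have hB: "h i \<in> B" for i
    by (auto simp: bij_betw_def)
  then have "\<forall>i. \<exists>l. A *v h i = l *\<^sub>R h i"
    using B(3) by blast
  then obtain d where d: "\<And>i. A *v h i = d i *\<^sub>R h i"
    by metis
  have hh: "h i \<bullet> h j = (if i = j then 1 else 0)" for i j
  proof (cases "i = j")
    case True
    then show ?thesis
      using B(3) hB [of j] by (simp add: dot_square_norm)
  next
    case False
    then have "h i \<noteq> h j"
      using h by (auto simp: bij_betw_def inj_def)
    then show ?thesis
      using False B(1) hB by (simp add: pairwise_def orthogonal_def)
  qed
  define Q :: "'n mat" where "Q = (\<chi> i j. h j $ i)"
  have Q: "orthogonal_matrix Q"
    unfolding orthogonal_matrix
    using hh by (simp add: vec_eq_iff matrix_matrix_mult_def transpose_def mat_def Q_def inner_vec_def)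
  have "A ** Q = Q ** diag_mat d"
  proof -
    have "(A ** Q) $ i $ j = (A *v h j) $ i" for i j
      by (simp add: matrix_matrix_mult_def matrix_vector_mult_def Q_def)
    then show ?thesis
      by (simp add: vec_eq_iff d) (simp add: Q_def)
  qed
  then have "A ** (Q ** transpose Q) = spectral Q d"
    by (simp add: spectral_def matrix_mul_assoc)
  then show ?thesis
    using that Q orthogonal_transpose_mult [OF Q] by simp
qed

lemma spectral_theorem_pos:
  fixes A :: "'n::finite mat"
  assumes A: "transpose A = A" and pos: "\<And>x. x \<noteq> 0 \<Longrightarrow> x \<bullet> (A *v x) > 0"
  obtains Q d where "orthogonal_matrix Q" "A = spectral Q d" "\<And>i. d i > 0"
proof -
  obtain Q d where Q: "orthogonal_matrix Q" "A = spectral Q d"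
    using spectral_theorem [OF A] .
  have "d i > 0" for i
  proof -
    let ?x = "Q *v axis i 1"
    have "transpose Q *v ?x = axis i 1"
      by (simp add: matrix_vector_mul_assoc orthogonal_transpose_mult [OF Q(1)] del: transpose_matrix_vector)
    then have "?x \<noteq> 0"
      by (metis axis_eq_0_iff matrix_vector_mult_0_right zero_neq_one)
    then have "0 < ?x \<bullet> (A *v ?x)"
      by (rule pos)
    also have "\<dots> = d i * (?x \<bullet> ?x)"
      unfolding Q(2) spectral_column [OF Q(1)] by simp
    finally show ?thesis
      using inner_ge_zero [of ?x] by (simp add: zero_less_mult_iff not_less [symmetric])
  qed
  then show ?thesis
    using that Q by blast
qed

definition loewner_le :: "'n::finite mat \<Rightarrow> 'n mat \<Rightarrow> bool" where
  "loewner_le A B \<longleftrightarrow> (\<forall>x. x \<bullet> (A *v x) \<le> x \<bullet> (B *v x))"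

text \<open>Let \<open>x\<close> be an eigenvector of \<open>S - R\<close> for its least eigenvalue \<open>l\<close>.  Then \<open>l\<close> times the positive
  number \<open>x \<bullet> (S + R) x\<close> is the value of the form \<open>S\<^sup>2 - R\<^sup>2\<close> at \<open>x\<close>, and hence \<open>l \<ge> 0\<close>.\<close>

lemma loewner_le_sqrt:
  fixes R S :: "'n::finite mat"
  assumes sym: "transpose R = R" "transpose S = S"
    and pos: "\<And>x. x \<noteq> 0 \<Longrightarrow> x \<bullet> (R *v x) > 0" "\<And>x. x \<noteq> 0 \<Longrightarrow> x \<bullet> (S *v x) > 0"
    and le: "loewner_le (R ** R) (S ** S)"
  shows "loewner_le R S"
proof -
  have lin: "linear (\<lambda>x. (S - R) *v x)"
    by (rule matrix_vector_mul_linear)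
  have sa: "((S - R) *v x) \<bullet> y = x \<bullet> ((S - R) *v y)" for x y
    using symmetric_inner [OF sym(1), of x y] symmetric_inner [OF sym(2), of x y]
    by (simp add: matrix_vector_mult_diff_rdistrib inner_diff_left inner_diff_right)
  have "(axis undefined 1 :: real^'n) \<noteq> 0"
    by (simp add: axis_eq_0_iff)
  then have "(UNIV :: (real^'n) set) \<noteq> {0}" by blast
  then obtain x l where x: "norm x = 1" "(S - R) *v x = l *\<^sub>R x"
    and l: "\<And>y. l * (y \<bullet> y) \<le> ((S - R) *v y) \<bullet> y"
    using min_eigenvector [OF lin sa, of UNIV] by auto
  have x0: "x \<noteq> 0"
    using x by auto
  have Sx: "S *v x = R *v x + l *\<^sub>R x"
    using x(2) by (simp add: matrix_vector_mult_diff_rdistrib algebra_simps)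
  have sq: "y \<bullet> ((M ** M) *v y) = (M *v y) \<bullet> (M *v y)" if "transpose M = M" for M :: "'n mat" and y
    using symmetric_inner [OF that, of y "M *v y"] by (simp add: matrix_vector_mul_assoc)
  have "0 \<le> (S *v x) \<bullet> (S *v x) - (R *v x) \<bullet> (R *v x)"
    using le [unfolded loewner_le_def, rule_format, of x] sq [OF sym(1), of x] sq [OF sym(2), of x]
    by linarith
  also have "\<dots> = l * (x \<bullet> (S *v x) + x \<bullet> (R *v x))"
    unfolding Sx by (simp add: inner_add_left inner_add_right inner_commute algebra_simps)
  finally have "0 \<le> l"
    using pos [OF x0] by (simp add: zero_le_mult_iff)
  have "0 \<le> y \<bullet> (S *v y) - y \<bullet> (R *v y)" for y
  proof -
    have "0 \<le> ((S - R) *v y) \<bullet> y"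
      using l [of y] mult_nonneg_nonneg [OF \<open>0 \<le> l\<close> inner_ge_zero [of y]] by linarith
    then show ?thesis
      by (simp add: matrix_vector_mult_diff_rdistrib inner_commute inner_diff_right)
  qed
  then show ?thesis
    by (simp add: loewner_le_def)
qed

lemma loewner_le_root:
  assumes Q: "orthogonal_matrix Q1" "orthogonal_matrix Q2"
    and d: "\<And>i. d1 i > 0" "\<And>i. d2 i > 0"
    and le: "loewner_le (spectral Q1 d1) (spectral Q2 d2)"
  shows "loewner_le (spectral Q1 (\<lambda>i. d1 i powr (1 / 2 ^ m))) (spectral Q2 (\<lambda>i. d2 i powr (1 / 2 ^ m)))"
proof (induction m)
  case 0
  then show ?case
    using le d by (simp add: less_imp_le)
next
  case (Suc m)
  have s: "c powr (1 / 2 ^ Suc m) * c powr (1 / 2 ^ Suc m) = c powr (1 / 2 ^ m)" for c :: real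
    by (simp add: powr_add [symmetric])
  show ?case
  proof (rule loewner_le_sqrt)
    show "loewner_le
       (spectral Q1 (\<lambda>i. d1 i powr (1 / 2 ^ Suc m)) ** spectral Q1 (\<lambda>i. d1 i powr (1 / 2 ^ Suc m)))
       (spectral Q2 (\<lambda>i. d2 i powr (1 / 2 ^ Suc m)) ** spectral Q2 (\<lambda>i. d2 i powr (1 / 2 ^ Suc m)))"
      unfolding spectral_mult [OF Q(1)] spectral_mult [OF Q(2)] s by (rule Suc.IH)
  qed (use d in \<open>auto intro!: spectral_pos_def Q simp: less_imp_neq [symmetric]\<close>)
qed

section \<open>Gram-Schmidt adapted to a flag\<close>

text \<open>Gram-Schmidt, adding vectors by increasing key \<open>f\<close>.  Vectors with equal keys may come in any order,
  since each span condition involves all keys up to \<open>f j\<close>.\<close>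

lemma flag_gram_schmidt:
  fixes G :: "'n::finite \<Rightarrow> real^'n" and f :: "'n \<Rightarrow> real"
  assumes indep: "\<And>S x. x \<notin> S \<Longrightarrow> G x \<notin> span (G ` S)"
  shows "\<exists>k :: 'n \<Rightarrow> real^'n. (\<forall>i j. k i \<bullet> k j = (if i = j then 1 else 0)) \<and>
    (\<forall>j. G j \<in> span (k ` {i. f i \<le> f j}) \<and> k j \<in> span (G ` {i. f i \<le> f j}))"
proof -
  define P where "P S \<longleftrightarrow> (\<exists>k :: 'n \<Rightarrow> real^'n.
      (\<forall>i\<in>S. \<forall>j\<in>S. k i \<bullet> k j = (if i = j then 1 else 0)) \<and>
      (\<forall>j\<in>S. G j \<in> span (k ` {i\<in>S. f i \<le> f j}) \<and> k j \<in> span (G ` {i\<in>S. f i \<le> f j})))" for S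
  have "finite (UNIV :: 'n set)" by simp
  then have "P UNIV"
  proof (induction rule: finite_ranking_induct [where f = f])
    case empty
    show ?case by (simp add: P_def)
  next
    case (insert x S)
    show ?case
    proof (cases "x \<in> S")
      case True
      then show ?thesis
        using insert by (simp add: insert_absorb)
    next
      case False
      obtain k where k: "\<And>i j. i \<in> S \<Longrightarrow> j \<in> S \<Longrightarrow> k i \<bullet> k j = (if i = j then 1 else 0)"
        and Gk: "\<And>j. j \<in> S \<Longrightarrow> G j \<in> span (k ` {i\<in>S. f i \<le> f j})"
        and kG: "\<And>j. j \<in> S \<Longrightarrow> k j \<in> span (G ` {i\<in>S. f i \<le> f j})"
        using insert.IH unfolding P_def by blast
      define p where "p = (\<Sum>y\<in>S. (G x \<bullet> k y) *\<^sub>R k y)"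
      define u where "u = G x - p"
      have kS: "k j \<in> span (G ` S)" if "j \<in> S" for j
        using kG [OF that] span_mono [of "G ` {i\<in>S. f i \<le> f j}" "G ` S"] by auto
      have p1: "p \<in> span (G ` S)"
        unfolding p_def by (intro span_sum span_scale kS)
      have p2: "p \<in> span (k ` S)"
        unfolding p_def by (intro span_sum span_scale span_base) auto
      have "u \<noteq> 0"
        using indep [OF False] p1 by (auto simp: u_def)
      have uk: "u \<bullet> k z = 0" if "z \<in> S" for z
      proof -
        have "p \<bullet> k z = (\<Sum>y\<in>S. (G x \<bullet> k y) * (if y = z then 1 else 0))"
          unfolding p_def inner_sum_left using that by (intro sum.cong) (simp_all add: k)
        also have "\<dots> = G x \<bullet> k z"
          using that insert.hyps(1) by (simp add: if_distrib [of "\<lambda>c. _ * c"] sum.delta cong: if_cong)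
        finally show ?thesis
          by (simp add: u_def inner_diff_left)
      qed
      define k' where "k' = k(x := u /\<^sub>R norm u)"
      have k'S: "k' i = k i" if "i \<in> S" for i
        using that False by (auto simp: k'_def)
      have k'x: "k' x = u /\<^sub>R norm u"
        by (simp add: k'_def)
      have all: "{i \<in> insert x S. f i \<le> f x} = insert x S"
        using insert.hyps(2) by auto
      have im: "k' ` insert x S = insert (k' x) (k ` S)"
        using k'S by auto
      have "\<forall>i\<in>insert x S. \<forall>j\<in>insert x S. k' i \<bullet> k' j = (if i = j then 1 else 0)"
        using False \<open>u \<noteq> 0\<close> uk k
        by (auto simp: k'x k'S inner_commute [of _ u] dot_square_norm power2_eq_square field_simps)
      moreover have "G j \<in> span (k' ` {i \<in> insert x S. f i \<le> f j}) \<and>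
          k' j \<in> span (G ` {i \<in> insert x S. f i \<le> f j})" if "j \<in> insert x S" for j
      proof (cases "j = x")
        case True
        have "G x = norm u *\<^sub>R k' x + p"
          using \<open>u \<noteq> 0\<close> by (simp add: k'x u_def)
        moreover have "k' x \<in> span (insert (k' x) (k ` S))" "p \<in> span (insert (k' x) (k ` S))"
          using p2 span_mono [of "k ` S" "insert (k' x) (k ` S)"] by (auto intro: span_base)
        ultimately have "G x \<in> span (k' ` insert x S)"
          unfolding im by (metis span_add span_scale)
        moreover have "k' x \<in> span (G ` insert x S)"
          unfolding k'x u_def
          using p1 span_mono [of "G ` S" "G ` insert x S"]
          by (intro span_scale span_diff) (auto intro: span_base)
        ultimately show ?thesis
          unfolding True all by blast
      next
        case False
        then have j: "j \<in> S"
          using that by simp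
        have "k ` {i \<in> S. f i \<le> f j} = k' ` {i \<in> S. f i \<le> f j}"
          using k'S by (intro image_cong) auto
        then have "k ` {i \<in> S. f i \<le> f j} \<subseteq> k' ` {i \<in> insert x S. f i \<le> f j}"
          by auto
        moreover have "G ` {i \<in> S. f i \<le> f j} \<subseteq> G ` {i \<in> insert x S. f i \<le> f j}"
          by auto
        ultimately show ?thesis
          using subsetD [OF span_mono Gk [OF j]] subsetD [OF span_mono kG [OF j]] k'S [OF j] by simp
      qed
      ultimately show ?thesis
        unfolding P_def by blast
    qed
  qed
  then show ?thesis
    by (simp add: P_def)
qed

text \<open>A QR decomposition in which "triangular" refers to the preorder of the indices given by a
  real-valued key.  For a diagonal matrix with entries \<open>- f\<close> this keeps the conjugates of \<open>q\<close> and \<open>r\<close> by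
  its flow bounded in positive time.\<close>

lemma flag_qr:
  fixes g :: "'n::finite mat" and f :: "'n \<Rightarrow> real"
  assumes "invertible g"
  obtains k q r where "orthogonal_matrix k" "g = k ** q" "q ** r = mat 1" "r ** q = mat 1"
    "\<And>i j. q $ i $ j \<noteq> 0 \<Longrightarrow> f i \<le> f j" "\<And>i j. r $ i $ j \<noteq> 0 \<Longrightarrow> f i \<le> f j"
proof -
  obtain h where gh: "g ** h = mat 1" and hg: "h ** g = mat 1"
    using assms by (auto simp: invertible_def)
  define G where "G j = g *v axis j 1" for j
  have hG: "h *v G j = axis j 1" for j
    by (simp add: G_def matrix_vector_mul_assoc hg)
  have vanish: "(h *v v) $ x = 0" if "v \<in> span (G ` S)" "x \<notin> S" for v x S
    using that(1)
  proof (induction rule: span_induct)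
    case base
    show ?case
      by (auto simp: subspace_def matrix_vector_right_distrib matrix_vector_mult_scaleR)
  next
    case (step v)
    then show ?case
      using that(2) by (auto simp: hG axis_def)
  qed
  have "G x \<notin> span (G ` S)" if "x \<notin> S" for S x
    using vanish [of "G x" S x] that by (auto simp: hG)
  then obtain K where K: "\<And>i j. K i \<bullet> K j = (if i = j then 1 else 0)"
    and GK: "\<And>j. G j \<in> span (K ` {i. f i \<le> f j})" and KG: "\<And>j. K j \<in> span (G ` {i. f i \<le> f j})"
    using flag_gram_schmidt [of G f] by blast
  define k :: "'n mat" where "k = (\<chi> i j. K j $ i)"
  have kK: "k *v axis j 1 = K j" for j
    by (simp add: k_def vec_eq_iff matrix_vector_mult_def axis_def if_distrib [of "\<lambda>c. _ * c"] cong: if_cong)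
  have ok: "orthogonal_matrix k"
    unfolding orthogonal_matrix
    using K by (simp add: vec_eq_iff matrix_matrix_mult_def transpose_def mat_def k_def inner_vec_def)
  note kk = orthogonal_transpose_mult [OF ok]
  define q where "q = transpose k ** g"
  define r where "r = h ** k"
  have entry: "M $ i $ j = (M *v axis j 1) $ i" for M :: "'n mat" and i j
    by (simp add: matrix_vector_mult_def axis_def if_distrib [of "\<lambda>c. _ * c"] cong: if_cong)
  show ?thesis
  proof
    show "orthogonal_matrix k" by (rule ok)
    show "g = k ** q"
      using kk by (simp add: q_def matrix_mul_assoc)
    show "q ** r = mat 1"
      using kk gh by (metis q_def r_def matrix_mul_assoc matrix_mul_lid)
    show "r ** q = mat 1"
      using kk hg by (metis q_def r_def matrix_mul_assoc matrix_mul_lid)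
  next
    fix i j assume nz: "q $ i $ j \<noteq> 0"
    have "q $ i $ j = K i \<bullet> G j"
      by (simp add: q_def matrix_matrix_mult_def transpose_def k_def inner_vec_def G_def matrix_vector_mult_def
          axis_def if_distrib [of "\<lambda>c. _ * c"] cong: if_cong)
    moreover have "K i \<bullet> v = 0" if "v \<in> span (K ` {i. f i \<le> f j})" "\<not> f i \<le> f j" for v
      using that(1)
    proof (induction rule: span_induct)
      case base
      show ?case
        by (auto simp: subspace_def inner_add_right)
    next
      case (step v)
      then show ?case
        using that(2) K by auto
    qed
    ultimately show "f i \<le> f j"
      using GK [of j] nz by metis
  next
    fix i j assume nz: "r $ i $ j \<noteq> 0"
    have "r $ i $ j = (h *v K j) $ i"
      using entry [of r i j] by (simp add: r_def kK [symmetric] matrix_vector_mul_assoc)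
    then show "f i \<le> f j"
      using vanish [OF KG [of j], of i] nz by auto
  qed
qed

section \<open>Conjugating by the orthogonal factor\<close>

lemma matrix_vector_norm_le:
  fixes M :: "'n::finite mat"
  shows "(M *v v) \<bullet> (M *v v) \<le> (M \<bullet> M) * (v \<bullet> v)"
proof -
  have "(M *v v) \<bullet> (M *v v) = (\<Sum>j\<in>UNIV. (M $ j \<bullet> v)\<^sup>2)"
    by (simp add: inner_vec_def [of "M *v v"] matrix_vector_mul_component power2_eq_square)
  also have "\<dots> \<le> (\<Sum>j\<in>UNIV. (M $ j \<bullet> M $ j) * (v \<bullet> v))"
    by (intro sum_mono Cauchy_Schwarz_ineq)
  also have "\<dots> = (M \<bullet> M) * (v \<bullet> v)"
    by (simp add: inner_vec_def [of M] sum_distrib_right)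
  finally show ?thesis .
qed

lemma symmetric_entry_polar:
  fixes A :: "'n::finite mat"
  assumes "transpose A = A"
  shows "A $ i $ j = (((axis i 1 + axis j 1) \<bullet> (A *v (axis i 1 + axis j 1))) -
    axis i 1 \<bullet> (A *v axis i 1) - axis j 1 \<bullet> (A *v axis j 1)) / 2"
proof -
  have e: "axis i 1 \<bullet> (A *v axis j 1) = A $ i $ j" for i j
  proof -
    have "axis i 1 \<bullet> (A *v axis j 1) = (A *v axis j 1) $ i"
      by (simp add: inner_axis')
    also have "\<dots> = A $ i $ j"
      by (simp add: matrix_vector_mult_def axis_def if_distrib [of "\<lambda>c. _ * c"] cong: if_cong)
    finally show ?thesis .
  qed
  have "A $ i $ j = A $ j $ i"
    using assms by (metis transpose_def vec_lambda_beta)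
  then show ?thesis
    by (simp add: matrix_vector_right_distrib inner_add_left inner_add_right e)
qed

lemma tendsto_symmetric_matrix:
  fixes A :: "nat \<Rightarrow> 'n::finite mat"
  assumes "\<And>m. transpose (A m) = A m" "transpose L = L"
    and "\<And>x. (\<lambda>m. x \<bullet> (A m *v x)) \<longlonglongrightarrow> x \<bullet> (L *v x)"
  shows "A \<longlonglongrightarrow> L"
  unfolding vec_eq_iff
proof (intro vec_tendstoI)
  fix i j
  show "(\<lambda>m. A m $ i $ j) \<longlonglongrightarrow> L $ i $ j"
    unfolding symmetric_entry_polar [OF assms(1)] symmetric_entry_polar [OF assms(2)]
    by (intro tendsto_intros assms(3)) simp
qed

lemma diagonal_eq_diag_mat:
  assumes "Z \<in> diagonal_matrices"
  shows "Z = diag_mat (\<lambda>i. Z $ i $ i)"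
  using assms by (auto simp: vec_eq_iff diagonal_matrices_def)

text \<open>Conjugation by the flow of \<open>z\<close> multiplies the entry \<open>(i, j)\<close> by \<open>exp (- t (z i - z j))\<close>, which is at
  most \<open>1\<close> wherever \<open>q\<close> does not vanish.\<close>

lemma triangular_flow_le:
  fixes q :: "'n::finite mat"
  assumes tri: "\<And>i j. q $ i $ j \<noteq> 0 \<Longrightarrow> z j \<le> z i" and "t \<ge> 0"
  defines "M \<equiv> transpose (diag_mat (\<lambda>i. exp (- t * z i)) ** q ** diag_mat (\<lambda>i. exp (t * z i)))"
  shows "M \<bullet> M \<le> q \<bullet> q"
proof -
  have e: "(M $ j $ i)\<^sup>2 \<le> (q $ i $ j)\<^sup>2" for i j
  proof (cases "q $ i $ j = 0")
    case False
    have "t * z j \<le> t * z i"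
      using tri [OF False] assms(2) by (intro mult_left_mono)
    then have "exp (- t * z i) * exp (t * z j) \<le> 1"
      by (simp flip: exp_add)
    then have "(exp (- t * z i) * exp (t * z j))\<^sup>2 * (q $ i $ j)\<^sup>2 \<le> 1 * (q $ i $ j)\<^sup>2"
      by (intro mult_right_mono) (auto simp: abs_square_le_1)
    then show ?thesis
      by (simp add: M_def transpose_def power_mult_distrib mult_ac)
  qed (simp add: M_def transpose_def)
  have "M \<bullet> M = (\<Sum>i\<in>UNIV. \<Sum>j\<in>UNIV. (M $ j $ i)\<^sup>2)"
    unfolding inner_vec_def by (subst sum.swap) (simp add: power2_eq_square)
  also have "\<dots> \<le> (\<Sum>i\<in>UNIV. \<Sum>j\<in>UNIV. (q $ i $ j)\<^sup>2)"
    by (intro sum_mono e)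
  also have "\<dots> = q \<bullet> q"
    unfolding inner_vec_def by (simp add: power2_eq_square)
  finally show ?thesis .
qed

text \<open>With \<open>D\<close> the flow and \<open>q\<^sub>t = D\<^sup>-\<^sup>1 q D\<close>, the matrix \<open>q D = D q\<^sub>t\<close> has transpose \<open>q\<^sub>t\<^sup>T D\<close>, and both \<open>q\<^sub>t\<close> and its
  inverse are bounded uniformly in \<open>t\<close>.\<close>

lemma sandwich_by_powers:
  fixes q r :: "'n::finite mat"
  assumes qr: "q ** r = mat 1" and t: "t \<ge> 0"
    and tri: "\<And>i j. q $ i $ j \<noteq> 0 \<Longrightarrow> z j \<le> z i" "\<And>i j. r $ i $ j \<noteq> 0 \<Longrightarrow> z j \<le> z i"
  defines "B \<equiv> transpose (q ** diag_mat (\<lambda>i. exp (t * z i)))"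
    and "D \<equiv> diag_mat (\<lambda>i. exp (t * z i))"
  shows "(B *v y) \<bullet> (B *v y) \<le> (q \<bullet> q) * ((D *v y) \<bullet> (D *v y))"
    and "(D *v y) \<bullet> (D *v y) \<le> (r \<bullet> r) * ((B *v y) \<bullet> (B *v y))"
proof -
  let ?D' = "diag_mat (\<lambda>i. exp (- t * z i))"
  let ?q = "transpose (?D' ** q ** D)" and ?r = "transpose (?D' ** r ** D)"
  have DD: "D ** ?D' = mat 1" "?D' ** D = mat 1"
    by (simp_all add: D_def diag_mat_mult flip: exp_add diag_mat_1)
  have tD: "transpose D = D"
    by (simp add: D_def)
  have B: "B = ?q ** D"
  proof -
    have "q ** D = (D ** ?D') ** q ** D"
      using DD(1) by (metis matrix_mul_lid)
    then have "B = transpose (D ** (?D' ** q ** D))"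
      by (simp add: B_def D_def [symmetric] matrix_mul_assoc)
    then show ?thesis
      by (simp add: matrix_transpose_mul tD)
  qed
  have "(?D' ** q ** D) ** (?D' ** r ** D) = ?D' ** (q ** (D ** ?D') ** r) ** D"
    by (simp add: matrix_mul_assoc)
  also have "\<dots> = mat 1"
    using DD qr by (metis matrix_mul_rid)
  finally have "?r ** ?q = mat 1"
    by (metis matrix_transpose_mul transpose_mat)
  then have D: "D = ?r ** B"
    by (simp add: B matrix_mul_assoc)
  have "(B *v y) \<bullet> (B *v y) \<le> (?q \<bullet> ?q) * ((D *v y) \<bullet> (D *v y))"
    using matrix_vector_norm_le [of ?q "D *v y"] by (simp add: B matrix_vector_mul_assoc)
  also have "\<dots> \<le> (q \<bullet> q) * ((D *v y) \<bullet> (D *v y))"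
    unfolding D_def by (intro mult_right_mono triangular_flow_le tri t) auto
  finally show "(B *v y) \<bullet> (B *v y) \<le> (q \<bullet> q) * ((D *v y) \<bullet> (D *v y))" .
  have "(D *v y) \<bullet> (D *v y) = (?r *v (B *v y)) \<bullet> (?r *v (B *v y))"
    using D by (simp add: matrix_vector_mul_assoc del: transpose_matrix_vector)
  also have "\<dots> \<le> (?r \<bullet> ?r) * ((B *v y) \<bullet> (B *v y))"
    by (rule matrix_vector_norm_le)
  also have "\<dots> \<le> (r \<bullet> r) * ((B *v y) \<bullet> (B *v y))"
    unfolding D_def by (intro mult_right_mono triangular_flow_le tri t) auto
  finally show "(D *v y) \<bullet> (D *v y) \<le> (r \<bullet> r) * ((B *v y) \<bullet> (B *v y))" .
qed

text \<open>The factor \<open>k\<close> itself need not lie in the group.  However, the positive definite matrix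
  \<open>P t = g e\<^sup>2\<^sup>t\<^sup>Z g\<^sup>T\<close> does, and it lies between two multiples of \<open>k e\<^sup>2\<^sup>t\<^sup>Z k\<^sup>T\<close> with factors independent of
  \<open>t \<ge> 0\<close>.  For \<open>t = 2\<^sup>m\<close>, taking the root of order \<open>2\<^sup>m\<close> preserves both the Loewner order and membership
  in the group, and the factors tend to \<open>1\<close>.  So \<open>k e\<^sup>2\<^sup>Z k\<^sup>T\<close> and its real powers lie in the group.\<close>

lemma gl_gamma_flag_conj:
  fixes Z g k q r :: "'n::finite mat"
  assumes \<gamma>: "\<forall>T\<in>\<gamma>. is_tensor T" and sa: "self_adjoint_group (stabilizer \<gamma>)"
    and Z: "Z \<in> a_gamma \<gamma>" and g: "g \<in> stabilizer \<gamma>" and k: "orthogonal_matrix k" and gkq: "g = k ** q"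
    and qr: "q ** r = mat 1"
    and tri: "\<And>i j. q $ i $ j \<noteq> 0 \<Longrightarrow> Z $ j $ j \<le> Z $ i $ i"
      "\<And>i j. r $ i $ j \<noteq> 0 \<Longrightarrow> Z $ j $ j \<le> Z $ i $ i"
  shows "k ** Z ** transpose k \<in> gl_gamma \<gamma>"
proof -
  define z where "z i = Z $ i $ i" for i
  have Zz: "Z = diag_mat z"
    using Z diagonal_eq_diag_mat [of Z] by (simp add: z_def [abs_def] a_gamma_def)
  define D where "D t = diag_mat (\<lambda>i. exp (t * z i))" for t
  define L where "L = spectral k (\<lambda>i. exp (2 * z i))"
  have DG: "D t \<in> stabilizer \<gamma>" for t
    using Z unfolding a_gamma_def p_gamma_def gl_gamma_def lie_algebra_of_def
    by (auto simp: Zz scaleR_diag_mat mat_exp_diag D_def)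
  have kk: "transpose k ** k = mat 1" "k ** transpose k = mat 1"
    using orthogonal_transpose_mult [OF k] .
  have mat1: "mat 1 \<noteq> (0 :: 'n mat)"
    by (auto simp: vec_eq_iff mat_def)
  have q0: "q \<bullet> q > 0" and r0: "r \<bullet> r > 0"
    using qr mat1 by auto
  \<comment> \<open>the two factors of the sandwich\<close>
  define c where "c = inverse (r \<bullet> r)"
  define C where "C = q \<bullet> q"
  have cC: "c > 0" "C > 0"
    using q0 r0 by (auto simp: c_def C_def)
  define P where "P t = g ** D (2 * t) ** transpose g" for t
  have PG: "P t \<in> stabilizer \<gamma>" for t
    using g sa DG unfolding P_def self_adjoint_group_def by (intro stabilizer_mult) auto
  have tP: "transpose (P t) = P t" for t
    by (simp add: P_def D_def matrix_transpose_mul matrix_mul_assoc)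
  have Pq: "x \<bullet> (P t *v x) = (transpose (q ** D t) *v (transpose k *v x)) \<bullet> (transpose (q ** D t) *v (transpose k *v x))"
    for t x
  proof -
    have "D (2 * t) = D t ** D t"
      by (simp add: D_def diag_mat_mult mult.assoc flip: exp_add)
    then have "P t = (k ** (q ** D t)) ** transpose (k ** (q ** D t))"
      by (simp add: P_def gkq matrix_transpose_mul matrix_mul_assoc) (simp add: D_def)
    then have "x \<bullet> (P t *v x) = (transpose (k ** (q ** D t)) *v x) \<bullet> (transpose (k ** (q ** D t)) *v x)"
      by (simp add: dot_lmul_matrix flip: matrix_vector_mul_assoc)
    then show ?thesis
      by (simp add: matrix_transpose_mul matrix_vector_mul_assoc del: transpose_matrix_vector)
  qed
  have Dq: "(D t *v (transpose k *v x)) \<bullet> (D t *v (transpose k *v x)) =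
      x \<bullet> (spectral k (\<lambda>i. exp (2 * t * z i)) *v x)" for t x
  proof -
    have "exp (2 * t * z i) = exp (t * z i) * exp (t * z i)" for i
      by (simp flip: exp_add)
    then show ?thesis
      unfolding spectral_nth_inner unfolding inner_vec_def D_def
      by (simp add: power2_eq_square mult_ac del: transpose_matrix_vector)
  qed
  have sc: "x \<bullet> (spectral k (\<lambda>i. a * d i) *v x) = a * (x \<bullet> (spectral k d *v x))" for a d x
    by (simp add: spectral_nth_inner sum_distrib_left mult.assoc)
  have lo: "loewner_le (spectral k (\<lambda>i. c * exp (2 * t * z i))) (P t)"
    and hi: "loewner_le (P t) (spectral k (\<lambda>i. C * exp (2 * t * z i)))" if "t \<ge> 0" for t
    unfolding loewner_le_def sc Dq [symmetric] Pq
    using sandwich_by_powers [OF qr that, of z] tri r0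
    by (auto simp: D_def z_def c_def C_def field_simps simp del: transpose_matrix_vector)
  have "\<exists>Q d. orthogonal_matrix Q \<and> P t = spectral Q d \<and> (\<forall>i. d i > 0)" if "t \<ge> 0" for t
  proof -
    have "x \<bullet> (P t *v x) > 0" if "x \<noteq> 0" for x
    proof -
      have "0 < x \<bullet> (spectral k (\<lambda>i. c * exp (2 * t * z i)) *v x)"
        using cC that by (intro spectral_pos_def k) auto
      then show ?thesis
        using lo [OF \<open>t \<ge> 0\<close>] unfolding loewner_le_def by (meson less_le_trans)
    qed
    then show ?thesis
      using spectral_theorem_pos [OF tP [of t]] by metis
  qed
  then have "\<forall>m::nat. \<exists>Q d. orthogonal_matrix Q \<and> P (2 ^ m) = spectral Q d \<and> (\<forall>i. d i > 0)"
    by simp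
  then obtain Q d where Q: "\<And>m. orthogonal_matrix (Q m)" and PQ: "\<And>m. P (2 ^ m) = spectral (Q m) (d m)"
    and d: "\<And>m i. d m i > 0"
    by metis
  define A where "A m = spectral (Q m) (\<lambda>i. d m i powr (1 / 2 ^ m))" for m
  have AG: "A m \<in> stabilizer \<gamma>" for m
    unfolding A_def using PG [of "2 ^ m"] by (intro stabilizer_powr \<gamma> Q d) (simp add: PQ)
  have root: "(a * exp (2 * 2 ^ m * y)) powr (1 / 2 ^ m) = a powr (1 / 2 ^ m) * exp (2 * y)"
    if "a > 0" for a y :: real and m :: nat
    using that by (simp add: powr_mult powr_def [of "exp _"])
  have Alo: "c powr (1 / 2 ^ m) * (x \<bullet> (L *v x)) \<le> x \<bullet> (A m *v x)" for m x
    using loewner_le_root [OF k Q [of m], of "\<lambda>i. c * exp (2 * 2 ^ m * z i)" "d m" m] d lo [of "2 ^ m"] cC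
    by (simp add: loewner_le_def root sc L_def A_def PQ)
  have Ahi: "x \<bullet> (A m *v x) \<le> C powr (1 / 2 ^ m) * (x \<bullet> (L *v x))" for m x
    using loewner_le_root [OF Q [of m] k, of "d m" "\<lambda>i. C * exp (2 * 2 ^ m * z i)" m] d hi [of "2 ^ m"] cC
    by (simp add: loewner_le_def root sc L_def A_def PQ)
  have lim1: "(\<lambda>m. a powr (1 / 2 ^ m) * y) \<longlonglongrightarrow> y" if "a > 0" for a y :: real
  proof -
    have "(\<lambda>m. (1 / 2) ^ m :: real) \<longlonglongrightarrow> 0"
      by (intro LIMSEQ_power_zero) simp
    then have "(\<lambda>m. 1 / 2 ^ m :: real) \<longlonglongrightarrow> 0"
      by (simp add: power_one_over)
    then have "(\<lambda>m. a powr (1 / 2 ^ m) * y) \<longlonglongrightarrow> a powr 0 * y"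
      using that by (intro tendsto_intros) auto
    then show ?thesis
      using that by simp
  qed
  have "(\<lambda>m. x \<bullet> (A m *v x)) \<longlonglongrightarrow> x \<bullet> (L *v x)" for x
    using Alo Ahi by (intro tendsto_sandwich [OF _ _ lim1 [OF cC(1)] lim1 [OF cC(2)]]) auto
  then have "A \<longlonglongrightarrow> L"
    by (intro tendsto_symmetric_matrix) (simp_all add: A_def L_def)
  moreover have "invertible L"
  proof -
    have "L ** spectral k (\<lambda>i. exp (- 2 * z i)) = mat 1" "spectral k (\<lambda>i. exp (- 2 * z i)) ** L = mat 1"
      unfolding L_def spectral_mult [OF k] by (simp_all add: spectral_def diag_mat_1 kk flip: exp_add)
    then show ?thesis
      unfolding invertible_def by blast
  qed
  ultimately have "L \<in> stabilizer \<gamma>"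
    by (rule stabilizer_closed [where g = A, OF \<gamma> AG])
  then have "spectral k (\<lambda>i. exp (2 * z i) powr (t / 2)) \<in> stabilizer \<gamma>" for t
    unfolding L_def by (intro stabilizer_powr \<gamma> k) auto
  moreover have "spectral k (\<lambda>i. exp (2 * z i) powr (t / 2)) = mat_exp (t *\<^sub>R (k ** Z ** transpose k))" for t
  proof -
    have "mat_exp (t *\<^sub>R (k ** Z ** transpose k)) = mat_exp (k ** diag_mat (\<lambda>i. t * z i) ** transpose k)"
      unfolding Zz scaleR_diag_mat [symmetric] by (simp add: mat_ring)
    also have "\<dots> = spectral k (\<lambda>i. exp (t * z i))"
      by (simp add: mat_exp_conj [OF kk(1)] mat_exp_diag spectral_def)
    finally show ?thesis
      by (simp add: powr_def)
  qed
  ultimately show ?thesis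
    by (simp add: gl_gamma_def lie_algebra_of_def)
qed

section \<open>Brackets and their moment matrix\<close>

lemma mat_inner_eq_inner: "mat_inner = (\<bullet>)"
proof (intro ext)
  fix X Y :: "'n::finite mat"
  show "mat_inner X Y = X \<bullet> Y"
    by (simp add: mat_inner_def trace_def matrix_matrix_mult_def transpose_def inner_vec_def)
qed

lemma bracket_inner_alt:
  "bracket_inner \<mu> \<nu> = (\<Sum>i\<in>UNIV. \<Sum>j\<in>UNIV. \<mu> (axis i 1) (axis j 1) \<bullet> \<nu> (axis i 1) (axis j 1))"
  unfolding bracket_inner_def inner_axis by (simp add: inner_vec_def)

text \<open>The gradient of \<open>g \<mapsto> \<langle>g \<cdot> w, g \<cdot> w\<rangle> / 2\<close> at the identity, that is, the moment map of the full linear group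
  without the factor \<open>1 / \<langle>w, w\<rangle>\<close>; it is also four times the Ricci operator if \<open>w\<close> is nilpotent.\<close>

definition moment_mat :: "'n::finite bracket \<Rightarrow> 'n mat" where
  "moment_mat w = (\<chi> a b. (\<Sum>i\<in>UNIV. \<Sum>j\<in>UNIV. w (axis i 1) (axis j 1) $ a * w (axis i 1) (axis j 1) $ b) -
     2 * (\<Sum>j\<in>UNIV. w (axis a 1) (axis j 1) \<bullet> w (axis b 1) (axis j 1)))"

lemma transpose_moment_mat: "transpose (moment_mat w) = moment_mat w"
proof -
  have "moment_mat w $ a $ b = moment_mat w $ b $ a" for a b
    unfolding moment_mat_def vec_lambda_beta
    by (intro arg_cong2 [where f = "(-)"] arg_cong2 [where f = "(*)"] sum.cong refl mult.commute inner_commute)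
  then show ?thesis
    by (simp add: transpose_def vec_eq_iff)
qed

lemma sum_swap4:
  "(\<Sum>i\<in>A. \<Sum>j\<in>B. \<Sum>a\<in>C. \<Sum>b\<in>D. f i j a b) = (\<Sum>a\<in>C. \<Sum>b\<in>D. \<Sum>i\<in>A. \<Sum>j\<in>B. f i j a b)"
proof -
  have r: "(\<Sum>i\<in>A. \<Sum>j\<in>B. \<Sum>a\<in>E. g i j a) = (\<Sum>a\<in>E. \<Sum>i\<in>A. \<Sum>j\<in>B. g i j a)" for E g
  proof -
    have "(\<Sum>i\<in>A. \<Sum>j\<in>B. \<Sum>a\<in>E. g i j a) = (\<Sum>i\<in>A. \<Sum>a\<in>E. \<Sum>j\<in>B. g i j a)"
      by (rule sum.cong [OF refl]) (rule sum.swap)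
    also have "\<dots> = (\<Sum>a\<in>E. \<Sum>i\<in>A. \<Sum>j\<in>B. g i j a)"
      by (rule sum.swap)
    finally show ?thesis .
  qed
  have "(\<Sum>i\<in>A. \<Sum>j\<in>B. \<Sum>a\<in>C. \<Sum>b\<in>D. f i j a b) = (\<Sum>a\<in>C. \<Sum>i\<in>A. \<Sum>j\<in>B. \<Sum>b\<in>D. f i j a b)"
    by (rule r)
  also have "\<dots> = (\<Sum>a\<in>C. \<Sum>b\<in>D. \<Sum>i\<in>A. \<Sum>j\<in>B. f i j a b)"
    by (rule sum.cong [OF refl]) (rule r)
  finally show ?thesis .
qed

lemma sum_swap3:
  "(\<Sum>j\<in>A. \<Sum>i\<in>B. \<Sum>a\<in>C. f i j a) = (\<Sum>a\<in>C. \<Sum>i\<in>B. \<Sum>j\<in>A. f i j a)"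
proof -
  have "(\<Sum>j\<in>A. \<Sum>i\<in>B. \<Sum>a\<in>C. f i j a) = (\<Sum>i\<in>B. \<Sum>j\<in>A. \<Sum>a\<in>C. f i j a)"
    by (rule sum.swap)
  also have "\<dots> = (\<Sum>i\<in>B. \<Sum>a\<in>C. \<Sum>j\<in>A. f i j a)"
    by (rule sum.cong [OF refl]) (rule sum.swap)
  also have "\<dots> = (\<Sum>a\<in>C. \<Sum>i\<in>B. \<Sum>j\<in>A. f i j a)"
    by (rule sum.swap)
  finally show ?thesis .
qed

lemma skew_bilinearD:
  assumes "w \<in> skew_bilinear"
  shows "bilinear w" "w X Y = - w Y X"
  using assms unfolding skew_bilinear_def by blast+

lemma matrix_vector_axis: "X *v axis i 1 = (\<Sum>a\<in>UNIV. X $ a $ i *\<^sub>R axis a (1::real))"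
proof -
  have "(X *v axis i 1) $ k = X $ k $ i" for k
    by (simp add: matrix_vector_mult_def axis_def if_distrib [of "\<lambda>c. _ * c"] cong: if_cong)
  then show ?thesis
    by (simp add: vec_eq_iff axis_def if_distrib [of "\<lambda>c. _ * c"] cong: if_cong)
qed

lemma bilinear_sum_left:
  assumes "bilinear w"
  shows "w (\<Sum>a\<in>A. f a *\<^sub>R x a) y = (\<Sum>a\<in>A. f a *\<^sub>R w (x a) y)"
proof -
  have l: "linear (\<lambda>x. w x y)"
    using assms by (simp add: bilinear_def)
  show ?thesis
    using linear_sum [OF l, of "\<lambda>a. f a *\<^sub>R x a" A] linear_scale [OF l] by simp
qed

lemma bilinear_sum_right:
  assumes "bilinear w"
  shows "w y (\<Sum>a\<in>A. f a *\<^sub>R x a) = (\<Sum>a\<in>A. f a *\<^sub>R w y (x a))"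
proof -
  have l: "linear (\<lambda>x. w y x)"
    using assms by (simp add: bilinear_def)
  show ?thesis
    using linear_sum [OF l, of "\<lambda>a. f a *\<^sub>R x a" A] linear_scale [OF l] by simp
qed

lemma bracket_der_moment:
  assumes w: "w \<in> skew_bilinear"
  shows "bracket_inner (bracket_der X w) w = moment_mat w \<bullet> X"
proof -
  define W where "W i j = w (axis i 1) (axis j 1)" for i j
  have sk: "W i j = - W j i" for i j
    unfolding W_def by (rule skew_bilinearD [OF w])
  have w1: "w (X *v axis i 1) (axis j 1) = (\<Sum>a\<in>UNIV. X $ a $ i *\<^sub>R W a j)" for i j
    unfolding matrix_vector_axis W_def by (rule bilinear_sum_left [OF skew_bilinearD(1) [OF w]])
  have w2: "w (axis i 1) (X *v axis j 1) = - (\<Sum>a\<in>UNIV. X $ a $ j *\<^sub>R W a i)" for i j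
    using skew_bilinearD(2) [OF w, of "axis i 1" "X *v axis j 1"] w1 [of j i] by simp
  let ?T = "\<Sum>j\<in>UNIV. \<Sum>i\<in>UNIV. \<Sum>a\<in>UNIV. X $ a $ i * (W a j \<bullet> W i j)"
  have W: "w (axis i 1) (axis j 1) = W i j" for i j
    by (simp add: W_def)
  have "bracket_der X w (axis i 1) (axis j 1) \<bullet> W i j = (X *v W i j) \<bullet> W i j -
      (\<Sum>a\<in>UNIV. X $ a $ i * (W a j \<bullet> W i j)) - (\<Sum>a\<in>UNIV. X $ a $ j * (W a i \<bullet> W j i))" for i j
  proof -
    have m: "(\<Sum>a\<in>UNIV. X $ a $ j *\<^sub>R W a i) \<bullet> W i j = - (\<Sum>a\<in>UNIV. X $ a $ j * (W a i \<bullet> W j i))"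
      unfolding inner_sum_left sk [of i j] by (simp add: sum_negf)
    then show ?thesis
      unfolding bracket_der_def w1 w2 W
      by (simp only: inner_diff_left inner_minus_left m) (simp add: inner_sum_left)
  qed
  then have "bracket_inner (bracket_der X w) w = (\<Sum>i\<in>UNIV. \<Sum>j\<in>UNIV.
      (X *v W i j) \<bullet> W i j - (\<Sum>a\<in>UNIV. X $ a $ i * (W a j \<bullet> W i j)) - (\<Sum>a\<in>UNIV. X $ a $ j * (W a i \<bullet> W j i)))"
    unfolding bracket_inner_alt W by simp
  also have "\<dots> = (\<Sum>i\<in>UNIV. \<Sum>j\<in>UNIV. (X *v W i j) \<bullet> W i j) -
      (\<Sum>i\<in>UNIV. \<Sum>j\<in>UNIV. \<Sum>a\<in>UNIV. X $ a $ i * (W a j \<bullet> W i j)) -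
      (\<Sum>i\<in>UNIV. \<Sum>j\<in>UNIV. \<Sum>a\<in>UNIV. X $ a $ j * (W a i \<bullet> W j i))"
    by (simp add: sum_subtractf)
  also have "(\<Sum>i\<in>UNIV. \<Sum>j\<in>UNIV. \<Sum>a\<in>UNIV. X $ a $ i * (W a j \<bullet> W i j)) = ?T"
    by (rule sum.swap)
  also have "(\<Sum>i\<in>UNIV. \<Sum>j\<in>UNIV. (X *v W i j) \<bullet> W i j) =
      (\<Sum>i\<in>UNIV. \<Sum>j\<in>UNIV. \<Sum>a\<in>UNIV. \<Sum>b\<in>UNIV. X $ a $ b * (W i j $ a * W i j $ b))"
    by (simp add: inner_vec_def matrix_vector_mult_def sum_distrib_right sum_distrib_left mult_ac)
  also have "\<dots> = (\<Sum>a\<in>UNIV. \<Sum>b\<in>UNIV. X $ a $ b * (\<Sum>i\<in>UNIV. \<Sum>j\<in>UNIV. W i j $ a * W i j $ b))"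
    by (subst sum_swap4) (simp add: sum_distrib_left)
  also have "?T = (\<Sum>a\<in>UNIV. \<Sum>b\<in>UNIV. X $ a $ b * (\<Sum>j\<in>UNIV. W a j \<bullet> W b j))"
    by (subst sum_swap3) (simp add: sum_distrib_left)
  finally have eq: "bracket_inner (bracket_der X w) w =
      (\<Sum>a\<in>UNIV. \<Sum>b\<in>UNIV. X $ a $ b * (\<Sum>i\<in>UNIV. \<Sum>j\<in>UNIV. W i j $ a * W i j $ b)) -
      2 * (\<Sum>a\<in>UNIV. \<Sum>b\<in>UNIV. X $ a $ b * (\<Sum>j\<in>UNIV. W a j \<bullet> W b j))"
    by simp
  have "moment_mat w $ a $ b * X $ a $ b = X $ a $ b * (\<Sum>i\<in>UNIV. \<Sum>j\<in>UNIV. W i j $ a * W i j $ b) -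
      2 * (X $ a $ b * (\<Sum>j\<in>UNIV. W a j \<bullet> W b j))" for a b
    by (simp add: moment_mat_def W algebra_simps)
  then show ?thesis
    unfolding eq inner_vec_def [of "moment_mat w"] inner_vec_def [of "moment_mat w $ a" for a] inner_real_def
    by (simp only: sum_subtractf sum_distrib_left)
qed

subsection \<open>The action of the linear group\<close>

lemma matrix_inv_unique:
  fixes g h :: "'n::finite mat"
  assumes "g ** h = mat 1"
  shows "matrix_inv g = h" "invertible g"
proof -
  have hg: "h ** g = mat 1"
    using assms by (simp add: matrix_left_right_inverse)
  then show "invertible g"
    using assms by (auto simp: invertible_def)
  then show "matrix_inv g = h"
    using matrix_inv_both [of g] assms hg by (metis matrix_mul_assoc matrix_mul_lid matrix_mul_rid)
qed

lemma bracket_act_eq: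
  assumes "g ** h = mat 1"
  shows "bracket_act g w = (\<lambda>X Y. g *v w (h *v X) (h *v Y))"
  by (simp add: bracket_act_def matrix_inv_unique [OF assms])

lemma bracket_act_mult:
  assumes "g ** h = mat 1" "g' ** h' = mat 1"
  shows "bracket_act (g ** g') w = bracket_act g (bracket_act g' w)"
proof -
  have "(g ** g') ** (h' ** h) = mat 1"
    using assms by (metis matrix_mul_assoc matrix_mul_rid)
  then show ?thesis
    by (simp add: bracket_act_eq [OF assms(1)] bracket_act_eq [OF assms(2)] bracket_act_eq
        matrix_vector_mul_assoc)
qed

lemma bracket_act_one [simp]: "bracket_act (mat 1) w = w"
  using bracket_act_eq [of "mat 1" "mat 1" w] by simp

lemma linear_comp_matrix:
  fixes f :: "real^'n::finite \<Rightarrow> 'b::real_vector" and A :: "real^'m::finite^'n"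
  assumes "linear f"
  shows "linear (\<lambda>x. f (A *v x))"
  using linear_compose [OF matrix_vector_mul_linear assms] by (simp add: o_def)

lemma bracket_act_skew:
  assumes "g ** h = mat 1" "w \<in> skew_bilinear"
  shows "bracket_act g w \<in> skew_bilinear"
proof -
  have "linear (\<lambda>y. g *v w x (h *v y))" "linear (\<lambda>x. g *v w (h *v x) y)" for x y
  proof -
    have "linear (w x)" "linear (\<lambda>x. w x y)" for x y
      using skew_bilinearD(1) [OF assms(2)] by (auto simp: bilinear_def)
    then have "linear (\<lambda>y. w x (h *v y))" "linear (\<lambda>x. w (h *v x) y)"
      using linear_comp_matrix [of "w x" h] linear_comp_matrix [of "\<lambda>x. w x y" h] by auto
    then show "linear (\<lambda>y. g *v w x (h *v y))" "linear (\<lambda>x. g *v w (h *v x) y)"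
      using linear_compose [OF _ matrix_vector_mul_linear, of _ g] by (auto simp: o_def)
  qed
  moreover have "g *v w (h *v X) (h *v Y) = - (g *v w (h *v Y) (h *v X))" for X Y
    using skew_bilinearD(2) [OF assms(2), of "h *v X" "h *v Y"]
    by (metis linear_neg matrix_vector_mul_linear)
  ultimately show ?thesis
    unfolding skew_bilinear_def bracket_act_eq [OF assms(1)] bilinear_def by blast
qed

lemma bracket_act_zero: "bracket_act g (\<lambda>X Y. 0) = (\<lambda>X Y. 0)"
  by (simp add: bracket_act_def)

lemma bracket_act_nonzero:
  assumes "g ** h = mat 1" "w \<noteq> (\<lambda>X Y. 0)"
  shows "bracket_act g w \<noteq> (\<lambda>X Y. 0)"
proof
  assume "bracket_act g w = (\<lambda>X Y. 0)"
  then have "bracket_act (h ** g) w = (\<lambda>X Y. 0)"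
    using bracket_act_mult [of h g g h w] assms(1) by (simp add: bracket_act_zero matrix_left_right_inverse)
  moreover have "h ** g = mat 1"
    using assms(1) by (simp add: matrix_left_right_inverse)
  ultimately show False
    using assms(2) by simp
qed

lemma skew_bilinear_eqI:
  assumes "bilinear v" "bilinear w" "\<And>i j. v (axis i 1) (axis j 1) = w (axis i 1) (axis j (1::real))"
  shows "v = (w :: 'n::finite bracket)"
  using assms(1,2)
proof (rule bilinear_eq_stdbasis)
  fix x y :: "real^'n" assume "x \<in> Basis" "y \<in> Basis"
  then show "v x y = w x y"
    using assms(3) by (auto simp: Basis_vec_def)
qed

lemma bilinear_zero: "bilinear (\<lambda>X Y. 0)"
  by (simp add: bilinear_def linear_zero)

lemma bracket_inner_pos:
  assumes "w \<in> skew_bilinear" "w \<noteq> (\<lambda>X Y. 0)"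
  shows "bracket_inner w w > 0"
proof -
  have "\<exists>i j. w (axis i 1) (axis j 1) \<noteq> 0"
    using assms skew_bilinear_eqI [OF skew_bilinearD(1) bilinear_zero] by blast
  then obtain i j where "w (axis i 1) (axis j 1) \<noteq> 0" by blast
  then show ?thesis
    unfolding bracket_inner_alt
    by (intro sum_pos2 [of UNIV i] sum_pos2 [of UNIV j] sum_nonneg) auto
qed

lemma sum_inner_rotate:
  fixes f g :: "real^'n::finite \<Rightarrow> real^'m::finite"
  assumes "linear f" "linear g" and k: "orthogonal_matrix k"
  shows "(\<Sum>i\<in>UNIV. f (transpose k *v axis i 1) \<bullet> g (transpose k *v axis i 1)) =
    (\<Sum>i\<in>UNIV. f (axis i 1) \<bullet> g (axis i 1))"
proof -
  have kk: "(\<Sum>i\<in>UNIV. k $ i $ a * k $ i $ b) = (if a = b then 1 else 0)" for a b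
    using orthogonal_transpose_mult(1) [OF k]
    by (simp add: vec_eq_iff matrix_matrix_mult_def transpose_def mat_def)
  have e: "h (transpose k *v axis i 1) = (\<Sum>a\<in>UNIV. k $ i $ a *\<^sub>R h (axis a 1))"
    if "linear h" for h :: "real^'n \<Rightarrow> real^'m" and i
    unfolding matrix_vector_axis using that by (simp add: linear_sum linear_scale transpose_def)
  have "(\<Sum>i\<in>UNIV. f (transpose k *v axis i 1) \<bullet> g (transpose k *v axis i 1)) =
      (\<Sum>i\<in>UNIV. \<Sum>a\<in>UNIV. \<Sum>b\<in>UNIV. (k $ i $ a * k $ i $ b) * (f (axis b 1) \<bullet> g (axis a 1)))"
    unfolding e [OF assms(1)] e [OF assms(2)]
    by (simp add: inner_sum_left inner_sum_right sum_distrib_left mult_ac)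
  also have "\<dots> = (\<Sum>b\<in>UNIV. \<Sum>a\<in>UNIV. \<Sum>i\<in>UNIV. (k $ i $ a * k $ i $ b) * (f (axis b 1) \<bullet> g (axis a 1)))"
    by (subst sum_swap3) (rule sum.cong [OF refl], rule sum.cong [OF refl], rule refl)
  also have "\<dots> = (\<Sum>b\<in>UNIV. \<Sum>a\<in>UNIV. (if a = b then 1 else 0) * (f (axis b 1) \<bullet> g (axis a 1)))"
    by (simp add: kk flip: sum_distrib_right)
  also have "\<dots> = (\<Sum>a\<in>UNIV. f (axis a 1) \<bullet> g (axis a 1))"
    by (simp add: if_distrib [of "\<lambda>c. c * _"] cong: if_cong)
  finally show ?thesis .
qed

lemma bracket_inner_orthogonal:
  fixes v w :: "'n::finite bracket"
  assumes k: "orthogonal_matrix k" and v: "bilinear v" and w: "bilinear w"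
  shows "bracket_inner (bracket_act k v) (bracket_act k w) = bracket_inner v w"
proof -
  note kk = orthogonal_transpose_mult [OF k]
  have iso: "(k *v x) \<bullet> (k *v y) = x \<bullet> y" for x y
    using kk by (metis dot_lmul_matrix matrix_vector_mul_assoc matrix_vector_mul_lid transpose_matrix_vector transpose_transpose)
  have lv: "linear (v x)" "linear (\<lambda>x. v x y)" and lw: "linear (w x)" "linear (\<lambda>x. w x y)" for x y
    using v w by (auto simp: bilinear_def)
  have "bracket_inner (bracket_act k v) (bracket_act k w) = (\<Sum>i\<in>UNIV. \<Sum>j\<in>UNIV.
      v (transpose k *v axis i 1) (transpose k *v axis j 1) \<bullet> w (transpose k *v axis i 1) (transpose k *v axis j 1))"
    unfolding bracket_inner_alt bracket_act_eq [OF kk(2)] by (simp add: iso del: transpose_matrix_vector)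
  also have "\<dots> = (\<Sum>i\<in>UNIV. \<Sum>j\<in>UNIV. v (transpose k *v axis i 1) (axis j 1) \<bullet> w (transpose k *v axis i 1) (axis j 1))"
    by (intro sum.cong refl sum_inner_rotate lv lw k)
  also have "\<dots> = (\<Sum>j\<in>UNIV. \<Sum>i\<in>UNIV. v (transpose k *v axis i 1) (axis j 1) \<bullet> w (transpose k *v axis i 1) (axis j 1))"
    by (rule sum.swap)
  also have "\<dots> = (\<Sum>j\<in>UNIV. \<Sum>i\<in>UNIV. v (axis i 1) (axis j 1) \<bullet> w (axis i 1) (axis j 1))"
    by (intro sum.cong refl sum_inner_rotate lv lw k)
  also have "\<dots> = bracket_inner v w"
    unfolding bracket_inner_alt by (rule sum.swap)
  finally show ?thesis .
qed

lemma bracket_der_act: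
  assumes "g ** h = mat 1"
  shows "bracket_der (g ** X ** h) (bracket_act g w) = bracket_act g (bracket_der X w)"
proof -
  have hg: "h ** g = mat 1"
    using assms by (simp add: matrix_left_right_inverse)
  have "(g ** X ** h) *v (g *v v) = g *v (X *v v)" "h *v ((g ** X ** h) *v v) = X *v (h *v v)" for v
    using hg by (metis matrix_mul_assoc matrix_mul_rid matrix_vector_mul_assoc,
      metis matrix_mul_assoc matrix_mul_lid matrix_vector_mul_assoc)
  then show ?thesis
    by (simp add: bracket_der_def bracket_act_eq [OF assms] matrix_vector_mult_diff_distrib)
qed

lemma bracket_der_bilinear:
  assumes "bilinear w"
  shows "bilinear (bracket_der X w)"
proof -
  have "linear (w x)" "linear (\<lambda>x. w x y)" for x y
    using assms by (auto simp: bilinear_def)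
  then show ?thesis
    unfolding bilinear_def bracket_der_def
    by (auto intro!: linear_compose_sub linear_comp_matrix
        linear_compose [OF _ matrix_vector_mul_linear, unfolded o_def])
qed

lemma moment_mat_orthogonal:
  assumes k: "orthogonal_matrix k" and w: "w \<in> skew_bilinear"
  shows "moment_mat (bracket_act k w) \<bullet> (k ** X ** transpose k) = moment_mat w \<bullet> X"
proof -
  note kk = orthogonal_transpose_mult [OF k]
  have "moment_mat (bracket_act k w) \<bullet> (k ** X ** transpose k) =
      bracket_inner (bracket_der (k ** X ** transpose k) (bracket_act k w)) (bracket_act k w)"
    by (rule bracket_der_moment [OF bracket_act_skew [OF kk(2) w], symmetric])
  also have "\<dots> = bracket_inner (bracket_act k (bracket_der X w)) (bracket_act k w)"
    by (simp add: bracket_der_act [OF kk(2)])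
  also have "\<dots> = bracket_inner (bracket_der X w) w"
    by (intro bracket_inner_orthogonal k bracket_der_bilinear skew_bilinearD(1) [OF w])
  finally show ?thesis
    by (simp add: bracket_der_moment [OF w])
qed

subsection \<open>Weights under the action of triangular matrices\<close>

lemma bracket_der_diag:
  assumes "bilinear w"
  shows "bracket_der (diag_mat z) w (axis i 1) (axis j 1) $ k = (z k - z i - z j) * w (axis i 1) (axis j 1) $ k"
proof -
  have "diag_mat z *v axis i 1 = z i *\<^sub>R axis i 1" for i
    by (simp add: vec_eq_iff axis_def)
  then show ?thesis
    by (simp add: bracket_der_def bilinear_lmul [OF assms] bilinear_rmul [OF assms] algebra_simps)
qed

lemma moment_mat_diag:
  assumes "w \<in> skew_bilinear"
  shows "moment_mat w \<bullet> diag_mat z =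
    (\<Sum>i\<in>UNIV. \<Sum>j\<in>UNIV. \<Sum>k\<in>UNIV. (z k - z i - z j) * (w (axis i 1) (axis j 1) $ k)\<^sup>2)"
  unfolding bracket_der_moment [OF assms, symmetric] bracket_inner_def
  by (simp add: inner_axis bracket_der_diag [OF skew_bilinearD(1) [OF assms]] power2_eq_square mult.assoc)

lemma bracket_act_coord_nonzero:
  assumes qr: "q ** r = mat 1" and w: "bilinear w"
    and nz: "bracket_act q w (axis i 1) (axis j 1) $ k \<noteq> 0"
  shows "\<exists>a b c. q $ k $ c \<noteq> 0 \<and> r $ a $ i \<noteq> 0 \<and> r $ b $ j \<noteq> 0 \<and> w (axis a 1) (axis b 1) $ c \<noteq> 0"
proof (rule ccontr)
  assume *: "\<not> ?thesis"
  have "bracket_act q w (axis i 1) (axis j 1) $ k =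
      (\<Sum>c\<in>UNIV. \<Sum>b\<in>UNIV. \<Sum>a\<in>UNIV. q $ k $ c * (r $ b $ j * (r $ a $ i * w (axis a 1) (axis b 1) $ c)))"
    unfolding bracket_act_eq [OF qr] matrix_vector_axis [of r]
    by (simp add: bilinear_sum_left [OF w] bilinear_sum_right [OF w] matrix_vector_mult_def sum_distrib_left)
  also have "\<dots> = 0"
    using * by (intro sum.neutral ballI) auto
  finally show False
    using nz by simp
qed

text \<open>A coordinate of \<open>w\<close> only contributes to coordinates of \<open>q \<cdot> w\<close> of the same or larger \<open>z\<close>-weight.\<close>

lemma bracket_act_weights_ge:
  assumes qr: "q ** r = mat 1" and w: "bilinear w"
    and tri: "\<And>i j. q $ i $ j \<noteq> 0 \<Longrightarrow> z j \<le> (z i :: real)" "\<And>i j. r $ i $ j \<noteq> 0 \<Longrightarrow> z j \<le> z i"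
    and weight: "\<And>a b c. w (axis a 1) (axis b 1) $ c \<noteq> 0 \<Longrightarrow> l \<le> z c - z a - z b"
    and nz: "bracket_act q w (axis i 1) (axis j 1) $ k \<noteq> 0"
  shows "l \<le> z k - z i - z j"
proof -
  obtain a b c where "q $ k $ c \<noteq> 0" "r $ a $ i \<noteq> 0" "r $ b $ j \<noteq> 0" "w (axis a 1) (axis b 1) $ c \<noteq> 0"
    using bracket_act_coord_nonzero [OF qr w nz] by blast
  then show ?thesis
    using tri(1) [of k c] tri(2) [of a i] tri(2) [of b j] weight [of a b c] by linarith
qed

lemma bracket_inner_coords:
  "bracket_inner w w = (\<Sum>i\<in>UNIV. \<Sum>j\<in>UNIV. \<Sum>k\<in>UNIV. (w (axis i 1) (axis j 1) $ k)\<^sup>2)"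
  unfolding bracket_inner_def by (simp add: inner_axis power2_eq_square)

text \<open>The pairing is the sum of the squared coordinates of \<open>w\<close>, each multiplied by its \<open>z\<close>-weight.\<close>

lemma moment_mat_weights_ge:
  assumes w: "w \<in> skew_bilinear"
    and weight: "\<And>i j k. w (axis i 1) (axis j 1) $ k \<noteq> 0 \<Longrightarrow> l \<le> z k - z i - z j"
  shows "l * bracket_inner w w \<le> moment_mat w \<bullet> diag_mat z"
    and "moment_mat w \<bullet> diag_mat z = l * bracket_inner w w \<Longrightarrow>
      w (axis i 1) (axis j 1) $ k \<noteq> 0 \<Longrightarrow> z k - z i - z j = l"
proof -
  define f where "f i j k = (z k - z i - z j - l) * (w (axis i 1) (axis j 1) $ k)\<^sup>2" for i j k
  have f0: "0 \<le> f i j k" for i j k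
    using weight [of i j k] by (cases "w (axis i 1) (axis j 1) $ k = 0") (auto simp: f_def)
  have eq: "moment_mat w \<bullet> diag_mat z - l * bracket_inner w w = (\<Sum>i\<in>UNIV. \<Sum>j\<in>UNIV. \<Sum>k\<in>UNIV. f i j k)"
    unfolding moment_mat_diag [OF w] bracket_inner_coords f_def
    by (simp add: sum_distrib_left left_diff_distrib sum_subtractf)
  have "0 \<le> (\<Sum>i\<in>UNIV. \<Sum>j\<in>UNIV. \<Sum>k\<in>UNIV. f i j k)"
    by (intro sum_nonneg f0)
  then show "l * bracket_inner w w \<le> moment_mat w \<bullet> diag_mat z"
    using eq by linarith
  assume "moment_mat w \<bullet> diag_mat z = l * bracket_inner w w" and nz: "w (axis i 1) (axis j 1) $ k \<noteq> 0"
  then have "(\<Sum>i\<in>UNIV. \<Sum>j\<in>UNIV. \<Sum>k\<in>UNIV. f i j k) = 0"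
    using eq by simp
  then have "f i j k = 0"
    using f0 by (simp add: sum_nonneg_eq_0_iff sum_nonneg)
  then show "z k - z i - z j = l"
    using nz by (simp add: f_def)
qed

lemma bracket_der_eigen:
  assumes w: "bilinear w" and "\<And>i j k. w (axis i 1) (axis j 1) $ k \<noteq> 0 \<Longrightarrow> z k - z i - z j = l"
  shows "bracket_der (diag_mat z) w = (\<lambda>X Y. l *\<^sub>R w X Y)"
proof (rule skew_bilinear_eqI)
  show "bilinear (bracket_der (diag_mat z) w)"
    using w by (rule bracket_der_bilinear)
  show "bilinear (\<lambda>X Y. l *\<^sub>R w X Y)"
    using w by (auto simp: bilinear_def intro: linear_compose_scale_right)
  fix i j
  show "bracket_der (diag_mat z) w (axis i 1) (axis j 1) = l *\<^sub>R w (axis i 1) (axis j 1)"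
    unfolding vec_eq_iff bracket_der_diag [OF w] using assms(2) by auto
qed

section \<open>Orthogonal projections and the moment map\<close>

lemma orth_proj_unique:
  assumes S: "subspace S" and P: "P \<in> S" "\<And>Y. Y \<in> S \<Longrightarrow> (X - P) \<bullet> Y = 0"
  shows "orth_proj (\<bullet>) S X = P"
  unfolding orth_proj_def
proof (rule the_equality)
  show "P \<in> S \<and> (\<forall>Y\<in>S. (X - P) \<bullet> Y = 0)"
    using P by blast
  fix P' assume P': "P' \<in> S \<and> (\<forall>Y\<in>S. (X - P') \<bullet> Y = 0)"
  have "P - P' \<in> S"
    using P P' S by (auto intro: subspace_diff)
  then have "(X - P') \<bullet> (P - P') - (X - P) \<bullet> (P - P') = 0"
    using P P' by simp
  then have "(P - P') \<bullet> (P - P') = 0"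
    by (simp flip: inner_diff_left)
  then show "P' = P" by simp
qed

lemma orth_proj_props:
  assumes S: "subspace S"
  shows "orth_proj (\<bullet>) S X \<in> S" "Y \<in> S \<Longrightarrow> orth_proj (\<bullet>) S X \<bullet> Y = X \<bullet> Y"
proof -
  obtain P Q where PQ: "P \<in> span S" "\<And>w. w \<in> span S \<Longrightarrow> orthogonal Q w" "X = P + Q"
    using orthogonal_subspace_decomp_exists [of S X] by metis
  then have "P \<in> S" "\<And>Y. Y \<in> S \<Longrightarrow> (X - P) \<bullet> Y = 0"
    using S by (auto simp: span_eq_iff [THEN iffD2] orthogonal_def)
  moreover from this have "orth_proj (\<bullet>) S X = P"
    by (intro orth_proj_unique S)
  ultimately show "orth_proj (\<bullet>) S X \<in> S" "Y \<in> S \<Longrightarrow> orth_proj (\<bullet>) S X \<bullet> Y = X \<bullet> Y"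
    by (auto simp: inner_diff_left)
qed

text \<open>The projection to the whole Lie algebra, which is what the Ricci operator calls for; it agrees
  with the moment map by \<open>gl_moment_eq_moment_map\<close>.\<close>

definition gl_moment :: "'n::finite tensor set \<Rightarrow> 'n bracket \<Rightarrow> 'n mat" where
  "gl_moment \<gamma> w = orth_proj (\<bullet>) (gl_gamma \<gamma>) (moment_mat w /\<^sub>R bracket_inner w w)"

lemma gl_moment_props:
  assumes "\<forall>T\<in>\<gamma>. is_tensor T"
  shows "gl_moment \<gamma> w \<in> gl_gamma \<gamma>"
    "Y \<in> gl_gamma \<gamma> \<Longrightarrow> gl_moment \<gamma> w \<bullet> Y = (moment_mat w \<bullet> Y) / bracket_inner w w"
  using orth_proj_props [OF subspace_gl_gamma [OF assms]]
  by (auto simp: gl_moment_def divide_inverse mult.commute)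

lemma inner_transpose: "transpose X \<bullet> transpose Y = X \<bullet> (Y :: 'n::finite mat)"
  unfolding inner_vec_def transpose_def by (simp add: sum.swap [of "\<lambda>i j. X $ j $ i * Y $ j $ i"])

text \<open>Since the Lie algebra is closed under transposition and the moment matrix is symmetric, its
  projection is symmetric as well, so projecting onto \<open>gl_gamma \<gamma>\<close> or \<open>p_gamma \<gamma>\<close> is the same.\<close>

lemma gl_moment_eq_moment_map:
  assumes \<gamma>: "\<forall>T\<in>\<gamma>. is_tensor T" and sa: "self_adjoint_group (stabilizer \<gamma>)"
    and w: "w \<in> skew_bilinear"
  shows "moment_map \<gamma> w = gl_moment \<gamma> w"
proof -
  let ?P = "gl_moment \<gamma> w" and ?M = "moment_mat w /\<^sub>R bracket_inner w w"
  have tM: "transpose ?M = ?M"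
    by (simp add: transpose_scalar transpose_moment_mat)
  have "?M \<bullet> Y = transpose ?P \<bullet> Y" if "Y \<in> gl_gamma \<gamma>" for Y
  proof -
    have "transpose ?P \<bullet> Y = ?P \<bullet> transpose Y"
      using inner_transpose [of ?P "transpose Y"] by simp
    also have "\<dots> = ?M \<bullet> transpose Y"
      using gl_moment_props(2) [OF \<gamma> gl_gamma_transpose [OF sa that]] by (simp add: divide_inverse mult.commute)
    also have "\<dots> = ?M \<bullet> Y"
      using inner_transpose [of ?M Y] tM by simp
    finally show ?thesis by simp
  qed
  then have "?P = transpose ?P"
    unfolding gl_moment_def [of \<gamma> w]
    using gl_gamma_transpose [OF sa gl_moment_props(1) [OF \<gamma>], of w]
    by (intro orth_proj_unique subspace_gl_gamma \<gamma>) (auto simp: inner_diff_left gl_moment_def)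
  then have Pp: "?P \<in> p_gamma \<gamma>"
    using gl_moment_props(1) [OF \<gamma>] by (auto simp: p_gamma_def symmetric_matrices_def)
  have sub: "subspace (p_gamma \<gamma>)"
  proof -
    have "subspace (symmetric_matrices :: 'a mat set)"
      by (auto simp: subspace_def symmetric_matrices_def transpose_def vec_eq_iff)
    then show ?thesis
      unfolding p_gamma_def by (intro subspace_inter subspace_gl_gamma \<gamma>)
  qed
  have PX: "?P \<bullet> X = bracket_inner (bracket_der X w) w / bracket_inner w w" if "X \<in> p_gamma \<gamma>" for X
    using gl_moment_props(2) [OF \<gamma>, of X w] that by (simp add: bracket_der_moment [OF w] p_gamma_def)
  show ?thesis
    unfolding moment_map_def mat_inner_eq_inner
  proof (rule the_equality)
    show "?P \<in> p_gamma \<gamma> \<and> (\<forall>X\<in>p_gamma \<gamma>. ?P \<bullet> X = bracket_inner (bracket_der X w) w / bracket_inner w w)"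
      using Pp PX by blast
    fix M assume M: "M \<in> p_gamma \<gamma> \<and>
      (\<forall>X\<in>p_gamma \<gamma>. M \<bullet> X = bracket_inner (bracket_der X w) w / bracket_inner w w)"
    then have "M - ?P \<in> p_gamma \<gamma>"
      using Pp sub by (auto intro: subspace_diff)
    then have "(M - ?P) \<bullet> (M - ?P) = 0"
      using M PX by (simp add: inner_diff_left)
    then show "M = ?P" by simp
  qed
qed

section \<open>Traces of nilpotent maps\<close>

text \<open>The trace can be computed in an orthonormal basis of any member of the flag.  To pass to the next
  member, expand \<open>f b\<close>, which lies in the smaller space, in a basis of that space, and then the elements of
  this basis in the larger one.  The last space has an empty basis.\<close>

lemma flag_trace_zero:
  fixes f :: "real^'n::finite \<Rightarrow> real^'n"
  assumes f: "linear f" and V: "\<And>k::nat. subspace (V k)" "V 0 = UNIV" "V N = {0}"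
    and dec: "\<And>k. V (Suc k) \<subseteq> V k" and fV: "\<And>k x. x \<in> V k \<Longrightarrow> f x \<in> V (Suc k)"
  shows "(\<Sum>i\<in>UNIV. f (axis i 1) \<bullet> axis i 1) = 0"
proof -
  let ?t = "\<Sum>i\<in>UNIV. f (axis i 1) \<bullet> axis i 1"
  have "\<exists>B. finite B \<and> pairwise orthogonal B \<and> (\<forall>b\<in>B. norm b = 1) \<and> span B = V k \<and>
      (\<Sum>b\<in>B. f b \<bullet> b) = ?t" for k
  proof (induction k)
    case 0
    have "(\<Sum>b\<in>range (\<lambda>i. axis i 1 :: real^'n). f b \<bullet> b) = ?t"
      by (subst sum.reindex) (auto simp: inj_def axis_eq_axis)
    moreover have "range (\<lambda>i. axis i 1 :: real^'n) = Basis"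
      by (auto simp: Basis_vec_def)
    ultimately show ?case
      using V(2) by (intro exI [of _ Basis]) (auto simp: pairwise_def orthogonal_def inner_Basis)
  next
    case (Suc k)
    then obtain B where B: "finite B" "pairwise orthogonal B" "\<And>b. b \<in> B \<Longrightarrow> norm b = 1" "span B = V k"
      "(\<Sum>b\<in>B. f b \<bullet> b) = ?t" by blast
    obtain B' where B': "pairwise orthogonal B'" "\<And>b. b \<in> B' \<Longrightarrow> norm b = 1" "independent B'" "span B' = V (Suc k)"
      using orthonormal_basis_subspace [OF V(1) [of "Suc k"]] by metis
    have fin: "finite B'"
      using B'(3) independent_imp_finite by blast
    have "f b \<bullet> b = (\<Sum>c\<in>B'. (f b \<bullet> c) * (b \<bullet> c))" if "b \<in> B" for b
    proof -
      have "f b \<in> span B'"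
        using fV [of b k] that B(4) B'(4) span_base by blast
      then have "f b = (\<Sum>c\<in>B'. (f b \<bullet> c) *\<^sub>R c)"
        using orthonormal_basis_expand [OF B'(1,2) _ fin] by metis
      then have "f b \<bullet> b = (\<Sum>c\<in>B'. (f b \<bullet> c) *\<^sub>R c) \<bullet> b"
        by simp
      then show ?thesis
        unfolding inner_sum_left by (simp add: inner_commute [of b])
    qed
    then have "?t = (\<Sum>b\<in>B. \<Sum>c\<in>B'. (f b \<bullet> c) * (b \<bullet> c))"
      using B(5) by simp
    also have "\<dots> = (\<Sum>c\<in>B'. \<Sum>b\<in>B. (f b \<bullet> c) * (b \<bullet> c))"
      by (rule sum.swap)
    also have "\<dots> = (\<Sum>c\<in>B'. f c \<bullet> c)"
    proof (rule sum.cong [OF refl])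
      fix c assume "c \<in> B'"
      then have "c \<in> span B"
        using dec [of k] B(4) B'(4) span_base by blast
      then have "c = (\<Sum>b\<in>B. (c \<bullet> b) *\<^sub>R b)"
        using orthonormal_basis_expand [OF B(2,3) _ B(1)] by metis
      then have "f c = (\<Sum>b\<in>B. (c \<bullet> b) *\<^sub>R f b)"
        using linear_sum [OF f, of "\<lambda>b. (c \<bullet> b) *\<^sub>R b" B] linear_scale [OF f] by simp
      then show "(\<Sum>b\<in>B. (f b \<bullet> c) * (b \<bullet> c)) = f c \<bullet> c"
        by (simp add: inner_sum_left inner_commute [of c] mult.commute)
    qed
    finally show ?case
      using B' fin by (intro exI [of _ B']) auto
  qed
  from this [of N] obtain B where B: "\<forall>b\<in>B. norm b = 1" "span B = {0}" "(\<Sum>b\<in>B. f b \<bullet> b) = ?t"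
    unfolding V(3) by blast
  have "B = {}"
  proof (rule ccontr)
    assume "B \<noteq> {}"
    then obtain b where b: "b \<in> B" by blast
    then have "b \<in> span B"
      by (rule span_base)
    then show False
      using b B(1,2) by auto
  qed
  then show ?thesis
    using B(3) by simp
qed

lemma lower_central_dec: "lower_central \<mu> (Suc k) \<subseteq> lower_central \<mu> k"
proof (induction k)
  case (Suc k)
  then show ?case
    unfolding lower_central.simps(2) [of \<mu> "Suc k"] lower_central.simps(2) [of \<mu> k]
    by (intro span_mono) auto
qed simp

lemma subspace_lower_central: "subspace (lower_central \<mu> k)"
  by (cases k) auto

lemma nilpotent_traces:
  fixes \<mu> :: "'n::finite bracket"
  assumes \<mu>: "nilpotent_lie_bracket \<mu>" and gh: "g ** h = mat 1"
  shows "(\<Sum>i\<in>UNIV. bracket_act g \<mu> X (axis i 1) \<bullet> axis i 1) = 0"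
    and "(\<Sum>i\<in>UNIV. bracket_act g \<mu> X (bracket_act g \<mu> Y (axis i 1)) \<bullet> axis i 1) = 0"
proof -
  have hg: "h ** g = mat 1"
    using gh by (simp add: matrix_left_right_inverse)
  have sk: "\<mu> \<in> skew_bilinear"
    using \<mu> by (simp add: nilpotent_lie_bracket_def lie_bracket_def)
  obtain N where N: "lower_central \<mu> N = {0}"
    using \<mu> by (auto simp: nilpotent_lie_bracket_def)
  define V where "V k = (*v) g ` lower_central \<mu> k" for k
  have V0: "V 0 = UNIV"
  proof -
    have "x = g *v (h *v x)" for x
      by (simp add: matrix_vector_mul_assoc gh)
    then show ?thesis
      unfolding V_def by auto
  qed
  have sub: "subspace (V k)" for k
    unfolding V_def by (intro linear_subspace_image matrix_vector_mul_linear subspace_lower_central)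
  have dec: "V (Suc k) \<subseteq> V k" for k
    unfolding V_def by (intro image_mono lower_central_dec)
  have VN: "V N = {0}"
    by (simp add: V_def N)
  have stepV: "bracket_act g \<mu> X y \<in> V (Suc k)" if y: "y \<in> V k" for X y k
  proof -
    obtain x where x: "x \<in> lower_central \<mu> k" "y = g *v x"
      using y by (auto simp: V_def)
    have "bracket_act g \<mu> X y = g *v \<mu> (h *v X) x"
      by (simp add: bracket_act_eq [OF gh] x matrix_vector_mul_assoc hg)
    moreover have "\<mu> (h *v X) x \<in> lower_central \<mu> (Suc k)"
      using x by (auto intro: span_base)
    ultimately show ?thesis
      by (auto simp: V_def)
  qed
  have lin: "linear (bracket_act g \<mu> X)" for X
    using skew_bilinearD(1) [OF bracket_act_skew [OF gh sk]] by (simp add: bilinear_def)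
  show "(\<Sum>i\<in>UNIV. bracket_act g \<mu> X (axis i 1) \<bullet> axis i 1) = 0"
    by (rule flag_trace_zero [OF lin sub V0 VN dec stepV])
  have "linear (\<lambda>x. bracket_act g \<mu> X (bracket_act g \<mu> Y x))"
    using linear_compose [OF lin lin] by (simp add: o_def)
  then show "(\<Sum>i\<in>UNIV. bracket_act g \<mu> X (bracket_act g \<mu> Y (axis i 1)) \<bullet> axis i 1) = 0"
    using stepV dec by (intro flag_trace_zero [where V = V and N = N] sub V0 VN) blast+
qed

section \<open>Ricci curvature of nilpotent brackets\<close>

text \<open>The Koszul formula solved for the canonical inner product.\<close>

definition koszul :: "'n::finite bracket \<Rightarrow> 'n bracket" where
  "koszul w X Y = (\<chi> k. (w X Y \<bullet> axis k 1 - w Y (axis k 1) \<bullet> X + w (axis k 1) X \<bullet> Y) / 2)"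

lemma koszul_inner:
  assumes "bilinear w"
  shows "2 * (koszul w X Y \<bullet> Z) = w X Y \<bullet> Z - w Y Z \<bullet> X + w Z X \<bullet> Y"
proof -
  have Z: "Z = (\<Sum>k\<in>UNIV. Z $ k *\<^sub>R axis k 1)"
    using basis_expansion [of Z] by (simp add: scalar_mult_eq_scaleR)
  have a: "w X Y \<bullet> Z = (\<Sum>k\<in>UNIV. Z $ k * (w X Y \<bullet> axis k 1))"
    by (subst Z) (simp add: inner_sum_right)
  have b: "w Y Z \<bullet> X = (\<Sum>k\<in>UNIV. Z $ k * (w Y (axis k 1) \<bullet> X))"
    by (subst Z) (simp add: bilinear_sum_right [OF assms] inner_sum_left)
  have c: "w Z X \<bullet> Y = (\<Sum>k\<in>UNIV. Z $ k * (w (axis k 1) X \<bullet> Y))"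
    by (subst Z) (simp add: bilinear_sum_left [OF assms] inner_sum_left)
  have "2 * (koszul w X Y \<bullet> Z) = (\<Sum>k\<in>UNIV. Z $ k * (w X Y \<bullet> axis k 1 - w Y (axis k 1) \<bullet> X + w (axis k 1) X \<bullet> Y))"
    unfolding inner_vec_def [of "koszul w X Y"] unfolding koszul_def vec_lambda_beta inner_real_def sum_distrib_left
    by (intro sum.cong refl) (simp add: mult.commute)
  then show ?thesis
    unfolding a b c by (simp add: algebra_simps sum.distrib sum_subtractf)
qed

lemma koszul_unique:
  assumes "bilinear w" "\<And>Z. 2 * (D \<bullet> Z) = w X Y \<bullet> Z - w Y Z \<bullet> X + w Z X \<bullet> Y"
  shows "D = koszul w X Y"
proof -
  have "D \<bullet> Z = koszul w X Y \<bullet> Z" for Z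
    using assms(2) [of Z] koszul_inner [OF assms(1), of X Y Z] by linarith
  then show ?thesis
    using vector_eq_rdot by blast
qed

lemma koszul_bilinear:
  assumes w: "bilinear w"
  shows "bilinear (koszul w)"
proof -
  note bl = bilinear_ladd [OF w] bilinear_radd [OF w] bilinear_lmul [OF w] bilinear_rmul [OF w]
  have "koszul w X (Y + Y') = koszul w X Y + koszul w X Y'" for X Y Y'
    by (rule koszul_unique [OF w, symmetric])
      (simp add: inner_add_left inner_add_right bl distrib_left koszul_inner [OF w])
  moreover have "koszul w (X + X') Y = koszul w X Y + koszul w X' Y" for X X' Y
    by (rule koszul_unique [OF w, symmetric])
      (simp add: inner_add_left inner_add_right bl distrib_left koszul_inner [OF w])
  moreover have "koszul w X (c *\<^sub>R Y) = c *\<^sub>R koszul w X Y" for X Y c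
    by (rule koszul_unique [OF w, symmetric])
      (simp add: bl mult.left_commute [of 2] koszul_inner [OF w] algebra_simps)
  moreover have "koszul w (c *\<^sub>R X) Y = c *\<^sub>R koszul w X Y" for X Y c
    by (rule koszul_unique [OF w, symmetric])
      (simp add: bl mult.left_commute [of 2] koszul_inner [OF w] algebra_simps)
  ultimately show ?thesis
    by (simp add: bilinear_def linear_iff)
qed

definition koszul_curvature :: "'n::finite bracket \<Rightarrow> real^'n \<Rightarrow> real^'n \<Rightarrow> real^'n \<Rightarrow> real^'n" where
  "koszul_curvature w X Y Z = koszul w X (koszul w Y Z) - koszul w Y (koszul w X Z) - koszul w (w X Y) Z"

lemma sum_antisym:
  fixes f :: "'n::finite \<Rightarrow> 'n \<Rightarrow> real"
  assumes "\<And>i j. f i j = - f j i"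
  shows "(\<Sum>i\<in>UNIV. \<Sum>j\<in>UNIV. f i j) = 0"
proof -
  have "(\<Sum>i\<in>UNIV. \<Sum>j\<in>UNIV. f i j) = (\<Sum>j\<in>UNIV. \<Sum>i\<in>UNIV. f i j)"
    by (rule sum.swap)
  also have "\<dots> = (\<Sum>j\<in>UNIV. \<Sum>i\<in>UNIV. - f j i)"
    by (intro sum.cong refl assms)
  finally show ?thesis
    by (simp add: sum_negf)
qed

lemma moment_mat_inner:
  assumes w: "bilinear w"
  shows "(moment_mat w *v Y) \<bullet> Z = (\<Sum>i\<in>UNIV. \<Sum>j\<in>UNIV. (w (axis i 1) (axis j 1) \<bullet> Y) * (w (axis i 1) (axis j 1) \<bullet> Z)) -
    2 * (\<Sum>j\<in>UNIV. w Y (axis j 1) \<bullet> w Z (axis j 1))"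
proof -
  define W where "W i j = w (axis i 1) (axis j 1)" for i j
  have "(moment_mat w *v Y) \<bullet> Z = (\<Sum>a\<in>UNIV. \<Sum>b\<in>UNIV. (\<Sum>i\<in>UNIV. \<Sum>j\<in>UNIV. W i j $ a * W i j $ b) * (Y $ b * Z $ a)) -
      2 * (\<Sum>a\<in>UNIV. \<Sum>b\<in>UNIV. (\<Sum>j\<in>UNIV. W a j \<bullet> W b j) * (Y $ b * Z $ a))"
    unfolding inner_vec_def [of "moment_mat w *v Y"]
    by (simp only: matrix_vector_mult_def vec_lambda_beta moment_mat_def W_def inner_real_def
        sum_distrib_right left_diff_distrib sum_subtractf sum_distrib_left mult.assoc)
  also have "(\<Sum>a\<in>UNIV. \<Sum>b\<in>UNIV. (\<Sum>i\<in>UNIV. \<Sum>j\<in>UNIV. W i j $ a * W i j $ b) * (Y $ b * Z $ a)) =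
      (\<Sum>a\<in>UNIV. \<Sum>b\<in>UNIV. \<Sum>i\<in>UNIV. \<Sum>j\<in>UNIV. (W i j $ b * Y $ b) * (W i j $ a * Z $ a))"
    by (simp add: sum_distrib_right sum_distrib_left mult_ac)
  also have "\<dots> = (\<Sum>i\<in>UNIV. \<Sum>j\<in>UNIV. \<Sum>a\<in>UNIV. \<Sum>b\<in>UNIV. (W i j $ b * Y $ b) * (W i j $ a * Z $ a))"
    by (rule sum_swap4)
  also have "\<dots> = (\<Sum>i\<in>UNIV. \<Sum>j\<in>UNIV. (W i j \<bullet> Y) * (W i j \<bullet> Z))"
    by (simp add: inner_vec_def sum_product mult.commute sum_distrib_left sum_distrib_right)
  also have "(\<Sum>a\<in>UNIV. \<Sum>b\<in>UNIV. (\<Sum>j\<in>UNIV. W a j \<bullet> W b j) * (Y $ b * Z $ a)) =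
      (\<Sum>a\<in>UNIV. \<Sum>b\<in>UNIV. \<Sum>j\<in>UNIV. (Z $ a *\<^sub>R W a j) \<bullet> (Y $ b *\<^sub>R W b j))"
    by (simp add: sum_distrib_right sum_distrib_left mult_ac)
  also have "\<dots> = (\<Sum>j\<in>UNIV. \<Sum>b\<in>UNIV. \<Sum>a\<in>UNIV. (Z $ a *\<^sub>R W a j) \<bullet> (Y $ b *\<^sub>R W b j))"
    by (rule sum_swap3)
  also have "\<dots> = (\<Sum>j\<in>UNIV. w Y (axis j 1) \<bullet> w Z (axis j 1))"
  proof (rule sum.cong [OF refl])
    fix j
    have e: "w X (axis j 1) = (\<Sum>b\<in>UNIV. X $ b *\<^sub>R W b j)" for X
    proof -
      have "w X (axis j 1) = w (\<Sum>b\<in>UNIV. X $ b *\<^sub>R axis b 1) (axis j 1)"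
        using basis_expansion [of X] by (simp add: scalar_mult_eq_scaleR)
      then show ?thesis
        by (simp add: bilinear_sum_left [OF w] W_def)
    qed
    show "(\<Sum>b\<in>UNIV. \<Sum>a\<in>UNIV. (Z $ a *\<^sub>R W a j) \<bullet> (Y $ b *\<^sub>R W b j)) = w Y (axis j 1) \<bullet> w Z (axis j 1)"
      unfolding e inner_sum_left inner_sum_right
      by (rule trans [OF sum.swap], rule sum.cong [OF refl], rule sum.cong [OF refl], rule inner_commute)
  qed
  finally show ?thesis
    by (simp add: W_def)
qed

text \<open>Writing \<open>A\<close> and \<open>B\<close> for the matrices of \<open>w Y\<close> and \<open>w Z\<close>, and \<open>p\<close>, \<open>r\<close> for the
  skew-symmetric matrices of the forms \<open>w \<bullet> Y\<close> and \<open>w \<bullet> Z\<close>, the Ricci tensor is the pairing of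
  \<open>- B - B\<^sup>T - r\<close> with \<open>A + A\<^sup>T - p\<close>, up to a factor; mixed products of symmetric and
  skew-symmetric matrices drop out, and nilpotency kills the trace of \<open>A B\<close>.\<close>

lemma ricci_trace:
  assumes w: "w \<in> skew_bilinear"
    and t1: "\<And>X. (\<Sum>i\<in>UNIV. w X (axis i 1) \<bullet> axis i 1) = 0"
    and t2: "\<And>X Y. (\<Sum>i\<in>UNIV. w X (w Y (axis i 1)) \<bullet> axis i 1) = 0"
  shows "4 * (\<Sum>i\<in>UNIV. koszul_curvature w (axis i 1) Y Z \<bullet> axis i 1) = (moment_mat w *v Y) \<bullet> Z"
proof -
  note bl = skew_bilinearD(1) [OF w] and sk = skew_bilinearD(2) [OF w]
  define A where "A i j = w Y (axis i 1) \<bullet> axis j 1" for i j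
  define B where "B i j = w Z (axis i 1) \<bullet> axis j 1" for i j
  define p where "p i j = w (axis i 1) (axis j 1) \<bullet> Y" for i j
  define r where "r i j = w (axis i 1) (axis j 1) \<bullet> Z" for i j
  have pr: "p i j = - p j i" "r i j = - r j i" for i j
    using sk [of "axis i 1" "axis j 1"] by (simp_all add: p_def r_def)
  have lcs: "koszul w Y U \<bullet> V = - (U \<bullet> koszul w Y V)" for U V
    using koszul_inner [OF bl, of Y U V] koszul_inner [OF bl, of Y V U] sk [of V U] sk [of V Y] sk [of U Y]
    by (simp add: inner_commute [of U])
  have c: "x \<bullet> y = (\<Sum>j\<in>UNIV. (x \<bullet> axis j 1) * (y \<bullet> axis j 1))" for x y :: "real^'a"
    by (simp add: inner_vec_def [of x y] inner_axis)
  define D where "D i j = koszul w (axis i 1) Z \<bullet> axis j 1" for i j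
  define E where "E i j = koszul w Y (axis i 1) \<bullet> axis j 1" for i j
  have D: "2 * D i j = - B i j - B j i - r i j" for i j
    using koszul_inner [OF bl, of "axis i 1" Z "axis j 1"] sk [of "axis i 1" Z] sk [of "axis j 1" "axis i 1"]
    by (simp add: D_def B_def r_def)
  have E: "2 * E i j = A i j - p i j - A j i" for i j
    using koszul_inner [OF bl, of Y "axis i 1" "axis j 1"] sk [of "axis j 1" Y]
    by (simp add: E_def A_def p_def)
  have z: "w x x = 0" for x
  proof -
    have "w x x $ k = 0" for k
      using arg_cong [OF sk [of x x], of "\<lambda>v. v $ k"] by simp
    then show ?thesis
      by (simp add: vec_eq_iff)
  qed
  have T1: "(\<Sum>i\<in>UNIV. koszul w (axis i 1) V \<bullet> axis i 1) = 0" for V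
  proof -
    have "koszul w (axis i 1) V \<bullet> axis i 1 = - (w V (axis i 1) \<bullet> axis i 1)" for i
      using koszul_inner [OF bl, of "axis i 1" V "axis i 1"] sk [of "axis i 1" V] z [of "axis i 1"] by simp
    then show ?thesis
      using t1 [of V] by (simp add: sum_negf)
  qed
  have T2: "(\<Sum>i\<in>UNIV. koszul w Y (koszul w (axis i 1) Z) \<bullet> axis i 1) = - (\<Sum>i\<in>UNIV. \<Sum>j\<in>UNIV. D i j * E i j)"
    unfolding lcs by (simp add: c [of "koszul w (axis i 1) Z" "koszul w Y (axis i 1)" for i] D_def E_def sum_negf)
  have T3: "(\<Sum>i\<in>UNIV. koszul w (w (axis i 1) Y) Z \<bullet> axis i 1) = - (\<Sum>i\<in>UNIV. \<Sum>j\<in>UNIV. D i j * A j i)"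
  proof -
    have "w (axis i 1) Y = (\<Sum>j\<in>UNIV. (- A i j) *\<^sub>R axis j 1)" for i
      using basis_expansion [of "w (axis i 1) Y"] sk [of "axis i 1" Y]
      by (simp add: scalar_mult_eq_scaleR A_def inner_axis)
    then have "koszul w (w (axis i 1) Y) Z \<bullet> axis i 1 = - (\<Sum>j\<in>UNIV. D j i * A i j)" for i
      by (simp only: bilinear_sum_left [OF koszul_bilinear [OF bl]] inner_sum_left)
        (simp add: D_def sum_negf mult.commute)
    then have "(\<Sum>i\<in>UNIV. koszul w (w (axis i 1) Y) Z \<bullet> axis i 1) = - (\<Sum>i\<in>UNIV. \<Sum>j\<in>UNIV. D j i * A i j)"
      by (simp add: sum_negf)
    then show ?thesis
      by (subst (asm) sum.swap)
  qed
  have "(\<Sum>i\<in>UNIV. koszul_curvature w (axis i 1) Y Z \<bullet> axis i 1) = (\<Sum>i\<in>UNIV. \<Sum>j\<in>UNIV. D i j * (E i j + A j i))"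
    unfolding koszul_curvature_def inner_diff_left sum_subtractf T1 T2 T3 by (simp add: distrib_left sum.distrib)
  then have "4 * (\<Sum>i\<in>UNIV. koszul_curvature w (axis i 1) Y Z \<bullet> axis i 1) = (\<Sum>i\<in>UNIV. \<Sum>j\<in>UNIV. 4 * (D i j * (E i j + A j i)))"
    by (simp add: sum_distrib_left)
  also have "\<dots> = (\<Sum>i\<in>UNIV. \<Sum>j\<in>UNIV. p i j * r i j + ((B i j + B j i) * p i j - r i j * (A i j + A j i)) -
      B i j * A i j - B j i * A j i - B i j * A j i - B j i * A i j)"
  proof (rule sum.cong [OF refl], rule sum.cong [OF refl])
    fix i j
    have "4 * (D i j * (E i j + A j i)) = (2 * D i j) * (2 * E i j + 2 * A j i)"
      by (simp add: algebra_simps)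
    also have "\<dots> = (- B i j - B j i - r i j) * (A i j + A j i - p i j)"
      unfolding D E by simp
    finally show "4 * (D i j * (E i j + A j i)) = p i j * r i j + ((B i j + B j i) * p i j - r i j * (A i j + A j i)) -
      B i j * A i j - B j i * A j i - B i j * A j i - B j i * A i j"
      by (simp add: algebra_simps)
  qed
  also have "\<dots> = (\<Sum>i\<in>UNIV. \<Sum>j\<in>UNIV. p i j * r i j) +
      (\<Sum>i\<in>UNIV. \<Sum>j\<in>UNIV. (B i j + B j i) * p i j - r i j * (A i j + A j i)) -
      (\<Sum>i\<in>UNIV. \<Sum>j\<in>UNIV. B i j * A i j) - (\<Sum>i\<in>UNIV. \<Sum>j\<in>UNIV. B j i * A j i) -
      (\<Sum>i\<in>UNIV. \<Sum>j\<in>UNIV. B i j * A j i) - (\<Sum>i\<in>UNIV. \<Sum>j\<in>UNIV. B j i * A i j)"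
    by (simp only: sum.distrib sum_subtractf)
  also have "(\<Sum>i\<in>UNIV. \<Sum>j\<in>UNIV. (B i j + B j i) * p i j - r i j * (A i j + A j i)) = 0"
  proof (rule sum_antisym)
    fix i j
    show "(B i j + B j i) * p i j - r i j * (A i j + A j i) = - ((B j i + B i j) * p j i - r j i * (A j i + A i j))"
      unfolding pr [of i j] by (simp add: algebra_simps)
  qed
  also have "(\<Sum>i\<in>UNIV. \<Sum>j\<in>UNIV. B j i * A j i) = (\<Sum>i\<in>UNIV. \<Sum>j\<in>UNIV. B i j * A i j)"
    by (rule sum.swap)
  also have "(\<Sum>i\<in>UNIV. \<Sum>j\<in>UNIV. B j i * A i j) = (\<Sum>i\<in>UNIV. \<Sum>j\<in>UNIV. B i j * A j i)"
    by (rule sum.swap)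
  also have "(\<Sum>i\<in>UNIV. \<Sum>j\<in>UNIV. B i j * A j i) = 0"
  proof -
    have "w Z (axis i 1) = (\<Sum>j\<in>UNIV. B i j *\<^sub>R axis j 1)" for i
      using basis_expansion [of "w Z (axis i 1)"] by (simp add: scalar_mult_eq_scaleR B_def inner_axis)
    then have "w Y (w Z (axis i 1)) \<bullet> axis i 1 = (\<Sum>j\<in>UNIV. B i j * A j i)" for i
      by (simp only: bilinear_sum_right [OF bl] inner_sum_left) (simp add: A_def)
    then show ?thesis
      using t2 [of Y Z] by simp
  qed
  also have "(\<Sum>i\<in>UNIV. \<Sum>j\<in>UNIV. B i j * A i j) = (\<Sum>i\<in>UNIV. w Y (axis i 1) \<bullet> w Z (axis i 1))"
    by (simp add: c [of "w Y (axis i 1)" "w Z (axis i 1)" for i] A_def B_def mult.commute)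
  finally show ?thesis
    unfolding moment_mat_inner [OF bl] p_def r_def by simp
qed

subsection \<open>Compatible metrics as moving brackets\<close>

text \<open>The metric \<open>pullback (\<bullet>) h\<close> on the bracket \<open>\<mu>\<close> is isometric, via \<open>h\<close>, to the canonical
  metric on the bracket \<open>h \<cdot> \<mu>\<close>.\<close>

locale moved_bracket =
  fixes \<mu> :: "'n::finite bracket" and h h' :: "'n mat"
  assumes nil: "nilpotent_lie_bracket \<mu>" and hh': "h ** h' = mat 1"
begin

definition w :: "'n bracket" where "w = bracket_act h \<mu>"

definition ip :: "'n form" where "ip = pullback (\<bullet>) h"

lemma h'h: "h' ** h = mat 1"
  using hh' by (simp add: matrix_left_right_inverse)

lemma ip_eq: "ip X Y = (h *v X) \<bullet> (h *v Y)"
  by (simp add: ip_def pullback_def)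

lemma w_skew: "w \<in> skew_bilinear"
  using nil by (simp add: w_def bracket_act_skew [OF hh'] nilpotent_lie_bracket_def lie_bracket_def)

lemma w_bilinear: "bilinear w"
  by (rule skew_bilinearD [OF w_skew])

lemma cancel [simp]: "h *v (h' *v X) = X" "h' *v (h *v X) = X"
  by (simp_all add: matrix_vector_mul_assoc hh' h'h)

lemma w_h: "w (h *v X) (h *v Y) = h *v \<mu> X Y"
  by (simp add: w_def bracket_act_eq [OF hh'])

lemma h_eq: "h *v X = Y \<longleftrightarrow> X = h' *v Y"
  by auto

lemma levi_civita_eq: "levi_civita ip \<mu> X Y = h' *v koszul w (h *v X) (h *v Y)"
  unfolding levi_civita_def
proof (rule the_equality)
  show "\<forall>Z. 2 * ip (h' *v koszul w (h *v X) (h *v Y)) Z = ip (\<mu> X Y) Z - ip (\<mu> Y Z) X + ip (\<mu> Z X) Y"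
    by (simp add: ip_eq koszul_inner [OF w_bilinear] w_h)
next
  fix D assume *: "\<forall>Z. 2 * ip D Z = ip (\<mu> X Y) Z - ip (\<mu> Y Z) X + ip (\<mu> Z X) Y"
  have "h *v D = koszul w (h *v X) (h *v Y)"
  proof (rule koszul_unique [OF w_bilinear])
    fix Z
    show "2 * ((h *v D) \<bullet> Z) = w (h *v X) (h *v Y) \<bullet> Z - w (h *v Y) Z \<bullet> (h *v X) + w Z (h *v X) \<bullet> (h *v Y)"
      using * [rule_format, of "h' *v Z"] w_h [of Y "h' *v Z"] w_h [of "h' *v Z" X]
      by (simp add: ip_eq w_h)
  qed
  then show "D = h' *v koszul w (h *v X) (h *v Y)"
    by (simp add: h_eq)
qed

lemma curvature_eq: "curvature ip \<mu> X Y Z = h' *v koszul_curvature w (h *v X) (h *v Y) (h *v Z)"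
  by (simp add: curvature_def levi_civita_eq koszul_curvature_def w_h [symmetric] matrix_vector_mult_diff_distrib)

lemma linear_koszul_curvature: "linear (\<lambda>X. koszul_curvature w X Y Z)"
proof -
  have "linear (koszul w X)" "linear (\<lambda>X. koszul w X Y)" "linear (\<lambda>X. w X Y)" for X Y
    using koszul_bilinear [OF w_bilinear] w_bilinear by (auto simp: bilinear_def)
  then show ?thesis
    unfolding koszul_curvature_def
    by (intro linear_compose_sub linear_compose [of "\<lambda>X. koszul w X Z" "koszul w Y", unfolded o_def]
        linear_compose [of "\<lambda>X. w X Y" "\<lambda>X. koszul w X Z", unfolded o_def]) auto
qed

lemma trace_matrix: "trace (matrix f) = (\<Sum>i\<in>UNIV. f (axis i 1) \<bullet> axis i 1)"
  for f :: "real^'n \<Rightarrow> real^'n"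
  by (simp add: trace_def matrix_def inner_axis)

lemma ricci_tensor_eq: "4 * ricci_tensor ip \<mu> Y Z = (moment_mat w *v (h *v Y)) \<bullet> (h *v Z)"
proof -
  let ?F = "\<lambda>X. koszul_curvature w X (h *v Y) (h *v Z)"
  have "matrix (\<lambda>X. h' *v ?F (h *v X)) = h' ** matrix ?F ** h"
  proof -
    have "(h' ** matrix ?F ** h) *v X = h' *v ?F (h *v X)" for X
      using fun_cong [OF matrix_vector_mul(2) [OF linear_koszul_curvature], of "h *v Y" "h *v Z" "h *v X"]
      by (simp flip: matrix_vector_mul_assoc)
    then show ?thesis
      by (metis (no_types, lifting) ext matrix_of_matrix_vector_mul)
  qed
  then have "ricci_tensor ip \<mu> Y Z = trace (h' ** matrix ?F ** h)"
    by (simp add: ricci_tensor_def curvature_eq)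
  also have "\<dots> = trace (h ** (h' ** matrix ?F))"
    by (rule trace_mul_sym)
  also have "\<dots> = trace (matrix ?F)"
    by (simp add: matrix_mul_assoc hh')
  also have "4 * \<dots> = (moment_mat w *v (h *v Y)) \<bullet> (h *v Z)"
    unfolding trace_matrix
    by (rule ricci_trace [OF w_skew])
      (use nilpotent_traces [OF nil hh'] in \<open>simp_all add: w_def\<close>)
  finally show ?thesis .
qed

lemma ricci_operator_eq: "ricci_operator ip \<mu> = h' ** (moment_mat w /\<^sub>R 4) ** h"
  unfolding ricci_operator_def
proof (rule the_equality)
  have "(moment_mat w /\<^sub>R 4) *v X = (moment_mat w *v X) /\<^sub>R 4" for X
    by (simp add: scaleR_matrix_vector_assoc)
  then show "\<forall>Y Z. ip ((h' ** (moment_mat w /\<^sub>R 4) ** h) *v Y) Z = ricci_tensor ip \<mu> Y Z"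
    by (simp add: ip_eq ricci_tensor_eq [symmetric] flip: matrix_vector_mul_assoc)
  then show "R = h' ** (moment_mat w /\<^sub>R 4) ** h" if "\<forall>Y Z. ip (R *v Y) Z = ricci_tensor ip \<mu> Y Z" for R
  proof -
    have "ip (R *v Y) (h' *v Z) = ip ((h' ** (moment_mat w /\<^sub>R 4) ** h) *v Y) (h' *v Z)" for Y Z
      using that \<open>\<forall>Y Z. ip ((h' ** (moment_mat w /\<^sub>R 4) ** h) *v Y) Z = ricci_tensor ip \<mu> Y Z\<close> by simp
    then have "(h *v (R *v Y)) \<bullet> Z = (h *v ((h' ** (moment_mat w /\<^sub>R 4) ** h) *v Y)) \<bullet> Z" for Y Z
      unfolding ip_eq by simp
    then have "h *v (R *v Y) = h *v ((h' ** (moment_mat w /\<^sub>R 4) ** h) *v Y)" for Y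
      using vector_eq_rdot by blast
    then have "R *v Y = (h' ** (moment_mat w /\<^sub>R 4) ** h) *v Y" for Y
      by (metis cancel(2))
    then show ?thesis
      by (simp add: matrix_eq)
  qed
qed

lemma trace_conj: "trace (h' ** M ** h) = trace M"
  using trace_mul_sym [of "h' ** M" h] by (simp add: matrix_mul_assoc hh')

lemma scalar_curvature_eq: "scalar_curvature ip \<mu> = - bracket_inner w w / 4"
proof -
  have "trace M = M \<bullet> diag_mat (\<lambda>i. 1)" for M :: "'n mat"
    unfolding trace_def inner_vec_def by (simp add: if_distrib [of "\<lambda>c. _ * c"] cong: if_cong)
  then have "trace (moment_mat w) = - bracket_inner w w"
    by (simp add: moment_mat_diag [OF w_skew] bracket_inner_coords sum_negf)
  moreover have "trace (moment_mat w /\<^sub>R 4) = trace (moment_mat w) / 4"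
    unfolding trace_def by (simp flip: sum_divide_distrib)
  ultimately show ?thesis
    unfolding scalar_curvature_def ricci_operator_eq trace_conj by (simp only:)
qed

lemma adjoint_eq: "adjoint_wrt ip X = h' ** transpose (h ** X ** h') ** h"
  unfolding adjoint_wrt_def
proof (rule the_equality)
  have a: "(M *v x) \<bullet> y = x \<bullet> (transpose M *v y)" for M :: "'n mat" and x y
    using dot_lmul_matrix [of y M x] by (simp add: inner_commute)
  have "ip (X *v u) v = (h *v u) \<bullet> (transpose (h ** X ** h') *v (h *v v))" for u v
  proof -
    have "(h ** X ** h') *v (h *v u) = h *v (X *v u)"
      by (simp only: matrix_vector_mul_assoc [symmetric] cancel)
    then show ?thesis
      using a [of "h ** X ** h'" "h *v u" "h *v v"] by (simp only: ip_eq)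
  qed
  then show *: "\<forall>u v. ip (X *v u) v = ip u ((h' ** transpose (h ** X ** h') ** h) *v v)"
  proof -
    have "h *v ((h' ** transpose (h ** X ** h') ** h) *v v) = transpose (h ** X ** h') *v (h *v v)" for v
      by (simp only: matrix_vector_mul_assoc [symmetric] cancel)
    then show ?thesis
      using \<open>\<And>v u. ip (X *v u) v = (h *v u) \<bullet> (transpose (h ** X ** h') *v (h *v v))\<close>
      by (auto simp only: ip_eq)
  qed
  fix Y assume Y: "\<forall>u v. ip (X *v u) v = ip u (Y *v v)"
  have "ip (h' *v u) (Y *v v) = ip (h' *v u) ((h' ** transpose (h ** X ** h') ** h) *v v)" for u v
    by (rule trans [OF Y [rule_format, symmetric] * [rule_format]])
  then have "u \<bullet> (h *v (Y *v v)) = u \<bullet> (h *v ((h' ** transpose (h ** X ** h') ** h) *v v))" for u v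
    unfolding ip_eq by simp
  then have "h *v (Y *v v) = h *v ((h' ** transpose (h ** X ** h') ** h) *v v)" for v
    using vector_eq_ldot by blast
  then have "Y *v v = (h' ** transpose (h ** X ** h') ** h) *v v" for v
    by (metis cancel(2))
  then show "Y = h' ** transpose (h ** X ** h') ** h"
    by (simp add: matrix_eq)
qed

lemma mat_inner_wrt_eq: "mat_inner_wrt ip X Y = (h ** X ** h') \<bullet> (h ** Y ** h')"
proof -
  have "mat_inner_wrt ip X Y = trace (X ** (h' ** transpose (h ** Y ** h') ** h))"
    by (simp add: mat_inner_wrt_def adjoint_eq)
  also have "\<dots> = trace (h ** (X ** (h' ** transpose (h ** Y ** h'))))"
    using trace_mul_sym [of "X ** (h' ** transpose (h ** Y ** h'))" h] by (simp add: matrix_mul_assoc)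
  also have "\<dots> = mat_inner (h ** X ** h') (h ** Y ** h')"
    by (simp add: mat_inner_def matrix_mul_assoc)
  finally show ?thesis
    by (simp add: mat_inner_eq_inner)
qed

lemma ricci_gamma_norm2_eq:
  assumes \<gamma>: "\<forall>T\<in>\<gamma>. is_tensor T"
    and conj: "\<And>Y. Y \<in> gl_gamma \<gamma> \<Longrightarrow> h ** Y ** h' \<in> gl_gamma \<gamma>" "\<And>Y. Y \<in> gl_gamma \<gamma> \<Longrightarrow> h' ** Y ** h \<in> gl_gamma \<gamma>"
    and nz: "bracket_inner w w > 0"
  shows "ricci_gamma_norm2 \<gamma> ip \<mu> = (scalar_curvature ip \<mu>)\<^sup>2 * (gl_moment \<gamma> w \<bullet> gl_moment \<gamma> w)"
proof -
  have hc: "h ** (h' ** M ** h) ** h' = M" for M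
  proof -
    have "h ** (h' ** M ** h) ** h' = (h ** h') ** M ** (h ** h')"
      by (simp only: matrix_mul_assoc)
    then show ?thesis by (simp add: hh')
  qed
  have h'c: "h' ** (h ** M ** h') ** h = M" for M
  proof -
    have "h' ** (h ** M ** h') ** h = (h' ** h) ** M ** (h' ** h)"
      by (simp only: matrix_mul_assoc)
    then show ?thesis by (simp add: h'h)
  qed
  let ?S = "gl_gamma \<gamma>" and ?R = "ricci_operator ip \<mu>"
  define P where "P = (bracket_inner w w / 4) *\<^sub>R gl_moment \<gamma> w"
  have sub: "subspace ?S"
    by (rule subspace_gl_gamma [OF \<gamma>])
  have PS: "P \<in> ?S"
    unfolding P_def by (intro subspace_scale sub gl_moment_props \<gamma>)
  have PY: "P \<bullet> Y = (moment_mat w /\<^sub>R 4) \<bullet> Y" if "Y \<in> ?S" for Y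
    using gl_moment_props(2) [OF \<gamma> that, of w] nz by (simp add: P_def field_simps)
  have "ricci_gamma \<gamma> ip \<mu> = h' ** P ** h"
    unfolding ricci_gamma_def orth_proj_def
  proof (rule the_equality)
    have "mat_inner_wrt ip (?R - h' ** P ** h) Y = 0" if "Y \<in> ?S" for Y
      using PY [OF conj(1) [OF that]]
      by (simp add: mat_inner_wrt_eq ricci_operator_eq mat_mult_diff_left mat_mult_diff_right hc inner_diff_left)
    then show "h' ** P ** h \<in> ?S \<and> (\<forall>Y\<in>?S. mat_inner_wrt ip (?R - h' ** P ** h) Y = 0)"
      using conj(2) [OF PS] by blast
    fix P' assume P': "P' \<in> ?S \<and> (\<forall>Y\<in>?S. mat_inner_wrt ip (?R - P') Y = 0)"
    let ?D = "h ** P' ** h' - P"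
    have D: "?D \<in> ?S"
      using P' PS conj(1) sub by (auto intro: subspace_diff)
    have "mat_inner_wrt ip (?R - P') (h' ** ?D ** h) = 0"
      using P' conj(2) [OF D] by blast
    then have "(moment_mat w /\<^sub>R 4 - h ** P' ** h') \<bullet> ?D = 0"
      by (simp add: mat_inner_wrt_eq ricci_operator_eq mat_mult_diff_left mat_mult_diff_right hc)
    then have "?D \<bullet> ?D = 0"
      using PY [OF D] by (simp add: inner_diff_left)
    then have "h ** P' ** h' = P" by simp
    then show "P' = h' ** P ** h"
      using h'c [of P'] by simp
  qed
  then have "ricci_gamma_norm2 \<gamma> ip \<mu> = P \<bullet> P"
    by (simp add: ricci_gamma_norm2_def mat_inner_wrt_eq hc)
  then show ?thesis
    by (simp add: P_def scalar_curvature_eq power2_eq_square)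
qed

end

lemma gl_moment_scale:
  assumes "c \<noteq> 0"
  shows "gl_moment \<gamma> (\<lambda>X Y. c *\<^sub>R w X Y) = gl_moment \<gamma> w"
    "bracket_inner (\<lambda>X Y. c *\<^sub>R w X Y) (\<lambda>X Y. c *\<^sub>R w X Y) = c\<^sup>2 * bracket_inner w w"
proof -
  have m: "moment_mat (\<lambda>X Y. c *\<^sub>R w X Y) = c\<^sup>2 *\<^sub>R moment_mat w"
    by (simp add: moment_mat_def vec_eq_iff power2_eq_square sum_distrib_left algebra_simps)
  show i: "bracket_inner (\<lambda>X Y. c *\<^sub>R w X Y) (\<lambda>X Y. c *\<^sub>R w X Y) = c\<^sup>2 * bracket_inner w w"
    unfolding bracket_inner_alt by (simp add: power2_eq_square sum_distrib_left mult.assoc)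
  show "gl_moment \<gamma> (\<lambda>X Y. c *\<^sub>R w X Y) = gl_moment \<gamma> w"
  proof -
    have e: "inverse (c\<^sup>2 * b) * c\<^sup>2 = inverse b" for b
      using assms by simp
    show ?thesis
      unfolding gl_moment_def m i scaleR_scaleR e ..
  qed
qed

lemma compatible_metric_curvature:
  fixes \<mu> :: "'n::finite bracket"
  assumes \<gamma>: "\<forall>T\<in>\<gamma>. is_tensor T" and nil: "nilpotent_lie_bracket \<mu>" and nz: "\<mu> \<noteq> (\<lambda>X Y. 0)"
    and g: "g \<in> stabilizer \<gamma>" and c: "c > 0"
  defines "q \<equiv> (\<lambda>X Y. c * pullback (\<bullet>) g X Y)"
  shows "scalar_curvature q \<mu> = - bracket_inner (bracket_act g \<mu>) (bracket_act g \<mu>) / (4 * c)"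
    "ricci_gamma_norm2 \<gamma> q \<mu> = (scalar_curvature q \<mu>)\<^sup>2 * (norm (gl_moment \<gamma> (bracket_act g \<mu>)))\<^sup>2"
    "bracket_inner (bracket_act g \<mu>) (bracket_act g \<mu>) > 0"
proof -
  have inv: "invertible g"
    using g by (simp add: stabilizer_def)
  then obtain g' where g': "g ** g' = mat 1"
    using matrix_inv_both(1) by blast
  have g'g: "g' ** g = mat 1"
    using g' by (simp add: matrix_left_right_inverse)
  have g'G: "g' \<in> stabilizer \<gamma>"
    by (rule stabilizer_inv [OF g g'])
  define s where "s = sqrt c"
  have s: "s > 0" "s * s = c"
    using c by (auto simp: s_def)
  \<comment> \<open>the homothety of factor \<open>c\<close> is absorbed into \<open>h\<close>, and conjugation by \<open>h\<close> or by \<open>g\<close> is the same\<close>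
  define h h' where "h = s *\<^sub>R g" and "h' = inverse s *\<^sub>R g'"
  have hh': "h ** h' = mat 1"
    using s by (simp add: h_def h'_def mat_ring g')
  interpret moved_bracket \<mu> h h'
    by unfold_locales (rule nil, rule hh')
  have ipq: "ip = q"
    unfolding fun_eq_iff ip_eq
    by (simp add: q_def pullback_def h_def s(2) [symmetric] mult.assoc
        flip: scaleR_matrix_vector_assoc)
  have sk: "\<mu> \<in> skew_bilinear"
    using nil by (simp add: nilpotent_lie_bracket_def lie_bracket_def)
  have weq: "w = (\<lambda>X Y. inverse s *\<^sub>R bracket_act g \<mu> X Y)"
  proof (intro ext)
    fix X Y
    have "h' *v Z = inverse s *\<^sub>R (g' *v Z)" "h *v Z = s *\<^sub>R (g *v Z)" for Z
      by (simp_all add: h_def h'_def flip: scaleR_matrix_vector_assoc)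
    then show "w X Y = inverse s *\<^sub>R bracket_act g \<mu> X Y"
      unfolding w_def bracket_act_eq [OF hh'] bracket_act_eq [OF g'] using s
      by (simp add: bilinear_lmul [OF skew_bilinearD(1) [OF sk]] bilinear_rmul [OF skew_bilinearD(1) [OF sk]]
          matrix_vector_mult_scaleR)
  qed
  have isq: "inverse s \<noteq> 0" "(inverse s)\<^sup>2 = 1 / c"
    using s by (auto simp: power2_eq_square field_simps)
  show pos: "bracket_inner (bracket_act g \<mu>) (bracket_act g \<mu>) > 0"
    by (rule bracket_inner_pos [OF bracket_act_skew [OF g' sk] bracket_act_nonzero [OF g' nz]])
  have wpos: "bracket_inner w w > 0"
    unfolding weq gl_moment_scale(2) [OF isq(1)] isq(2) using pos c by simp
  show "scalar_curvature q \<mu> = - bracket_inner (bracket_act g \<mu>) (bracket_act g \<mu>) / (4 * c)"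
    using scalar_curvature_eq unfolding ipq weq gl_moment_scale(2) [OF isq(1)] isq(2) by simp
  have cj: "h ** Y ** h' = g ** Y ** g'" "h' ** Y ** h = g' ** Y ** g" for Y
    using s by (simp_all add: h_def h'_def mat_ring)
  show "ricci_gamma_norm2 \<gamma> q \<mu> = (scalar_curvature q \<mu>)\<^sup>2 * (norm (gl_moment \<gamma> (bracket_act g \<mu>)))\<^sup>2"
    using ricci_gamma_norm2_eq [OF \<gamma> _ _ wpos] gl_gamma_conj [OF _ g g'] gl_gamma_conj [OF _ g'G g'g]
    unfolding cj ipq by (simp add: weq gl_moment_scale(1) [OF isq(1)] power2_norm_eq_inner)
qed

text \<open>Rescaling a metric by a homothety normalizes its scalar curvature without changing the moment
  \<open>gl_moment \<gamma> (g \<cdot> \<mu>)\<close>, so a minimal metric is a minimum of the norm of that moment along the orbit.\<close>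

lemma minimal_metric_iff_moment:
  fixes \<mu> :: "'n::finite bracket"
  assumes cl: "class_gamma_nilpotent integ C \<gamma> \<mu>" and can: "(\<bullet>) \<in> C" and nz: "\<mu> \<noteq> (\<lambda>X Y. 0)"
  shows "(\<exists>ip. minimal_metric C \<gamma> \<mu> ip) \<longleftrightarrow> (\<exists>g\<in>stabilizer \<gamma>. \<forall>g'\<in>stabilizer \<gamma>.
    norm (gl_moment \<gamma> (bracket_act g \<mu>)) \<le> norm (gl_moment \<gamma> (bracket_act g' \<mu>)))"
proof -
  have \<gamma>: "\<forall>T\<in>\<gamma>. is_tensor T" and nil: "nilpotent_lie_bracket \<mu>"
    and orb: "single_orbit (stabilizer \<gamma>) C"
    using cl by (auto simp: class_gamma_nilpotent_def)
  note curv = compatible_metric_curvature [OF \<gamma> nil nz]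
  have C: "C = pullback (\<bullet>) ` stabilizer \<gamma>"
  proof -
    obtain ip where ip: "C = pullback ip ` stabilizer \<gamma>"
      using orb by (auto simp: single_orbit_def)
    then obtain g0 where g0: "g0 \<in> stabilizer \<gamma>" "(\<bullet>) = pullback ip g0"
      using can by auto
    obtain g1 where g1: "g0 ** g1 = mat 1"
      using g0(1) matrix_inv_both(1) by (auto simp: stabilizer_def)
    have g1G: "g1 \<in> stabilizer \<gamma>"
      by (rule stabilizer_inv [OF g0(1) g1])
    have pb: "pullback (\<bullet>) g = pullback ip (g0 ** g)" for g
      unfolding g0(2) by (simp add: pullback_def matrix_vector_mul_assoc)
    have "pullback ip g = pullback (\<bullet>) (g1 ** g)" for g
      by (simp add: pb matrix_mul_assoc g1)
    then show ?thesis
      unfolding ip using pb stabilizer_mult g0(1) g1G by (auto intro!: image_eqI)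
  qed
  let ?m = "\<lambda>g. norm (gl_moment \<gamma> (bracket_act g \<mu>))"
  have "minimal_metric C \<gamma> \<mu> (pullback (\<bullet>) g) \<longleftrightarrow> (\<forall>g'\<in>stabilizer \<gamma>. ?m g \<le> ?m g')"
    if g: "g \<in> stabilizer \<gamma>" for g
  proof -
    let ?q = "\<lambda>c g. (\<lambda>X Y. c * pullback (\<bullet>) g X Y) :: 'n form"
    have q1: "pullback (\<bullet>) g = ?q 1 g" by simp
    have neg: "scalar_curvature (?q 1 g) \<mu> \<noteq> 0"
      using curv(1) [OF g, of 1] curv(3) [OF g, of 1] by simp
    have le: "ricci_gamma_norm2 \<gamma> (?q 1 g) \<mu> \<le> ricci_gamma_norm2 \<gamma> (?q c g') \<mu> \<longleftrightarrow> ?m g \<le> ?m g'"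
      if "g' \<in> stabilizer \<gamma>" "c > 0" "scalar_curvature (?q c g') \<mu> = scalar_curvature (?q 1 g) \<mu>" for c g'
    proof -
      have "ricci_gamma_norm2 \<gamma> (?q 1 g) \<mu> = (scalar_curvature (?q 1 g) \<mu>)\<^sup>2 * (?m g)\<^sup>2"
        by (rule curv(2) [OF g]) simp
      moreover have "ricci_gamma_norm2 \<gamma> (?q c g') \<mu> = (scalar_curvature (?q 1 g) \<mu>)\<^sup>2 * (?m g')\<^sup>2"
        using curv(2) [OF that(1,2)] that(3) by simp
      moreover have "(scalar_curvature (?q 1 g) \<mu>)\<^sup>2 > 0"
        using neg by simp
      ultimately show ?thesis
        by (simp add: mult_le_cancel_left_pos power2_le_iff_abs_le)
    qed
    have ex: "\<exists>c>0. scalar_curvature (?q c g') \<mu> = scalar_curvature (?q 1 g) \<mu>" if g': "g' \<in> stabilizer \<gamma>" for g'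
    proof (intro exI conjI)
      let ?b = "\<lambda>g. bracket_inner (bracket_act g \<mu>) (bracket_act g \<mu>)"
      have b: "?b g > 0" "?b g' > 0"
        using curv(3) [OF g, of 1] curv(3) [OF g', of 1] by auto
      then show "?b g' / ?b g > 0" by simp
      then show "scalar_curvature (?q (?b g' / ?b g) g') \<mu> = scalar_curvature (?q 1 g) \<mu>"
        using curv(1) [OF g', of "?b g' / ?b g"] curv(1) [OF g, of 1] b by simp
    qed
    have resc: "q \<in> rescalings C \<longleftrightarrow> (\<exists>c g'. c > 0 \<and> g' \<in> stabilizer \<gamma> \<and> q = ?q c g')" for q
      by (auto simp: rescalings_def C)
    show ?thesis
    proof
      assume "minimal_metric C \<gamma> \<mu> (pullback (\<bullet>) g)"
      then have min: "\<forall>q\<in>rescalings C. scalar_curvature q \<mu> = scalar_curvature (?q 1 g) \<mu> \<longrightarrow>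
          ricci_gamma_norm2 \<gamma> (?q 1 g) \<mu> \<le> ricci_gamma_norm2 \<gamma> q \<mu>"
        unfolding minimal_metric_def q1 [symmetric] by blast
      show "\<forall>g'\<in>stabilizer \<gamma>. ?m g \<le> ?m g'"
      proof
        fix g' assume g': "g' \<in> stabilizer \<gamma>"
        obtain c where c: "c > 0" "scalar_curvature (?q c g') \<mu> = scalar_curvature (?q 1 g) \<mu>"
          using ex [OF g'] by blast
        have "?q c g' \<in> rescalings C"
          unfolding resc using c g' by blast
        then show "?m g \<le> ?m g'"
          using min c le [OF g' c] by blast
      qed
    next
      assume *: "\<forall>g'\<in>stabilizer \<gamma>. ?m g \<le> ?m g'"
      show "minimal_metric C \<gamma> \<mu> (pullback (\<bullet>) g)"
        unfolding minimal_metric_def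
      proof (intro conjI ballI impI)
        show "pullback (\<bullet>) g \<in> C"
          using g by (simp add: C)
        fix q assume "q \<in> rescalings C" and sc: "scalar_curvature q \<mu> = scalar_curvature (pullback (\<bullet>) g) \<mu>"
        then obtain c g' where "c > 0" "g' \<in> stabilizer \<gamma>" "q = ?q c g'"
          unfolding resc by blast
        then show "ricci_gamma_norm2 \<gamma> (pullback (\<bullet>) g) \<mu> \<le> ricci_gamma_norm2 \<gamma> q \<mu>"
          using le [of g' c] * sc unfolding q1 [symmetric] by simp
      qed
    qed
  qed
  moreover have "minimal_metric C \<gamma> \<mu> ip \<Longrightarrow> ip \<in> C" for ip
    by (simp add: minimal_metric_def)
  ultimately show ?thesis
    unfolding C by blast
qed

section \<open>Exponential sums and convex hulls\<close>

text \<open>The mean of the points \<open>b t\<close> under the weights \<open>C t\<close> tilted by \<open>H\<close>; it is half the gradient of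
  \<open>H \<mapsto> ln (\<Sum>t\<in>I. C t * exp (2 * (b t \<bullet> H)))\<close>.\<close>

definition tilted_mean ::
    "'i set \<Rightarrow> ('i \<Rightarrow> real) \<Rightarrow> ('i \<Rightarrow> 'a::euclidean_space) \<Rightarrow> 'a \<Rightarrow> 'a" where
  "tilted_mean I C b H = (\<Sum>t\<in>I. (C t * exp (2 * (b t \<bullet> H))) *\<^sub>R b t) /\<^sub>R (\<Sum>t\<in>I. C t * exp (2 * (b t \<bullet> H)))"

definition exp_sum :: "'i set \<Rightarrow> ('i \<Rightarrow> real) \<Rightarrow> ('i \<Rightarrow> 'a::euclidean_space) \<Rightarrow> 'a \<Rightarrow> real" where
  "exp_sum I C d H = (\<Sum>t\<in>I. C t * exp (2 * (d t \<bullet> H)))"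

lemma exp_sum_pos:
  assumes "finite I" "I \<noteq> {}" "\<And>t. t \<in> I \<Longrightarrow> C t > 0"
  shows "exp_sum I C d H > 0"
  unfolding exp_sum_def using assms by (intro sum_pos) auto

lemma exp_sum_ge:
  assumes "finite I" "\<And>t. t \<in> I \<Longrightarrow> C t > 0" "t \<in> I"
  shows "C t * exp (2 * (d t \<bullet> H)) \<le> exp_sum I C d H"
  unfolding exp_sum_def using assms
  by (intro member_le_sum) (auto simp: less_imp_le)

lemma continuous_exp_sum: "continuous_on S (exp_sum I C d)"
  unfolding exp_sum_def by (intro continuous_intros)

lemma tilted_mean_diff:
  fixes b :: "'i \<Rightarrow> 'a::euclidean_space" and \<beta> :: 'a
  assumes "finite I" "I \<noteq> {}" "\<And>t. t \<in> I \<Longrightarrow> C t > 0"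
  defines "d \<equiv> \<lambda>t. b t - \<beta>"
  shows "tilted_mean I C b H - \<beta> = (\<Sum>t\<in>I. (C t * exp (2 * (d t \<bullet> H))) *\<^sub>R d t) /\<^sub>R exp_sum I C d H"
proof -
  let ?E = "exp (2 * (\<beta> \<bullet> H))"
  have e: "C t * exp (2 * (b t \<bullet> H)) = ?E * (C t * exp (2 * (d t \<bullet> H)))" for t
    by (simp add: d_def inner_diff_left right_diff_distrib exp_diff)
  have Z: "exp_sum I C d H \<noteq> 0"
    using exp_sum_pos [of I C d H] assms(1-3) by simp
  have "tilted_mean I C b H = (\<Sum>t\<in>I. (?E * (C t * exp (2 * (d t \<bullet> H)))) *\<^sub>R b t) /\<^sub>R (?E * exp_sum I C d H)"
    unfolding tilted_mean_def e exp_sum_def sum_distrib_left by simp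
  also have "\<dots> = (\<Sum>t\<in>I. (C t * exp (2 * (d t \<bullet> H))) *\<^sub>R b t) /\<^sub>R exp_sum I C d H"
  proof -
    have s: "(\<Sum>t\<in>I. (?E * (C t * exp (2 * (d t \<bullet> H)))) *\<^sub>R b t) =
        ?E *\<^sub>R (\<Sum>t\<in>I. (C t * exp (2 * (d t \<bullet> H))) *\<^sub>R b t)"
      by (simp add: scaleR_sum_right)
    have "inverse (?E * exp_sum I C d H) * ?E = inverse (exp_sum I C d H)"
      by simp
    then show ?thesis
      unfolding s scaleR_scaleR by (simp only:)
  qed
  also have "(\<Sum>t\<in>I. (C t * exp (2 * (d t \<bullet> H))) *\<^sub>R b t) =
      (\<Sum>t\<in>I. (C t * exp (2 * (d t \<bullet> H))) *\<^sub>R d t) + exp_sum I C d H *\<^sub>R \<beta>"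
    unfolding exp_sum_def scaleR_sum_left sum.distrib [symmetric]
    by (intro sum.cong refl) (simp add: d_def scaleR_diff_right)
  finally show ?thesis
    using Z by (simp add: scaleR_add_right)
qed

text \<open>Stationarity at \<open>H\<close> in the direction \<open>Y\<close>, with a quadratic penalty of weight \<open>e\<close>, which may be \<open>0\<close>.\<close>

lemma exp_sum_critical:
  fixes d :: "'i \<Rightarrow> 'a::euclidean_space"
  assumes min: "\<And>s. exp_sum I C d H + e * (H \<bullet> H) \<le> exp_sum I C d (H + s *\<^sub>R Y) + e * ((H + s *\<^sub>R Y) \<bullet> (H + s *\<^sub>R Y))"
  shows "(\<Sum>t\<in>I. (C t * exp (2 * (d t \<bullet> H))) *\<^sub>R d t) \<bullet> Y = - e * (H \<bullet> Y)"
proof -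
  let ?F = "\<lambda>s. (\<Sum>t\<in>I. C t * exp (2 * (d t \<bullet> H + s * (d t \<bullet> Y)))) + e * (H \<bullet> H + 2 * s * (H \<bullet> Y) + s * s * (Y \<bullet> Y))"
  have F: "?F s = exp_sum I C d (H + s *\<^sub>R Y) + e * ((H + s *\<^sub>R Y) \<bullet> (H + s *\<^sub>R Y))" for s
    by (simp add: exp_sum_def inner_add_left inner_add_right inner_commute [of Y H] algebra_simps)
  have "(?F has_real_derivative
      (\<Sum>t\<in>I. C t * (exp (2 * (d t \<bullet> H + 0 * (d t \<bullet> Y))) * (2 * (d t \<bullet> Y)))) + e * (2 * (H \<bullet> Y))) (at 0)"
    by (auto intro!: derivative_eq_intros sum.cong)
  then have "(\<Sum>t\<in>I. C t * (exp (2 * (d t \<bullet> H + 0 * (d t \<bullet> Y))) * (2 * (d t \<bullet> Y)))) + e * (2 * (H \<bullet> Y)) = 0"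
  proof (rule DERIV_local_min)
    show "\<forall>y. \<bar>0 - y\<bar> < 1 \<longrightarrow> ?F 0 \<le> ?F y"
      using min unfolding F by simp
  qed simp
  moreover have "(\<Sum>t\<in>I. C t * (exp (2 * (d t \<bullet> H + 0 * (d t \<bullet> Y))) * (2 * (d t \<bullet> Y)))) =
      2 * ((\<Sum>t\<in>I. (C t * exp (2 * (d t \<bullet> H))) *\<^sub>R d t) \<bullet> Y)"
    by (simp add: inner_sum_left sum_distrib_left mult_ac)
  ultimately show ?thesis
    by simp
qed

text \<open>Minimize the exponential sum of the points \<open>b t - \<beta>\<close> plus a small multiple of the square norm:
  stationarity says that the tilted mean differs from \<open>\<beta>\<close> by a small multiple of the minimizer.\<close>

lemma tilted_mean_approx:
  fixes b :: "'i \<Rightarrow> 'a::euclidean_space"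
  assumes I: "finite I" "I \<noteq> {}" and C: "\<And>t. t \<in> I \<Longrightarrow> C t > 0"
    and \<beta>: "\<beta> \<in> convex hull (b ` I)" and \<epsilon>: "\<epsilon> > 0"
  shows "\<exists>H\<in>span ((\<lambda>t. b t - \<beta>) ` I). norm (tilted_mean I C b H - \<beta>) < \<epsilon>"
proof -
  define d where "d t = b t - \<beta>" for t
  define \<psi> where "\<psi> = exp_sum I C d"
  define c0 where "c0 = Min (C ` I)"
  have c0: "c0 > 0" "\<And>t. t \<in> I \<Longrightarrow> c0 \<le> C t"
    using I C by (auto simp: c0_def)
  have S: "\<psi> 0 > 0"
    unfolding \<psi>_def by (rule exp_sum_pos [OF I C])
  \<comment> \<open>at a minimum \<open>H\<close>, \<open>e * norm H\<close> is at most \<open>sqrt (e * \<psi> 0)\<close>, and \<open>\<psi> H\<close> is at least \<open>c0\<close>\<close>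
  define e where "e = (\<epsilon> * c0 / 2)\<^sup>2 / \<psi> 0"
  have e: "e > 0"
    using S \<epsilon> c0 by (simp add: e_def)
  define R where "R = sqrt (\<psi> 0 / e)"
  have R: "R \<ge> 0" "e * R\<^sup>2 = \<psi> 0"
    using S e by (auto simp: R_def)
  have "\<exists>H\<in>cball 0 R. \<forall>Y\<in>cball 0 R. \<psi> H + e * (H \<bullet> H) \<le> \<psi> Y + e * (Y \<bullet> Y)"
    using R unfolding \<psi>_def
    by (intro continuous_attains_inf compact_cball continuous_intros continuous_exp_sum) auto
  then obtain H where "\<forall>Y\<in>cball 0 R. \<psi> H + e * (H \<bullet> H) \<le> \<psi> Y + e * (Y \<bullet> Y)"
    by blast
  then have H: "\<And>Y. norm Y \<le> R \<Longrightarrow> \<psi> H + e * (H \<bullet> H) \<le> \<psi> Y + e * (Y \<bullet> Y)"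
    by simp
  have glob: "\<psi> H + e * (H \<bullet> H) \<le> \<psi> Y + e * (Y \<bullet> Y)" for Y
  proof (cases "norm Y \<le> R")
    case False
    then have "R\<^sup>2 \<le> Y \<bullet> Y"
      using R by (simp add: power2_norm_eq_inner [symmetric] power_mono)
    then have "\<psi> 0 \<le> e * (Y \<bullet> Y)"
      using R e by (metis mult_le_cancel_left_pos)
    moreover have "\<psi> Y > 0"
      unfolding \<psi>_def by (rule exp_sum_pos [OF I C])
    moreover have "\<psi> H + e * (H \<bullet> H) \<le> \<psi> 0"
      using H [of 0] R by simp
    ultimately show ?thesis by linarith
  qed (rule H)
  let ?v = "\<Sum>t\<in>I. (C t * exp (2 * (d t \<bullet> H))) *\<^sub>R d t"
  have "?v \<bullet> Y = (- e *\<^sub>R H) \<bullet> Y" for Y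
    using exp_sum_critical [of I C d H e Y] glob [unfolded \<psi>_def] by simp
  then have v: "?v = - e *\<^sub>R H"
    using vector_eq_rdot by blast
  have Hspan: "H \<in> span (d ` I)"
  proof -
    have v1: "?v \<in> span (d ` I)"
      by (intro span_sum span_scale span_base) auto
    have "H = (- inverse e) *\<^sub>R ?v"
      using e by (simp add: v)
    then show ?thesis
      using span_scale [OF v1, of "- inverse e"] by (simp only:)
  qed
  have "\<exists>t\<in>I. 0 \<le> d t \<bullet> H"
  proof (rule ccontr)
    assume "\<not> ?thesis"
    then have "b ` I \<subseteq> {x. H \<bullet> x < H \<bullet> \<beta>}"
      by (auto simp: d_def inner_diff_right inner_commute [of _ H] not_le)
    then have "convex hull (b ` I) \<subseteq> {x. H \<bullet> x < H \<bullet> \<beta>}"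
      by (intro hull_minimal convex_halfspace_lt)
    then show False
      using \<beta> by auto
  qed
  then obtain t where t: "t \<in> I" "0 \<le> d t \<bullet> H" by blast
  have "c0 \<le> C t * exp (2 * (d t \<bullet> H))"
  proof -
    have "C t * 1 \<le> C t * exp (2 * (d t \<bullet> H))"
      using t(2) C [OF t(1)] by (intro mult_left_mono) auto
    then show ?thesis
      using c0(2) [OF t(1)] by simp
  qed
  also have "\<dots> \<le> \<psi> H"
    unfolding \<psi>_def by (rule exp_sum_ge [OF I(1) C t(1)])
  finally have \<psi>H: "c0 \<le> \<psi> H" .
  have "(norm (e *\<^sub>R H))\<^sup>2 = e * (e * (H \<bullet> H))"
    by (simp only: power2_norm_eq_inner inner_scaleR_left inner_scaleR_right)
  also have "\<dots> \<le> e * \<psi> 0"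
    using glob [of 0] \<psi>H c0(1) e by (intro mult_left_mono) auto
  also have "\<dots> = (\<epsilon> * c0 / 2)\<^sup>2"
    using S by (simp add: e_def)
  finally have "norm (e *\<^sub>R H) \<le> \<epsilon> * c0 / 2"
    by (rule power2_le_imp_le) (use \<epsilon> c0 in auto)
  then have nH: "norm (e *\<^sub>R H) < \<epsilon> * \<psi> H"
    using \<epsilon> c0(1) mult_left_mono [OF \<psi>H, of \<epsilon>] mult_pos_pos [OF \<epsilon> c0(1)] by linarith
  have "tilted_mean I C b H - \<beta> = ?v /\<^sub>R \<psi> H"
    using tilted_mean_diff [OF I C, where b = b and \<beta> = \<beta>] unfolding d_def \<psi>_def by simp
  then have "norm (tilted_mean I C b H - \<beta>) = norm (e *\<^sub>R H) / \<psi> H"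
    using \<psi>H c0(1) by (simp add: v divide_inverse mult.commute abs_mult)
  also have "\<dots> < \<epsilon>"
    using nH \<psi>H c0(1) by (simp add: divide_less_eq)
  finally show ?thesis
    using Hspan by (auto simp: d_def [abs_def])
qed

text \<open>In every nonzero direction of the span of the points \<open>b t - \<beta>\<close> one of them has a positive inner
  product, so their exponential sum is coercive on the span.  Its gradient vanishes at a minimum.\<close>

lemma tilted_mean_attained:
  fixes b :: "'i \<Rightarrow> 'a::euclidean_space"
  assumes I: "finite I" "I \<noteq> {}" and C: "\<And>t. t \<in> I \<Longrightarrow> C t > 0"
    and sep: "\<And>H. \<forall>t\<in>I. (b t - \<beta>) \<bullet> H \<le> 0 \<Longrightarrow> \<forall>t\<in>I. (b t - \<beta>) \<bullet> H = 0"
  shows "\<exists>H\<in>span ((\<lambda>t. b t - \<beta>) ` I). tilted_mean I C b H = \<beta>"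
proof -
  define d where "d t = b t - \<beta>" for t
  define L where "L = span (d ` I)"
  define \<psi> where "\<psi> = exp_sum I C d"
  define c0 where "c0 = Min (C ` I)"
  have c0: "c0 > 0" "\<And>t. t \<in> I \<Longrightarrow> c0 \<le> C t"
    using I C by (auto simp: c0_def)
  have S: "\<psi> 0 > 0"
    unfolding \<psi>_def by (rule exp_sum_pos [OF I C])
  define \<theta> where "\<theta> H = (\<Sum>t\<in>I. max 0 (d t \<bullet> H))" for H
  have L: "subspace L"
    by (simp add: L_def)
  have \<theta>0: "0 \<le> \<theta> H" for H
    unfolding \<theta>_def by (intro sum_nonneg) simp
  have \<theta>pos: "\<theta> H > 0" if "H \<in> L" "H \<noteq> 0" for H
  proof (rule ccontr)
    assume "\<not> \<theta> H > 0"
    then have "\<theta> H = 0"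
      using \<theta>0 [of H] by linarith
    then have "\<forall>t\<in>I. d t \<bullet> H \<le> 0"
      using I(1) by (auto simp: \<theta>_def sum_nonneg_eq_0_iff max_def split: if_splits)
    then have *: "\<forall>t\<in>I. d t \<bullet> H = 0"
      using sep [of H] by (simp add: d_def)
    have "orthogonal H v" if "v \<in> span (d ` I)" for v
      using that by (rule orthogonal_to_span) (use * in \<open>auto simp: orthogonal_def inner_commute\<close>)
    then have "orthogonal H H"
      using that(1) by (simp add: L_def)
    then show False
      using that(2) by (simp add: orthogonal_def)
  qed
  obtain m where m: "m > 0" "\<And>H. H \<in> L \<Longrightarrow> m * norm H \<le> \<theta> H"
  proof (cases "sphere 0 1 \<inter> L = {}")
    case True
    have "H = 0" if "H \<in> L" for H
    proof (rule ccontr)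
      assume "H \<noteq> 0"
      then have "H /\<^sub>R norm H \<in> sphere 0 1 \<inter> L"
        using that L by (simp add: subspace_scale)
      then show False using True by blast
    qed
    then show ?thesis
      using that [of 1] \<theta>0 by fastforce
  next
    case False
    have "compact (sphere 0 1 \<inter> L)"
      using L by (intro compact_Int_closed compact_sphere closed_subspace)
    moreover have "continuous_on (sphere 0 1 \<inter> L) \<theta>"
      unfolding \<theta>_def by (intro continuous_intros)
    ultimately have "\<exists>x\<in>sphere 0 1 \<inter> L. \<forall>y\<in>sphere 0 1 \<inter> L. \<theta> x \<le> \<theta> y"
      using False by (intro continuous_attains_inf)
    then obtain x where x: "x \<in> L" "norm x = 1" "\<forall>y\<in>sphere 0 1 \<inter> L. \<theta> x \<le> \<theta> y"
      by auto
    have "\<theta> x * norm H \<le> \<theta> H" if "H \<in> L" for H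
    proof (cases "H = 0")
      case False
      have "\<theta> x \<le> \<theta> (H /\<^sub>R norm H)"
        using x(3) False that L by (simp add: subspace_scale)
      also have "\<theta> (H /\<^sub>R norm H) = \<theta> H / norm H"
      proof -
        have "max 0 (d t \<bullet> (H /\<^sub>R norm H)) = max 0 (d t \<bullet> H) / norm H" for t
          by (simp add: max_def divide_inverse mult.commute zero_le_mult_iff False)
        then show ?thesis
          by (simp add: \<theta>_def sum_divide_distrib)
      qed
      finally show ?thesis
        using False by (simp add: pos_le_divide_eq)
    qed (simp add: \<theta>0)
    moreover have "\<theta> x > 0"
      using \<theta>pos [OF x(1)] x(2) by fastforce
    ultimately show ?thesis
      using that by blast
  qed
  define N where "N = real (card I)"
  have N: "N > 0"
    using I by (simp add: N_def card_gt_0_iff)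
  define R where "R = \<psi> 0 * N / (2 * c0 * m)"
  have R0: "R \<ge> 0"
    using S N c0 m by (simp add: R_def)
  have coercive: "\<psi> 0 \<le> \<psi> H" if "H \<in> L" "R \<le> norm H" for H
  proof -
    have "\<exists>t\<in>I. m * norm H / N \<le> max 0 (d t \<bullet> H)"
    proof (rule ccontr)
      assume "\<not> ?thesis"
      then have "\<theta> H < (\<Sum>t\<in>I. m * norm H / N)"
        unfolding \<theta>_def using I by (intro sum_strict_mono) auto
      also have "\<dots> = m * norm H"
        using N by (simp add: N_def)
      finally show False
        using m(2) [OF that(1)] by simp
    qed
    then obtain t where t: "t \<in> I" "m * norm H / N \<le> max 0 (d t \<bullet> H)" by blast
    have ex: "2 * max 0 x \<le> exp (2 * x)" for x :: real
      using exp_ge_add_one_self [of "2 * x"] by (cases "0 \<le> x") (linarith | simp add: max_def)+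
    have "\<psi> 0 = c0 * (2 * (m * R / N))"
      using N c0 m by (simp add: R_def field_simps)
    also have "\<dots> \<le> c0 * (2 * (m * norm H / N))"
      using that(2) N c0 m by (intro mult_left_mono divide_right_mono) auto
    also have "\<dots> \<le> c0 * exp (2 * (d t \<bullet> H))"
      using t(2) ex [of "d t \<bullet> H"] c0 by (intro mult_left_mono) auto
    also have "\<dots> \<le> C t * exp (2 * (d t \<bullet> H))"
      using c0 t(1) by (intro mult_right_mono) auto
    also have "\<dots> \<le> \<psi> H"
      unfolding \<psi>_def by (rule exp_sum_ge [OF I(1) C t(1)])
    finally show ?thesis .
  qed
  have "\<exists>H\<in>cball 0 R \<inter> L. \<forall>Y\<in>cball 0 R \<inter> L. \<psi> H \<le> \<psi> Y"
  proof (intro continuous_attains_inf)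
    show "compact (cball 0 R \<inter> L)"
      using L by (intro compact_Int_closed compact_cball closed_subspace)
    have "0 \<in> cball 0 R \<inter> L"
      using R0 L by (simp add: subspace_0)
    then show "cball 0 R \<inter> L \<noteq> {}" by blast
  qed (simp add: \<psi>_def continuous_exp_sum)
  then obtain H where H: "H \<in> L" "\<And>Y. Y \<in> L \<Longrightarrow> norm Y \<le> R \<Longrightarrow> \<psi> H \<le> \<psi> Y"
    by auto
  have glob: "\<psi> H \<le> \<psi> Y" if "Y \<in> L" for Y
  proof (cases "norm Y \<le> R")
    case False
    then show ?thesis
      using coercive [OF that] H(2) [of 0] R0 subspace_0 [OF L] by simp
  qed (use H that in blast)
  let ?v = "\<Sum>t\<in>I. (C t * exp (2 * (d t \<bullet> H))) *\<^sub>R d t"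
  have vL: "?v \<in> L"
    unfolding L_def by (intro span_sum span_scale span_base) auto
  have "?v \<bullet> ?v = 0"
    using exp_sum_critical [of I C d H 0 ?v] glob [unfolded \<psi>_def] H(1) vL L
    by (simp add: subspace_add subspace_scale)
  then have "?v = 0" by simp
  then have "tilted_mean I C b H - \<beta> = 0"
    using tilted_mean_diff [OF I C, where b = b and \<beta> = \<beta>] unfolding d_def by simp
  then show ?thesis
    using H(1) by (auto simp: L_def d_def [abs_def])
qed

text \<open>Outside the relative interior of the hull \<open>\<beta>\<close> would have a supporting hyperplane that does not contain
  the hull.  Inside, the segment from the barycenter of \<open>S\<close> to \<open>\<beta>\<close> can be prolonged beyond \<open>\<beta>\<close>.\<close>

lemma positive_combination:
  fixes S :: "'a::euclidean_space set"
  assumes S: "finite S" and \<beta>: "\<beta> \<in> convex hull S"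
    and sep: "\<And>H. \<forall>p\<in>S. 0 \<le> (p - \<beta>) \<bullet> H \<Longrightarrow> \<forall>p\<in>S. (p - \<beta>) \<bullet> H = 0"
  shows "\<exists>x. (\<forall>p\<in>S. x p > 0) \<and> (\<Sum>p\<in>S. x p) = 1 \<and> (\<Sum>p\<in>S. x p *\<^sub>R p) = \<beta>"
proof -
  let ?K = "convex hull S"
  have ne: "S \<noteq> {}"
    using \<beta> by auto
  have "\<beta> \<in> rel_interior ?K"
  proof (rule ccontr)
    assume nri: "\<beta> \<notin> rel_interior ?K"
    have cl: "\<beta> \<in> closure ?K"
      using \<beta> closure_subset by blast
    obtain a where a: "a \<noteq> 0" "\<And>y. y \<in> closure ?K \<Longrightarrow> a \<bullet> \<beta> \<le> a \<bullet> y"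
      "\<And>y. y \<in> rel_interior ?K \<Longrightarrow> a \<bullet> \<beta> < a \<bullet> y"
      using supporting_hyperplane_relative_frontier [OF convex_convex_hull cl nri] by metis
    have "\<forall>p\<in>S. 0 \<le> (p - \<beta>) \<bullet> a"
    proof
      fix p assume "p \<in> S"
      then have "p \<in> closure ?K"
        by (intro subsetD [OF closure_subset] hull_inc)
      then show "0 \<le> (p - \<beta>) \<bullet> a"
        using a(2) [of p] by (simp add: inner_diff_right inner_commute [of _ a])
    qed
    then have "\<forall>p\<in>S. (p - \<beta>) \<bullet> a = 0"
      by (rule sep)
    then have "S \<subseteq> {y. a \<bullet> y = a \<bullet> \<beta>}"
      by (auto simp: inner_diff_right inner_commute [of _ a])
    then have "?K \<subseteq> {y. a \<bullet> y = a \<bullet> \<beta>}"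
      by (intro hull_minimal convex_hyperplane)
    moreover obtain y where "y \<in> rel_interior ?K"
      using rel_interior_eq_empty [of ?K] ne by auto
    ultimately show False
      using a(3) [of y] rel_interior_subset [of ?K] by auto
  qed
  moreover define N where "N = real (card S)"
  have N: "N > 0"
    using S ne by (simp add: N_def card_gt_0_iff)
  define c where "c = (\<Sum>p\<in>S. (1 / N) *\<^sub>R p)"
  have "c \<in> ?K"
    unfolding c_def convex_hull_finite [OF S] using N by (auto simp: N_def intro!: exI [of _ "\<lambda>_. 1 / N"])
  ultimately obtain e where e: "e > 1" "(1 - e) *\<^sub>R c + e *\<^sub>R \<beta> \<in> ?K"
    using convex_rel_interior_iff [of ?K \<beta>] ne by auto
  obtain u where u: "\<forall>p\<in>S. 0 \<le> u p" "sum u S = 1" "(\<Sum>p\<in>S. u p *\<^sub>R p) = (1 - e) *\<^sub>R c + e *\<^sub>R \<beta>"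
    using e(2) unfolding convex_hull_finite [OF S] by auto
  define x where "x p = (u p + (e - 1) / N) / e" for p
  have "x p > 0" if "p \<in> S" for p
    using u(1) that e(1) N by (auto simp: x_def intro!: divide_pos_pos add_nonneg_pos)
  moreover have "(\<Sum>p\<in>S. x p) = 1"
    using u(2) e(1) N by (simp add: x_def sum.distrib N_def flip: sum_divide_distrib)
  moreover have "(\<Sum>p\<in>S. x p *\<^sub>R p) = \<beta>"
  proof -
    have "e *\<^sub>R (\<Sum>p\<in>S. x p *\<^sub>R p) = (\<Sum>p\<in>S. u p *\<^sub>R p) + (e - 1) *\<^sub>R c"
      unfolding c_def scaleR_sum_right sum.distrib [symmetric]
      using e(1) by (intro sum.cong refl) (simp add: x_def scaleR_add_left)
    also have "\<dots> = e *\<^sub>R \<beta>"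
      by (simp add: u(3) algebra_simps)
    finally show ?thesis
      using e(1) by simp
  qed
  ultimately show ?thesis
    by blast
qed

section \<open>The moment along the orbit of a nice bracket\<close>

lemma inner_orthogonal_conj:
  fixes X Y k :: "'n::finite mat"
  assumes "orthogonal_matrix k"
  shows "(k ** X ** transpose k) \<bullet> (k ** Y ** transpose k) = X \<bullet> Y"
proof -
  note kk = orthogonal_transpose_mult [OF assms]
  have "(k ** X ** transpose k) ** transpose (k ** Y ** transpose k) =
      k ** X ** (transpose k ** k) ** transpose Y ** transpose k"
    by (simp add: matrix_transpose_mul matrix_mul_assoc)
  also have "\<dots> = k ** (X ** transpose Y ** transpose k)"
    by (simp add: kk matrix_mul_assoc)
  finally have "mat_inner (k ** X ** transpose k) (k ** Y ** transpose k) = trace (k ** (X ** transpose Y ** transpose k))"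
    by (simp add: mat_inner_def)
  also have "\<dots> = trace (X ** transpose Y ** (transpose k ** k))"
    using trace_mul_sym [of k "X ** transpose Y ** transpose k"] by (simp add: matrix_mul_assoc)
  finally show ?thesis
    by (simp add: kk mat_inner_eq_inner flip: mat_inner_def)
qed

text \<open>A triangular shape for the key \<open>u + e z\<close> is then also one for the key \<open>u\<close>.\<close>

lemma exists_refining_perturbation:
  fixes u z :: "'n::finite \<Rightarrow> real"
  shows "\<exists>e>0. \<forall>i j. u i < u j \<longrightarrow> u i + e * z i < u j + e * z j"
proof -
  have "eventually (\<lambda>e. u i < u j \<longrightarrow> u i + e * z i < u j + e * z j) (at_right 0)" for i j
  proof (cases "u i < u j")
    case True
    have "((\<lambda>e. (u j + e * z j) - (u i + e * z i)) \<longlongrightarrow> (u j + 0 * z j) - (u i + 0 * z i)) (at_right 0)"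
      by (intro tendsto_intros)
    then have "eventually (\<lambda>e. 0 < (u j + e * z j) - (u i + e * z i)) (at_right 0)"
      using True by (intro order_tendstoD) auto
    then show ?thesis
      by (rule eventually_mono) simp
  qed simp
  then have "eventually (\<lambda>e. \<forall>i j. u i < u j \<longrightarrow> u i + e * z i < u j + e * z j) (at_right 0)"
    by (intro eventually_all_finite)
  moreover have "eventually (\<lambda>e::real. 0 < e) (at_right 0)"
    by (rule eventually_at_right_less)
  ultimately have "eventually (\<lambda>e. 0 < e \<and> (\<forall>i j. u i < u j \<longrightarrow> u i + e * z i < u j + e * z j)) (at_right (0::real))"
    by (rule eventually_conj [rotated])
  then show ?thesis
    by (intro eventually_happens' [OF trivial_limit_at_right_real])
qed

locale nice_bracket =
  fixes \<gamma> :: "'n::finite tensor set" and W :: "'n bracket set" and \<mu> :: "'n bracket"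
  assumes tensors: "\<forall>T\<in>\<gamma>. is_tensor T"
    and self_adjoint: "self_adjoint_group (stabilizer \<gamma>)"
    and nice: "nice_space \<gamma> W"
    and \<mu>W: "\<mu> \<in> W" and \<mu>0: "\<mu> \<noteq> (\<lambda>X Y. 0)"
begin

text \<open>Different index triples may have the same projected weight, so the sums below run over triples.\<close>

definition nonzero_triples :: "('n \<times> 'n \<times> 'n) set" where
  "nonzero_triples = {(i, j, k). \<mu> (axis i 1) (axis j 1) $ k \<noteq> 0}"

definition coef :: "'n \<times> 'n \<times> 'n \<Rightarrow> real" where
  "coef = (\<lambda>(i, j, k). (\<mu> (axis i 1) (axis j 1) $ k)\<^sup>2)"

definition weight :: "'n \<times> 'n \<times> 'n \<Rightarrow> 'n mat" where
  "weight = (\<lambda>(i, j, k). orth_proj (\<bullet>) (a_gamma \<gamma>) (diag_unit k - diag_unit i - diag_unit j))"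

abbreviation moment :: "'n mat \<Rightarrow> 'n mat" where
  "moment g \<equiv> gl_moment \<gamma> (bracket_act g \<mu>)"

lemma skew: "\<mu> \<in> skew_bilinear"
  using nice \<mu>W by (auto simp: nice_space_def bracket_subspace_def)

lemma sub_a: "subspace (a_gamma \<gamma>)"
  by (rule subspace_a_gamma [OF tensors])

lemma a_diag: "Z \<in> a_gamma \<gamma> \<Longrightarrow> Z = diag_mat (\<lambda>i. Z $ i $ i)"
  by (intro diagonal_eq_diag_mat) (simp add: a_gamma_def)

lemma a_gl: "Z \<in> a_gamma \<gamma> \<Longrightarrow> Z \<in> gl_gamma \<gamma>"
  by (simp add: a_gamma_def p_gamma_def)

lemma weight_a: "weight t \<in> a_gamma \<gamma>"
  using orth_proj_props(1) [OF sub_a] by (auto simp: weight_def split: prod.split)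

lemma weight_inner:
  assumes "Z \<in> a_gamma \<gamma>"
  shows "weight (i, j, k) \<bullet> Z = Z $ k $ k - Z $ i $ i - Z $ j $ j"
proof -
  have u: "diag_unit k \<bullet> Z = Z $ k $ k" for k
  proof -
    have "diag_unit k \<bullet> Z = (\<Sum>i\<in>UNIV. \<Sum>j\<in>UNIV. if i = k \<and> j = k then Z $ i $ j else 0)"
      unfolding inner_vec_def diag_unit_def by (intro sum.cong refl) auto
    also have "\<dots> = (\<Sum>i\<in>UNIV. if i = k then Z $ i $ k else 0)"
      by (intro sum.cong refl) auto
    finally show ?thesis by simp
  qed
  show ?thesis
    using orth_proj_props(2) [OF sub_a assms, of "diag_unit k - diag_unit i - diag_unit j"]
    by (simp add: weight_def inner_diff_left u)
qed

lemma finite_nonzero_triples: "finite nonzero_triples"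
  by (rule finite_subset [OF subset_UNIV]) simp

lemma nonzero_triples_nonempty: "nonzero_triples \<noteq> {}"
proof
  assume "nonzero_triples = {}"
  then have "\<mu> (axis i 1) (axis j 1) = 0" for i j
    by (auto simp: nonzero_triples_def vec_eq_iff)
  then have "\<mu> = (\<lambda>X Y. 0)"
    by (intro skew_bilinear_eqI skew_bilinearD(1) [OF skew] bilinear_zero)
  then show False
    using \<mu>0 by blast
qed

lemma coef_pos: "t \<in> nonzero_triples \<Longrightarrow> coef t > 0"
  by (auto simp: nonzero_triples_def coef_def)

lemma weights_gamma_eq: "weights_gamma \<gamma> \<mu> = weight ` nonzero_triples"
proof -
  have "\<mu> (axis i 1) (axis i 1) $ k = 0" for i k
    using arg_cong [OF skew_bilinearD(2) [OF skew, of "axis i 1" "axis i 1"], of "\<lambda>v. v $ k"] by simp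
  then have "weights \<mu> = (\<lambda>(i, j, k). diag_unit k - diag_unit i - diag_unit j) ` nonzero_triples"
    unfolding weights_def nonzero_triples_def by (fastforce simp: inner_axis image_iff)
  then show ?thesis
    unfolding weights_gamma_def weight_def mat_inner_eq_inner by (force simp: image_iff)
qed

lemma sum_nonzero_triples:
  "(\<Sum>i\<in>UNIV. \<Sum>j\<in>UNIV. \<Sum>k\<in>UNIV. F (i, j, k) * (\<mu> (axis i 1) (axis j 1) $ k)\<^sup>2) = (\<Sum>t\<in>nonzero_triples. F t * coef t)"
proof -
  have "(\<Sum>i\<in>UNIV. \<Sum>j\<in>UNIV. \<Sum>k\<in>UNIV. F (i, j, k) * (\<mu> (axis i 1) (axis j 1) $ k)\<^sup>2) = (\<Sum>t\<in>UNIV. F t * coef t)"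
    by (simp add: coef_def sum.cartesian_product split_def)
  also have "\<dots> = (\<Sum>t\<in>nonzero_triples. F t * coef t)"
    by (rule sum.mono_neutral_right) (auto simp: nonzero_triples_def coef_def)
  finally show ?thesis .
qed

text \<open>On the orbit of the diagonal group niceness makes the moment diagonal.  It is therefore determined
  by its pairings with \<open>a_gamma \<gamma>\<close>, into which only the squared coordinates of the bracket enter.\<close>

lemma moment_exp:
  assumes H: "H \<in> a_gamma \<gamma>"
  shows "mat_exp H \<in> stabilizer \<gamma>" "moment (mat_exp H) = tilted_mean nonzero_triples coef weight H"
    "moment (mat_exp H) \<in> a_gamma \<gamma>"
proof -
  show G: "mat_exp H \<in> stabilizer \<gamma>"
  proof -
    have "mat_exp (1 *\<^sub>R H) \<in> stabilizer \<gamma>"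
      using a_gl [OF H] unfolding gl_gamma_def lie_algebra_of_def by blast
    then show ?thesis by simp
  qed
  define h where "h i = H $ i $ i" for i
  have Hh: "H = diag_mat h"
    using a_diag [OF H] by (simp add: h_def [abs_def])
  have E: "mat_exp H = diag_mat (\<lambda>i. exp (h i))"
    unfolding Hh by (rule mat_exp_diag)
  have inv: "mat_exp H ** diag_mat (\<lambda>i. exp (- h i)) = mat 1"
    by (simp add: E diag_mat_mult diag_mat_1 flip: exp_add)
  define w where "w = bracket_act (mat_exp H) \<mu>"
  have wW: "w \<in> W"
    using nice H \<mu>W by (auto simp: nice_space_def A_gamma_def w_def)
  have w0: "w \<noteq> (\<lambda>X Y. 0)"
    unfolding w_def by (rule bracket_act_nonzero [OF inv \<mu>0])
  have wsk: "w \<in> skew_bilinear"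
    unfolding w_def by (rule bracket_act_skew [OF inv skew])
  have wpos: "bracket_inner w w > 0"
    by (rule bracket_inner_pos [OF wsk w0])
  have "moment_map \<gamma> w \<in> a_gamma \<gamma>"
    using nice wW w0 by (auto simp: nice_space_def)
  then show Pa: "moment (mat_exp H) \<in> a_gamma \<gamma>"
    by (simp add: gl_moment_eq_moment_map [OF tensors self_adjoint wsk] flip: w_def)
  have coord: "w (axis i 1) (axis j 1) $ k = exp (h k - h i - h j) * \<mu> (axis i 1) (axis j 1) $ k" for i j k
  proof -
    have "diag_mat (\<lambda>i. exp (- h i)) *v axis i 1 = exp (- h i) *\<^sub>R axis i 1" for i
      by (simp add: vec_eq_iff axis_def)
    then show ?thesis
      unfolding w_def bracket_act_eq [OF inv] unfolding E
      by (simp add: bilinear_lmul [OF skew_bilinearD(1) [OF skew]] bilinear_rmul [OF skew_bilinearD(1) [OF skew]]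
          mult.assoc [symmetric] flip: exp_add)
  qed
  have sq: "(w (axis i 1) (axis j 1) $ k)\<^sup>2 = exp (2 * (weight (i, j, k) \<bullet> H)) * (\<mu> (axis i 1) (axis j 1) $ k)\<^sup>2" for i j k
    unfolding coord power_mult_distrib exp_double weight_inner [OF H] by (simp add: h_def)
  have Z: "bracket_inner w w = (\<Sum>t\<in>nonzero_triples. coef t * exp (2 * (weight t \<bullet> H)))"
    unfolding bracket_inner_coords sq using sum_nonzero_triples [of "\<lambda>t. exp (2 * (weight t \<bullet> H))"]
    by (simp add: mult.commute)
  have PY: "moment (mat_exp H) \<bullet> Y = tilted_mean nonzero_triples coef weight H \<bullet> Y" if Y: "Y \<in> a_gamma \<gamma>" for Y
  proof -
    have "moment_mat w \<bullet> Y = (\<Sum>i\<in>UNIV. \<Sum>j\<in>UNIV. \<Sum>k\<in>UNIV.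
        ((weight (i, j, k) \<bullet> Y) * exp (2 * (weight (i, j, k) \<bullet> H))) * (\<mu> (axis i 1) (axis j 1) $ k)\<^sup>2)"
      using moment_mat_diag [OF wsk, of "\<lambda>i. Y $ i $ i"]
      unfolding a_diag [OF Y, symmetric] weight_inner [OF Y, symmetric] sq by (simp add: mult.assoc)
    also have "\<dots> = (\<Sum>t\<in>nonzero_triples. (weight t \<bullet> Y) * exp (2 * (weight t \<bullet> H)) * coef t)"
      by (rule sum_nonzero_triples)
    also have "\<dots> = (\<Sum>t\<in>nonzero_triples. (coef t * exp (2 * (weight t \<bullet> H))) *\<^sub>R weight t) \<bullet> Y"
      by (simp add: inner_sum_left mult_ac)
    finally show ?thesis
      using gl_moment_props(2) [OF tensors a_gl [OF Y], of w]
      by (simp add: tilted_mean_def Z divide_inverse mult.commute flip: w_def)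
  qed
  have Ta: "tilted_mean nonzero_triples coef weight H \<in> a_gamma \<gamma>"
    unfolding tilted_mean_def by (intro subspace_scale subspace_sum sub_a weight_a)
  have "moment (mat_exp H) - tilted_mean nonzero_triples coef weight H \<in> a_gamma \<gamma>"
    by (intro subspace_diff sub_a Pa Ta)
  from PY [OF this] have "(moment (mat_exp H) - tilted_mean nonzero_triples coef weight H) \<bullet>
      (moment (mat_exp H) - tilted_mean nonzero_triples coef weight H) = 0"
    by (simp add: inner_diff_left)
  then show "moment (mat_exp H) = tilted_mean nonzero_triples coef weight H"
    by simp
qed

lemma moment_one_diagonal: "gl_moment \<gamma> \<mu> \<in> a_gamma \<gamma>"
  using moment_exp(3) [OF subspace_0 [OF sub_a]] by simp

text \<open>The action of a triangular matrix can only raise the \<open>Z\<close>-weights, and the orthogonal factor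
  merely conjugates the moment.\<close>

lemma moment_flag_estimate:
  assumes Z: "Z \<in> a_gamma \<gamma>" and k: "orthogonal_matrix k" and g: "g \<in> stabilizer \<gamma>" and gkq: "g = k ** q"
    and qr: "q ** r = mat 1"
    and tri: "\<And>i j. q $ i $ j \<noteq> 0 \<Longrightarrow> Z $ j $ j \<le> Z $ i $ i"
      "\<And>i j. r $ i $ j \<noteq> 0 \<Longrightarrow> Z $ j $ j \<le> Z $ i $ i"
    and l: "\<And>t. t \<in> nonzero_triples \<Longrightarrow> l \<le> weight t \<bullet> Z"
  shows "k ** Z ** transpose k \<in> gl_gamma \<gamma>"
    and "l \<le> moment g \<bullet> (k ** Z ** transpose k)"
    and "moment g \<bullet> (k ** Z ** transpose k) = l \<Longrightarrow>
      bracket_der Z (bracket_act q \<mu>) = (\<lambda>X Y. l *\<^sub>R bracket_act q \<mu> X Y)"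
proof -
  note kk = orthogonal_transpose_mult [OF k]
  show X: "k ** Z ** transpose k \<in> gl_gamma \<gamma>"
    by (rule gl_gamma_flag_conj [OF tensors self_adjoint Z g k gkq qr tri])
  define u where "u = bracket_act q \<mu>"
  have usk: "u \<in> skew_bilinear"
    unfolding u_def by (rule bracket_act_skew [OF qr skew])
  have upos: "bracket_inner u u > 0"
    unfolding u_def by (intro bracket_inner_pos bracket_act_skew [OF qr skew] bracket_act_nonzero [OF qr \<mu>0])
  have gu: "bracket_act g \<mu> = bracket_act k u"
    unfolding gkq u_def by (rule bracket_act_mult [OF kk(2) qr])
  have Zd: "diag_mat (\<lambda>i. Z $ i $ i) = Z"
    using a_diag [OF Z] by simp
  have wl: "l \<le> Z $ k $ k - Z $ i $ i - Z $ j $ j" if "u (axis i 1) (axis j 1) $ k \<noteq> 0" for i j k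
  proof (rule bracket_act_weights_ge [OF qr skew_bilinearD(1) [OF skew] tri])
    show "l \<le> Z $ c $ c - Z $ a $ a - Z $ b $ b" if "\<mu> (axis a 1) (axis b 1) $ c \<noteq> 0" for a b c
      using l [of "(a, b, c)"] that by (simp add: nonzero_triples_def weight_inner [OF Z])
  qed (use that in \<open>auto simp: u_def\<close>)
  have m: "moment g \<bullet> (k ** Z ** transpose k) = (moment_mat u \<bullet> Z) / bracket_inner u u"
    using gl_moment_props(2) [OF tensors X] bracket_inner_orthogonal [OF k skew_bilinearD(1) [OF usk] skew_bilinearD(1) [OF usk]]
    by (simp add: gu moment_mat_orthogonal [OF k usk])
  show "l \<le> moment g \<bullet> (k ** Z ** transpose k)"
    using moment_mat_weights_ge(1) [of u l "\<lambda>i. Z $ i $ i", OF usk wl] upos unfolding m Zd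
    by (simp add: pos_le_divide_eq)
  assume "moment g \<bullet> (k ** Z ** transpose k) = l"
  then have eq: "moment_mat u \<bullet> diag_mat (\<lambda>i. Z $ i $ i) = l * bracket_inner u u"
    using upos unfolding m Zd by (simp add: field_simps)
  have "bracket_der (diag_mat (\<lambda>i. Z $ i $ i)) u = (\<lambda>X Y. l *\<^sub>R u X Y)"
    by (intro bracket_der_eigen skew_bilinearD(1) [OF usk])
      (rule moment_mat_weights_ge(2) [OF usk wl eq])
  then show "bracket_der Z (bracket_act q \<mu>) = (\<lambda>X Y. l *\<^sub>R bracket_act q \<mu> X Y)"
    by (simp add: Zd u_def)
qed

lemma stabilizer_flag_qr:
  assumes "g \<in> stabilizer \<gamma>"
  obtains k q r where "orthogonal_matrix k" "g = k ** q" "q ** r = mat 1" "r ** q = mat 1"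
    "\<And>i j. q $ i $ j \<noteq> 0 \<Longrightarrow> z j \<le> (z i :: real)" "\<And>i j. r $ i $ j \<noteq> 0 \<Longrightarrow> z j \<le> z i"
proof -
  have "invertible g"
    using assms by (simp add: stabilizer_def)
  from flag_qr [OF this, of "\<lambda>i. - z i"] obtain k q r where kqr: "orthogonal_matrix k" "g = k ** q" "q ** r = mat 1" "r ** q = mat 1"
    "\<And>i j. q $ i $ j \<noteq> 0 \<Longrightarrow> - z i \<le> - z j" "\<And>i j. r $ i $ j \<noteq> 0 \<Longrightarrow> - z i \<le> - z j"
    by metis
  show ?thesis
    by (rule that [OF kqr(1-4)]) (use kqr(5,6) in auto)
qed

text \<open>Pair the moment with \<open>k \<beta> k\<^sup>T\<close>, which has the norm of \<open>\<beta>\<close>.\<close>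

lemma norm_moment_ge:
  assumes \<beta>: "\<beta> \<in> a_gamma \<gamma>" and l: "\<And>t. t \<in> nonzero_triples \<Longrightarrow> \<beta> \<bullet> \<beta> \<le> weight t \<bullet> \<beta>" and g: "g \<in> stabilizer \<gamma>"
  shows "norm \<beta> \<le> norm (moment g)"
proof -
  obtain k q r where kqr: "orthogonal_matrix k" "g = k ** q" "q ** r = mat 1" "r ** q = mat 1"
    "\<And>i j. q $ i $ j \<noteq> 0 \<Longrightarrow> \<beta> $ j $ j \<le> \<beta> $ i $ i" "\<And>i j. r $ i $ j \<noteq> 0 \<Longrightarrow> \<beta> $ j $ j \<le> \<beta> $ i $ i"
    by (rule stabilizer_flag_qr [OF g, of "\<lambda>i. \<beta> $ i $ i"]) (rule that; assumption)
  let ?X = "k ** \<beta> ** transpose k"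
  have nX: "norm ?X = norm \<beta>"
    by (simp add: norm_eq_sqrt_inner inner_orthogonal_conj [OF kqr(1)])
  have "norm \<beta> * norm \<beta> = \<beta> \<bullet> \<beta>"
    by (simp add: norm_eq_sqrt_inner)
  also have "\<dots> \<le> moment g \<bullet> ?X"
    by (rule moment_flag_estimate(2) [OF \<beta> kqr(1) g kqr(2,3,5,6) l])
  also have "\<dots> \<le> norm (moment g) * norm \<beta>"
    using norm_cauchy_schwarz [of "moment g" ?X] by (simp add: nX)
  finally show ?thesis
    by (cases "\<beta> = 0") (simp_all add: mult_le_cancel_right)
qed

text \<open>If the lower bound is attained at \<open>g = k q\<close>, then the moment is \<open>k \<beta> k\<^sup>T\<close>, and the estimate is
  an equality for every small perturbation \<open>Z'\<close> of \<open>\<beta>\<close> in a direction \<open>Z\<close> that weakly separates \<open>\<beta>\<close> from the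
  weights.  Hence \<open>q \<cdot> \<mu>\<close> is an eigenvector of \<open>Z'\<close>, so \<open>\<mu>\<close> is one of \<open>q\<^sup>-\<^sup>1 Z' q\<close>, which lies in the Lie
  algebra and has the same diagonal as \<open>Z'\<close>.  The moment of \<open>\<mu>\<close> itself is diagonal and does not see
  the difference, so all weights of \<open>\<mu>\<close> take the same value on \<open>Z'\<close>.\<close>

lemma moment_minimum_rigid:
  assumes \<beta>: "\<beta> \<in> a_gamma \<gamma>" and l: "\<And>t. t \<in> nonzero_triples \<Longrightarrow> \<beta> \<bullet> \<beta> \<le> weight t \<bullet> \<beta>" and g: "g \<in> stabilizer \<gamma>"
    and le: "norm (moment g) \<le> norm \<beta>"
    and Z: "Z \<in> a_gamma \<gamma>" and lZ: "\<And>t. t \<in> nonzero_triples \<Longrightarrow> \<beta> \<bullet> Z \<le> weight t \<bullet> Z"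
    and t: "t \<in> nonzero_triples"
  shows "weight t \<bullet> \<beta> = \<beta> \<bullet> \<beta>" "weight t \<bullet> Z = \<beta> \<bullet> Z"
proof -
  obtain e where e: "e > 0" and ref: "\<And>i j. \<beta> $ i $ i < \<beta> $ j $ j \<Longrightarrow>
      \<beta> $ i $ i + e * Z $ i $ i < \<beta> $ j $ j + e * Z $ j $ j"
    using exists_refining_perturbation [of "\<lambda>i. \<beta> $ i $ i" "\<lambda>i. Z $ i $ i"] by auto
  define Z' where "Z' = \<beta> + e *\<^sub>R Z"
  have Z'a: "Z' \<in> a_gamma \<gamma>"
    unfolding Z'_def by (intro subspace_add subspace_scale sub_a \<beta> Z)
  obtain k q r where k: "orthogonal_matrix k" and gkq: "g = k ** q" and qr: "q ** r = mat 1" "r ** q = mat 1"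
    and triZ: "\<And>i j. q $ i $ j \<noteq> 0 \<Longrightarrow> Z' $ j $ j \<le> Z' $ i $ i" "\<And>i j. r $ i $ j \<noteq> 0 \<Longrightarrow> Z' $ j $ j \<le> Z' $ i $ i"
    by (rule stabilizer_flag_qr [OF g, of "\<lambda>i. Z' $ i $ i"]) (rule that; assumption)
  note kk = orthogonal_transpose_mult [OF k]
  have refine: "\<beta> $ j $ j \<le> \<beta> $ i $ i" if "Z' $ j $ j \<le> Z' $ i $ i" for i j
    using that ref [of i j] by (force simp: Z'_def)
  have tri\<beta>: "\<And>i j. q $ i $ j \<noteq> 0 \<Longrightarrow> \<beta> $ j $ j \<le> \<beta> $ i $ i" "\<And>i j. r $ i $ j \<noteq> 0 \<Longrightarrow> \<beta> $ j $ j \<le> \<beta> $ i $ i"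
    using triZ refine by blast+
  let ?X = "k ** \<beta> ** transpose k"
  have XX: "?X \<bullet> ?X = \<beta> \<bullet> \<beta>"
    by (rule inner_orthogonal_conj [OF k])
  have ge: "\<beta> \<bullet> \<beta> \<le> moment g \<bullet> ?X"
    by (rule moment_flag_estimate(2) [OF \<beta> k g gkq qr(1) tri\<beta> l])
  have mm: "moment g \<bullet> moment g \<le> \<beta> \<bullet> \<beta>"
    using le by (simp add: norm_le)
  have "(moment g - ?X) \<bullet> (moment g - ?X) = moment g \<bullet> moment g - 2 * (moment g \<bullet> ?X) + ?X \<bullet> ?X"
    by (simp add: inner_diff_left inner_diff_right inner_commute [of ?X "moment g"])
  then have "(moment g - ?X) \<bullet> (moment g - ?X) = 0"
    using ge mm XX inner_ge_zero [of "moment g - ?X"] by linarith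
  then have mX: "moment g = ?X"
    by simp
  define l' where "l' = \<beta> \<bullet> Z'"
  have l': "l' \<le> weight s \<bullet> Z'" if "s \<in> nonzero_triples" for s
    unfolding l'_def Z'_def inner_add_right inner_scaleR_right
    using e by (intro add_mono mult_left_mono l [OF that] lZ [OF that]) simp
  have "moment g \<bullet> (k ** Z' ** transpose k) = l'"
    unfolding mX l'_def by (rule inner_orthogonal_conj [OF k])
  then have eig: "bracket_der Z' (bracket_act q \<mu>) = (\<lambda>X Y. l' *\<^sub>R bracket_act q \<mu> X Y)"
    using moment_flag_estimate(3) [OF Z'a k g gkq qr(1) triZ l'] by blast
  define S where "S = r ** Z' ** q"
  have ginv: "g ** (r ** transpose k) = mat 1" "(r ** transpose k) ** g = mat 1"
  proof -
    have "g ** (r ** transpose k) = k ** (q ** r) ** transpose k"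
      by (simp only: gkq matrix_mul_assoc)
    then show "g ** (r ** transpose k) = mat 1"
      by (simp add: qr kk)
    then show "(r ** transpose k) ** g = mat 1"
      by (simp add: matrix_left_right_inverse)
  qed
  have SG: "S \<in> gl_gamma \<gamma>"
  proof -
    have "(r ** transpose k) ** (k ** Z' ** transpose k) ** g \<in> gl_gamma \<gamma>"
      by (rule gl_gamma_conj [OF moment_flag_estimate(1) [OF Z'a k g gkq qr(1) triZ l']
            stabilizer_inv [OF g ginv(1)] ginv(2)])
    moreover have "(r ** transpose k) ** (k ** Z' ** transpose k) ** g =
        r ** (transpose k ** k) ** Z' ** (transpose k ** k) ** q"
      by (simp only: gkq matrix_mul_assoc)
    ultimately show ?thesis
      by (simp add: kk S_def)
  qed
  have rq\<mu>: "bracket_act r (bracket_act q \<mu>) = \<mu>"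
    using bracket_act_mult [OF qr(2) qr(1), of \<mu>] qr(2) by simp
  have "bracket_der S \<mu> = bracket_act r (bracket_der Z' (bracket_act q \<mu>))"
    using bracket_der_act [OF qr(2), of Z' "bracket_act q \<mu>"] by (simp add: rq\<mu> S_def)
  also have "\<dots> = (\<lambda>X Y. l' *\<^sub>R bracket_act r (bracket_act q \<mu>) X Y)"
    unfolding eig by (simp add: bracket_act_def [of r] matrix_vector_mult_scaleR)
  also have "\<dots> = (\<lambda>X Y. l' *\<^sub>R \<mu> X Y)"
    by (simp add: rq\<mu>)
  finally have "moment_mat \<mu> \<bullet> S = l' * bracket_inner \<mu> \<mu>"
    unfolding bracket_der_moment [OF skew, symmetric]
    by (simp add: bracket_inner_alt sum_distrib_left)
  moreover have "moment_mat \<mu> \<bullet> (S - Z') = 0"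
  proof -
    have dS: "S $ i $ i = Z' $ i $ i" for i
    proof -
      have "S = r ** (diag_mat (\<lambda>i. Z' $ i $ i) ** q)"
        using a_diag [OF Z'a] by (simp add: S_def matrix_mul_assoc)
      then have "S $ i $ i = (\<Sum>j\<in>UNIV. r $ i $ j * (Z' $ j $ j * q $ j $ i))"
        by (simp add: mat_mult_nth [of r])
      also have "\<dots> = (\<Sum>j\<in>UNIV. Z' $ i $ i * (r $ i $ j * q $ j $ i))"
      proof (rule sum.cong [OF refl])
        fix j
        show "r $ i $ j * (Z' $ j $ j * q $ j $ i) = Z' $ i $ i * (r $ i $ j * q $ j $ i)"
          using triZ(2) [of i j] triZ(1) [of j i]
          by (cases "r $ i $ j = 0 \<or> q $ j $ i = 0") auto
      qed
      also have "\<dots> = Z' $ i $ i * (r ** q) $ i $ i"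
        by (simp add: mat_mult_nth sum_distrib_left)
      finally show ?thesis
        by (simp add: qr mat_def)
    qed
    have ND: "diag_mat d \<bullet> (S - Z') = 0" for d
    proof -
      have "diag_mat d \<bullet> (S - Z') = (\<Sum>i\<in>UNIV. \<Sum>j\<in>UNIV. (if i = j then d i else 0) * (S - Z') $ i $ j)"
        by (simp add: inner_vec_def)
      also have "\<dots> = 0"
        using dS by (intro sum.neutral ballI) auto
      finally show ?thesis .
    qed
    have "S - Z' \<in> gl_gamma \<gamma>"
      by (intro subspace_diff subspace_gl_gamma tensors SG a_gl Z'a)
    from gl_moment_props(2) [OF tensors this, of \<mu>]
    show ?thesis
      using ND a_diag [OF moment_one_diagonal] bracket_inner_pos [OF skew \<mu>0] by (metis div_by_0 divide_eq_0_iff less_irrefl)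
  qed
  ultimately have "moment_mat \<mu> \<bullet> Z' = l' * bracket_inner \<mu> \<mu>"
    by (simp add: inner_diff_right)
  then have eq: "moment_mat \<mu> \<bullet> diag_mat (\<lambda>i. Z' $ i $ i) = l' * bracket_inner \<mu> \<mu>"
    using a_diag [OF Z'a] by simp
  obtain i j m where t': "t = (i, j, m)"
    by (cases t) auto
  have "Z' $ m $ m - Z' $ i $ i - Z' $ j $ j = l'"
  proof (rule moment_mat_weights_ge(2) [OF skew _ eq])
    show "l' \<le> Z' $ c $ c - Z' $ a $ a - Z' $ b $ b" if "\<mu> (axis a 1) (axis b 1) $ c \<noteq> 0" for a b c
      using l' [of "(a, b, c)"] that by (simp add: nonzero_triples_def weight_inner [OF Z'a])
    show "\<mu> (axis i 1) (axis j 1) $ m \<noteq> 0"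
      using t by (simp add: t' nonzero_triples_def)
  qed
  then have "weight t \<bullet> Z' = l'"
    by (simp add: t' weight_inner [OF Z'a])
  then have sum: "weight t \<bullet> \<beta> + e * (weight t \<bullet> Z) = \<beta> \<bullet> \<beta> + e * (\<beta> \<bullet> Z)"
    by (simp add: Z'_def l'_def inner_add_right)
  have "e * (\<beta> \<bullet> Z) \<le> e * (weight t \<bullet> Z)"
    using lZ [OF t] e by (intro mult_left_mono) auto
  then show "weight t \<bullet> \<beta> = \<beta> \<bullet> \<beta>"
    using sum l [OF t] by linarith
  then show "weight t \<bullet> Z = \<beta> \<bullet> Z"
    using sum e by simp
qed

lemma span_differences:
  assumes "\<beta> \<in> a_gamma \<gamma>"
  shows "span ((\<lambda>t. weight t - \<beta>) ` nonzero_triples) \<subseteq> a_gamma \<gamma>"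
  using assms weight_a sub_a by (intro span_minimal) (auto intro: subspace_diff)

lemma hull_weights: "convex hull (weight ` nonzero_triples) \<subseteq> a_gamma \<gamma>"
  using weight_a sub_a by (intro hull_minimal) (auto simp: subspace_imp_convex)

lemma moment_attains_min:
  assumes \<beta>: "\<beta> \<in> a_gamma \<gamma>" and eq: "\<And>t. t \<in> nonzero_triples \<Longrightarrow> weight t \<bullet> \<beta> = \<beta> \<bullet> \<beta>"
    and sep: "\<And>H. \<forall>t\<in>nonzero_triples. (weight t - \<beta>) \<bullet> H \<le> 0 \<Longrightarrow> \<forall>t\<in>nonzero_triples. (weight t - \<beta>) \<bullet> H = 0"
  shows "\<exists>g\<in>stabilizer \<gamma>. \<forall>g'\<in>stabilizer \<gamma>. norm (moment g) \<le> norm (moment g')"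
proof -
  obtain H where H: "H \<in> span ((\<lambda>t. weight t - \<beta>) ` nonzero_triples)" "tilted_mean nonzero_triples coef weight H = \<beta>"
    using tilted_mean_attained [where C = coef and b = weight, OF finite_nonzero_triples nonzero_triples_nonempty coef_pos sep] by blast
  then have Ha: "H \<in> a_gamma \<gamma>"
    using span_differences [OF \<beta>] by blast
  have "norm (moment (mat_exp H)) \<le> norm (moment g')" if "g' \<in> stabilizer \<gamma>" for g'
    unfolding moment_exp(2) [OF Ha] H(2) using norm_moment_ge [OF \<beta> _ that] eq by simp
  then show ?thesis
    using moment_exp(1) [OF Ha] by blast
qed

lemma positive_solution_of_min:
  assumes g: "g \<in> stabilizer \<gamma>" and min: "\<And>g'. g' \<in> stabilizer \<gamma> \<Longrightarrow> norm (moment g) \<le> norm (moment g')"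
  shows "\<exists>\<beta> x. (\<forall>p\<in>weight ` nonzero_triples. x p > 0) \<and> (\<Sum>p\<in>weight ` nonzero_triples. x p *\<^sub>R p) = \<beta> \<and> (\<forall>p\<in>weight ` nonzero_triples. p \<bullet> \<beta> = \<beta> \<bullet> \<beta>)"
proof -
  let ?B = "weight ` nonzero_triples"
  have fin: "finite ?B"
    using finite_nonzero_triples by blast
  let ?K = "convex hull ?B"
  define \<beta> where "\<beta> = closest_point ?K 0"
  have K: "closed ?K" "?K \<noteq> {}"
    using fin nonzero_triples_nonempty by (auto simp: finite_imp_compact_convex_hull compact_imp_closed)
  have \<beta>K: "\<beta> \<in> ?K"
    unfolding \<beta>_def by (rule closest_point_in_set [OF K])
  then have \<beta>: "\<beta> \<in> a_gamma \<gamma>"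
    using hull_weights by blast
  have l: "\<beta> \<bullet> \<beta> \<le> weight t \<bullet> \<beta>" if "t \<in> nonzero_triples" for t
  proof -
    have "weight t \<in> ?K"
      using that by (intro hull_inc) auto
    then have "(0 - \<beta>) \<bullet> (weight t - \<beta>) \<le> 0"
      unfolding \<beta>_def by (intro closest_point_dot convex_convex_hull K(1))
    then show ?thesis
      by (simp add: inner_diff_right inner_commute)
  qed
  have le: "norm (moment g) \<le> norm \<beta>"
  proof (rule ccontr)
    assume "\<not> ?thesis"
    then have "0 < norm (moment g) - norm \<beta>" by simp
    then obtain H where H: "H \<in> span ((\<lambda>t. weight t - \<beta>) ` nonzero_triples)"
      "norm (tilted_mean nonzero_triples coef weight H - \<beta>) < norm (moment g) - norm \<beta>"
      using tilted_mean_approx [where C = coef and b = weight, OF finite_nonzero_triples nonzero_triples_nonempty coef_pos \<beta>K] by blast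
    then have Ha: "H \<in> a_gamma \<gamma>"
      using span_differences [OF \<beta>] by blast
    have "norm (moment g) \<le> norm (tilted_mean nonzero_triples coef weight H)"
      using min [OF moment_exp(1) [OF Ha]] unfolding moment_exp(2) [OF Ha] .
    then show False
      using H(2) norm_triangle_ineq2 [of "tilted_mean nonzero_triples coef weight H" \<beta>] by linarith
  qed
  have sep: "\<forall>p\<in>?B. (p - \<beta>) \<bullet> H = 0" if H: "\<forall>p\<in>?B. 0 \<le> (p - \<beta>) \<bullet> H" for H
  proof -
    define Z where "Z = orth_proj (\<bullet>) (a_gamma \<gamma>) H"
    have Z: "Z \<in> a_gamma \<gamma>"
      unfolding Z_def by (rule orth_proj_props [OF sub_a])
    have pZ: "(weight t - \<beta>) \<bullet> Z = (weight t - \<beta>) \<bullet> H" for t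
      using orth_proj_props(2) [OF sub_a subspace_diff [OF sub_a weight_a \<beta>], of H t]
      by (simp add: Z_def inner_commute)
    have wZ: "weight t \<bullet> Z = \<beta> \<bullet> Z" if "t \<in> nonzero_triples" for t
    proof (rule moment_minimum_rigid(2) [OF \<beta> l g le Z _ that])
      show "\<beta> \<bullet> Z \<le> weight s \<bullet> Z" if "s \<in> nonzero_triples" for s
        using bspec [OF H imageI [OF that]] pZ [of s] by (simp add: inner_diff_left)
    qed
    have "(weight t - \<beta>) \<bullet> H = 0" if "t \<in> nonzero_triples" for t
      using pZ [of t] wZ [OF that] unfolding inner_diff_left by linarith
    then show ?thesis
      by blast
  qed
  have "p \<bullet> \<beta> = \<beta> \<bullet> \<beta>" if "p \<in> ?B" for p
    using that moment_minimum_rigid(1) [OF \<beta> l g le \<beta> l] by auto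
  then show ?thesis
    using positive_combination [OF fin \<beta>K sep] by blast
qed

end

section \<open>The Gram matrix criterion\<close>

theorem theorem5p14:
  fixes \<gamma> :: "'n::finite tensor set"
    and integ :: "'n tensor set \<Rightarrow> 'n bracket \<Rightarrow> bool"
    and C :: "'n form set"
    and W :: "'n bracket set"
    and \<mu> :: "'n bracket"
    and \<beta>s :: "'n mat list"
  assumes "class_gamma_nilpotent integ C \<gamma> \<mu>"
    and "(\<bullet>) \<in> C"
    and "self_adjoint_group (stabilizer \<gamma>)"
    and "maximal_abelian_in (a_gamma \<gamma>) (p_gamma \<gamma>)"
    and "nice_space \<gamma> W"
    and "\<mu> \<in> W"
    and "\<mu> \<noteq> (\<lambda>X Y. 0)"
    and "distinct \<beta>s" and "set \<beta>s = weights_gamma \<gamma> \<mu>"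
  shows "(\<exists>ip. minimal_metric C \<gamma> \<mu> ip) \<longleftrightarrow>
    (\<exists>(x :: nat \<Rightarrow> real) (lam :: real).
       (\<forall>p<length \<beta>s. x p > 0) \<and>
       (\<forall>p<length \<beta>s. (\<Sum>q<length \<beta>s. gram \<beta>s p q * x q) = lam))"
proof -
  interpret nice_bracket \<gamma> W \<mu>
    using assms by unfold_locales (auto simp: class_gamma_nilpotent_def)
  have set: "set \<beta>s = weight ` nonzero_triples"
    using assms(9) weights_gamma_eq by simp
  have bij: "bij_betw ((!) \<beta>s) {..<length \<beta>s} (weight ` nonzero_triples)"
    using bij_betw_nth [OF assms(8), of "{..<length \<beta>s}" "set \<beta>s"] set by simp
  have nth: "\<beta>s ! p \<in> weight ` nonzero_triples" if "p < length \<beta>s" for p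
    using that set nth_mem by blast
  have nth_a: "\<beta>s ! p \<in> a_gamma \<gamma>" if "p < length \<beta>s" for p
    using nth [OF that] by (elim imageE) (simp only: weight_a)
  have gram: "(\<Sum>q<length \<beta>s. gram \<beta>s p q * x q) = (\<beta>s ! p) \<bullet> (\<Sum>q<length \<beta>s. x q *\<^sub>R \<beta>s ! q)" for p x
    by (simp add: gram_def mat_inner_eq_inner inner_sum_right mult.commute)
  have "(\<exists>ip. minimal_metric C \<gamma> \<mu> ip) \<longleftrightarrow>
      (\<exists>g\<in>stabilizer \<gamma>. \<forall>g'\<in>stabilizer \<gamma>. norm (moment g) \<le> norm (moment g'))"
    by (rule minimal_metric_iff_moment [OF assms(1,2,7)])
  also have "\<dots> \<longleftrightarrow> (\<exists>x lam. (\<forall>p<length \<beta>s. x p > 0) \<and>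
       (\<forall>p<length \<beta>s. (\<Sum>q<length \<beta>s. gram \<beta>s p q * x q) = lam))"
  proof
    assume "\<exists>g\<in>stabilizer \<gamma>. \<forall>g'\<in>stabilizer \<gamma>. norm (moment g) \<le> norm (moment g')"
    then obtain \<beta> y where y: "\<forall>p\<in>weight ` nonzero_triples. y p > 0" "(\<Sum>p\<in>weight ` nonzero_triples. y p *\<^sub>R p) = \<beta>"
      "\<forall>p\<in>weight ` nonzero_triples. p \<bullet> \<beta> = \<beta> \<bullet> \<beta>"
      using positive_solution_of_min by blast
    have "(\<Sum>q<length \<beta>s. y (\<beta>s ! q) *\<^sub>R \<beta>s ! q) = \<beta>"
      using sum.reindex_bij_betw [OF bij, of "\<lambda>p. y p *\<^sub>R p"] y(2) by simp
    then show "\<exists>x lam. (\<forall>p<length \<beta>s. x p > 0) \<and>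
        (\<forall>p<length \<beta>s. (\<Sum>q<length \<beta>s. gram \<beta>s p q * x q) = lam)"
      unfolding gram using bspec [OF y(1) nth] bspec [OF y(3) nth]
      by (intro exI [of _ "\<lambda>q. y (\<beta>s ! q)"] exI [of _ "\<beta> \<bullet> \<beta>"]) simp
  next
    assume "\<exists>x lam. (\<forall>p<length \<beta>s. x p > 0) \<and>
        (\<forall>p<length \<beta>s. (\<Sum>q<length \<beta>s. gram \<beta>s p q * x q) = lam)"
    then obtain x lam where x: "\<And>p. p < length \<beta>s \<Longrightarrow> x p > 0"
      and eq: "\<And>p. p < length \<beta>s \<Longrightarrow> (\<beta>s ! p) \<bullet> (\<Sum>q<length \<beta>s. x q *\<^sub>R \<beta>s ! q) = lam"
      unfolding gram by blast
    define s where "s = (\<Sum>q<length \<beta>s. x q)"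
    have "length \<beta>s > 0"
      using set nonzero_triples_nonempty by fastforce
    then have s: "s > 0"
      unfolding s_def using x by (intro sum_pos) auto
    define \<beta> where "\<beta> = (\<Sum>q<length \<beta>s. x q *\<^sub>R \<beta>s ! q) /\<^sub>R s"
    have \<beta>a: "\<beta> \<in> a_gamma \<gamma>"
      unfolding \<beta>_def using nth_a by (intro subspace_scale subspace_sum sub_a) auto
    have p\<beta>: "\<beta>s ! p \<bullet> \<beta> = lam / s" if "p < length \<beta>s" for p
      using eq [OF that] by (simp add: \<beta>_def divide_inverse mult.commute)
    have s\<beta>: "(\<Sum>q<length \<beta>s. x q *\<^sub>R \<beta>s ! q) = s *\<^sub>R \<beta>"
      using s by (simp add: \<beta>_def)
    have "s * (\<beta> \<bullet> \<beta>) = (\<Sum>q<length \<beta>s. x q * (\<beta>s ! q \<bullet> \<beta>))"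
      using arg_cong [OF s\<beta>, of "\<lambda>v. v \<bullet> \<beta>"] by (simp add: inner_sum_left)
    also have "\<dots> = (\<Sum>q<length \<beta>s. x q * (lam / s))"
      by (intro sum.cong refl) (simp add: p\<beta>)
    also have "\<dots> = s * (lam / s)"
      by (simp only: s_def sum_distrib_right)
    finally have \<beta>\<beta>: "\<beta> \<bullet> \<beta> = lam / s"
      using s by (simp add: field_simps)
    show "\<exists>g\<in>stabilizer \<gamma>. \<forall>g'\<in>stabilizer \<gamma>. norm (moment g) \<le> norm (moment g')"
    proof (rule moment_attains_min [OF \<beta>a])
      fix t assume "t \<in> nonzero_triples"
      then obtain p where "p < length \<beta>s" "weight t = \<beta>s ! p"
        using set by (metis image_eqI in_set_conv_nth)
      then show "weight t \<bullet> \<beta> = \<beta> \<bullet> \<beta>"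
        by (simp add: p\<beta> \<beta>\<beta>)
    next
      fix H assume H: "\<forall>t\<in>nonzero_triples. (weight t - \<beta>) \<bullet> H \<le> 0"
      have le: "(\<beta>s ! p - \<beta>) \<bullet> H \<le> 0" if "p < length \<beta>s" for p
        using nth [OF that] H by auto
      have "(\<Sum>q<length \<beta>s. x q * ((\<beta>s ! q - \<beta>) \<bullet> H)) = ((\<Sum>q<length \<beta>s. x q *\<^sub>R \<beta>s ! q) - s *\<^sub>R \<beta>) \<bullet> H"
        by (simp add: s_def inner_diff_left inner_sum_left right_diff_distrib sum_subtractf sum_distrib_right)
      then have "(\<Sum>q<length \<beta>s. x q * ((\<beta>s ! q - \<beta>) \<bullet> H)) = 0"
        by (simp add: s\<beta>)
      then have "(\<Sum>q<length \<beta>s. - (x q * ((\<beta>s ! q - \<beta>) \<bullet> H))) = 0"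
        by (simp add: sum_negf)
      then have z0: "\<forall>q\<in>{..<length \<beta>s}. - (x q * ((\<beta>s ! q - \<beta>) \<bullet> H)) = 0"
        using x le by (subst (asm) sum_nonneg_eq_0_iff) (auto simp: mult_le_0_iff less_imp_le)
      have z: "(\<beta>s ! q - \<beta>) \<bullet> H = 0" if "q < length \<beta>s" for q
      proof -
        have "x q * ((\<beta>s ! q - \<beta>) \<bullet> H) = 0"
          using bspec [OF z0, of q] that by (simp only: lessThan_iff neg_equal_0_iff_equal)
        then show ?thesis
          using x [OF that] by (metis mult_eq_0_iff less_irrefl)
      qed
      show "\<forall>t\<in>nonzero_triples. (weight t - \<beta>) \<bullet> H = 0"
      proof
        fix t assume "t \<in> nonzero_triples"
        then obtain p where "p < length \<beta>s" "weight t = \<beta>s ! p"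
          using set by (metis image_eqI in_set_conv_nth)
        then show "(weight t - \<beta>) \<bullet> H = 0"
          using z by simp
      qed
    qed
  qed
  finally show ?thesis .
qed

end
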